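(* Let $f=f(x,v)$ be real-analytic on $\{v<0\}\cup\{v>0\}$ and with $\rho=\int f\,dv$ real-analytic on $\mathbb{R}$. Put $H(x,v)=\frac{v^2}{2}+\Phi(\rho(x))$. Then $f$ is a weak stationary state of the Vlasov equation $\partial_t f+v\,\partial_x f-\partial_x\Phi(\rho)\,\partial_v f=0$, $\rho=\int f\,dv$, if and only if there exist real-analytic functions $F_1,F_2$ such that $$f(x,v)=\begin{cases}F_1\bigl(H(x,v)\bigr), & v>0,\\ F_2\bigl(H(x,v)\bigr), & v<0.\end{cases}$$ Moreover, $$\rho(x)=\int_0^\infty\Bigl[F_1\Bigl(\frac{v^2}{2}+\Phi(\rho(x))\Bigr)+F_2\Bigl(\frac{v^2}{2}+\Phi(\rho(x))\Bigr)\Bigr]dv,$$ and for every $z\in\mathbb{R}$ which is not a critical value of $\Phi(\rho)$ one has $F_1(z)=F_2(z)$.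
   Context: Here $(x,v)\in\mathbb{R}_x\times\mathbb{R}_v$ (one space and one velocity dimension). The function $\Phi:\mathbb{R}\to\mathbb{R}$ is real-analytic on $(-R,R)$ for some $R>0$, meaning that there are real coefficients $c_n$ with $\Phi(z)=\sum_{n\ge0}c_nz^n$ for all $|z|<R$. Weak stationary state: a function $f\in L^1_{\rm loc}(\mathbb{R}_x\times\mathbb{R}_v)$ is a weak stationary state if $f(x,\cdot)\in L^1(\mathbb{R}_v)$ for a.e. $x\in\mathbb{R}$, $\Phi(\rho)\in W^{1,\infty}_{\rm loc}(\mathbb{R})$ where $\rho(x)=\int f(x,v)\,dv$, and $v\,\partial_xf-\partial_x\Phi(\rho)\,\partial_vf=0$ holds in the sense of distributions. The functions $F_1,F_2$ are functions of the energy, obtained on the energy range $(m,\infty)$, where $m=\inf_{x\in\mathbb{R}}\Phi(\rho(x))$. $\Phi(\rho)$ denotes the function $x\mapsto\Phi(\rho(x))$; a critical value of it is a value attained at a point $x$ where its derivative vanishes.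
   Formalization: The "if" direction also assumes F1(z)=F2(z) at all non-critical z>m when Φ(ρ) is not constant (false without it); F1=F2 is claimed only for non-constant Φ(ρ) (false for constant); Φ(ρ) in W^{1,∞}_loc is read as including continuity. *)

theory Defs
  imports "HOL-Analysis.Analysis"
begin

section \<open>Real-analytic functions of one and of two real variables\<close>

definition real_analytic_on :: "(real \<Rightarrow> real) \<Rightarrow> real set \<Rightarrow> bool"
    (infixl "real'_analytic'_on" 50) where
  "F real_analytic_on S \<longleftrightarrow>
     (\<forall>a\<in>S. \<exists>c::nat \<Rightarrow> real. \<exists>r>0. \<forall>x. \<bar>x - a\<bar> < r \<longrightarrow>
        (\<lambda>n. c n * (x - a) ^ n) sums F x)"

definition real_analytic2_on :: "(real \<times> real \<Rightarrow> real) \<Rightarrow> (real \<times> real) set \<Rightarrow> bool"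
    (infixl "real'_analytic2'_on" 50) where
  "f real_analytic2_on S \<longleftrightarrow>
     (\<forall>(a, b)\<in>S. \<exists>c::nat \<Rightarrow> nat \<Rightarrow> real. \<exists>r>0. \<forall>x v. \<bar>x - a\<bar> < r \<and> \<bar>v - b\<bar> < r \<longrightarrow>
        ((\<lambda>(i, j). c i j * (x - a) ^ i * (v - b) ^ j) has_sum f (x, v)) UNIV)"


section \<open>Test functions and local function spaces\<close>

primrec C_order :: "nat \<Rightarrow> ('a::euclidean_space \<Rightarrow> real) \<Rightarrow> bool" where
  "C_order 0 \<psi> \<longleftrightarrow> continuous_on UNIV \<psi>"
| "C_order (Suc k) \<psi> \<longleftrightarrow>
     (\<forall>p. \<psi> differentiable (at p)) \<and>
     (\<forall>e\<in>Basis. C_order k (\<lambda>p. frechet_derivative \<psi> (at p) e))"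

definition test_fun :: "('a::euclidean_space \<Rightarrow> real) \<Rightarrow> bool" where
  "test_fun \<psi> \<longleftrightarrow> (\<forall>k. C_order k \<psi>) \<and> compact (closure {p. \<psi> p \<noteq> 0})"

definition L1_loc :: "('a::euclidean_space \<Rightarrow> real) \<Rightarrow> bool" where
  "L1_loc g \<longleftrightarrow> (\<forall>K. compact K \<longrightarrow> g absolutely_integrable_on K)"

definition Linf_loc :: "('a::euclidean_space \<Rightarrow> real) \<Rightarrow> bool" where
  "Linf_loc g \<longleftrightarrow> g \<in> borel_measurable lebesgue \<and>
     (\<forall>K. compact K \<longrightarrow> (\<exists>B. AE p in lebesgue. p \<in> K \<longrightarrow> \<bar>g p\<bar> \<le> B))"

definition weak_derivative :: "(real \<Rightarrow> real) \<Rightarrow> (real \<Rightarrow> real) \<Rightarrow> bool" where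
  "weak_derivative g h \<longleftrightarrow>
     (\<forall>\<psi>. test_fun \<psi> \<longrightarrow>
        (LINT x|lebesgue. g x * deriv \<psi> x) = - (LINT x|lebesgue. h x * \<psi> x))"

text \<open>
  Membership of \<open>g\<close> in the local Sobolev space $W^{1,\infty}_{loc}$ of the line, with weak
  derivative \<open>h\<close>.  A Sobolev class on the line is identified, as usual, with its continuous
  representative; since \<open>g\<close> is a function and not a class, this is the clause
  \<^term>\<open>continuous_on UNIV g\<close>.  It cannot be dropped: an arbitrary \<open>\<Phi>\<close> may be changed at one point
  that \<open>\<rho>\<close> meets only on a null set, which would not be seen almost everywhere.
\<close>

definition W1inf_loc :: "(real \<Rightarrow> real) \<Rightarrow> (real \<Rightarrow> real) \<Rightarrow> bool" where
  "W1inf_loc g h \<longleftrightarrow>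
     continuous_on UNIV g \<and> Linf_loc g \<and> Linf_loc h \<and> weak_derivative g h"


section \<open>Weak stationary states\<close>

definition rho :: "(real \<times> real \<Rightarrow> real) \<Rightarrow> real \<Rightarrow> real" where
  "rho f x = (LINT v|lebesgue. f (x, v))"

definition potential :: "(real \<Rightarrow> real) \<Rightarrow> (real \<times> real \<Rightarrow> real) \<Rightarrow> real \<Rightarrow> real" where
  "potential \<Phi> f x = \<Phi> (rho f x)"

text \<open>
  The weak derivative \<open>h\<close> of the potential is unique up to null sets and depends on \<open>x\<close> only, so
  the distribution $v\,\partial_x f - h\,\partial_v f$ is $\partial_x(v f) - \partial_v(h f)$; below
  it is tested against \<open>\<psi>\<close>.
\<close>

definition weak_stationary_state :: "(real \<Rightarrow> real) \<Rightarrow> (real \<times> real \<Rightarrow> real) \<Rightarrow> bool" where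
  "weak_stationary_state \<Phi> f \<longleftrightarrow>
     L1_loc f \<and>
     (AE x in lebesgue. integrable lebesgue (\<lambda>v. f (x, v))) \<and>
     (\<exists>h. W1inf_loc (potential \<Phi> f) h \<and>
        (\<forall>\<psi>. test_fun \<psi> \<longrightarrow>
           (LINT p|lebesgue. f p *
              (h (fst p) * frechet_derivative \<psi> (at p) (0, 1)
               - snd p * frechet_derivative \<psi> (at p) (1, 0))) = 0))"


section \<open>Functions of the energy\<close>

definition energy :: "(real \<Rightarrow> real) \<Rightarrow> (real \<times> real \<Rightarrow> real) \<Rightarrow> real \<Rightarrow> real \<Rightarrow> real" where
  "energy \<Phi> f x v = v\<^sup>2 / 2 + potential \<Phi> f x"

text \<open>The interval \<open>(m, \<infinity>)\<close>; the infimum \<open>m\<close> may be \<open>-\<infinity>\<close>, hence \<^typ>\<open>ereal\<close>.\<close>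

definition energy_range :: "(real \<Rightarrow> real) \<Rightarrow> (real \<times> real \<Rightarrow> real) \<Rightarrow> real set" where
  "energy_range \<Phi> f = {z. (INF x. ereal (potential \<Phi> f x)) < ereal z}"

definition critical_value :: "(real \<Rightarrow> real) \<Rightarrow> real \<Rightarrow> bool" where
  "critical_value g z \<longleftrightarrow> (\<exists>x. g x = z \<and> (g has_real_derivative 0) (at x))"

definition energy_profiles ::
  "(real \<Rightarrow> real) \<Rightarrow> (real \<times> real \<Rightarrow> real) \<Rightarrow> (real \<Rightarrow> real) \<Rightarrow> (real \<Rightarrow> real) \<Rightarrow> bool" where
  "energy_profiles \<Phi> f F1 F2 \<longleftrightarrow>
     F1 real_analytic_on energy_range \<Phi> f \<and>
     F2 real_analytic_on energy_range \<Phi> f \<and>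
     (\<forall>x v. (v > 0 \<longrightarrow> f (x, v) = F1 (energy \<Phi> f x v)) \<and>
            (v < 0 \<longrightarrow> f (x, v) = F2 (energy \<Phi> f x v)))"

text \<open>
  For a constant potential every energy above \<open>m\<close> is vacuously non-critical, while every
  integrable $f(v)$ analytic off $v = 0$ is stationary, with \<open>F1\<close> and \<open>F2\<close> unrelated.  Equality at
  non-critical values is therefore a condition on non-constant potentials only.
\<close>

definition profiles_match ::
  "(real \<Rightarrow> real) \<Rightarrow> (real \<times> real \<Rightarrow> real) \<Rightarrow> (real \<Rightarrow> real) \<Rightarrow> (real \<Rightarrow> real) \<Rightarrow> bool" where
  "profiles_match \<Phi> f F1 F2 \<longleftrightarrow>
     (\<not> potential \<Phi> f constant_on UNIV \<longrightarrow>
       (\<forall>z\<in>energy_range \<Phi> f. \<not> critical_value (potential \<Phi> f) z \<longrightarrow> F1 z = F2 z))"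

end

theory Submission
  imports Defs "HOL-Complex_Analysis.Complex_Analysis"
begin

text \<open>
  Write \<open>g = \<Phi> \<circ> \<rho>\<close> and \<open>H = v\<^sup>2 / 2 + g\<close>, and let \<open>h\<close> be the weak derivative of \<open>g\<close>.

  Let \<open>f\<close> be stationary. Testing with \<open>\<phi> x * \<theta> v\<close>, \<open>\<theta>\<close> supported in \<open>v > 0\<close>, and the lemma of du
  Bois-Reymond show that \<open>\<integral> v \<theta> f dv\<close> is a primitive of \<open>- h \<integral> \<theta>' f dv\<close>. Hence at every \<open>x\<close> there is a
  \<open>d\<close> with \<open>v f\<^sub>x = d f\<^sub>v\<close> for all \<open>v > 0\<close>, and \<open>d\<close> is the derivative of \<open>g\<close> at \<open>x\<close> unless \<open>f\<^sub>v\<close> vanishes there.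
  So \<open>x \<mapsto> f (x, sqrt (2 (E - g x)))\<close> has derivative zero, and by the identity theorem its value
  \<open>F1 E\<close> is the same on all components of \<open>{g < E}\<close>. Reflecting \<open>v\<close> gives \<open>F2\<close>.

  If a profile \<open>F\<close> does not vanish, then \<open>g\<close> is analytic on the line: integrability of \<open>f (x, \<cdot>)\<close> excludes
  that \<open>F\<close> is eventually periodic, so \<open>g x\<close> is determined by \<open>f (x, \<cdot>)\<close>; inverting \<open>F\<close> locally shows that \<open>g\<close> is
  analytic near every limit point of a set \<open>{\<bar>g\<bar> \<le> B}\<close>, and at an end point \<open>b\<close> of a maximal interval of
  analyticity \<open>\<bar>g\<bar>\<close> would tend to infinity, which makes \<open>f (b, \<cdot>)\<close> constant. Test functions
  concentrating at \<open>v = 0\<close> give \<open>(F1 - F2) (g x) * g' x = 0\<close>, whence \<open>F1 = F2\<close> if \<open>g\<close> is not constant.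

  Conversely, for non-constant \<open>g\<close> the equality off the countably many critical values extends to all
  energies, and \<open>f = F \<circ> H\<close> can be singular only at \<open>v = 0\<close> over a minimum of \<open>g\<close>. There \<open>g - min g\<close>
  vanishes to finite order and a substitution bounds the integral of \<open>\<bar>f\<bar>\<close> by that over one line;
  the weak equation follows by cutting \<open>F\<close> off near the least energy.
\<close>

section \<open>Real-analytic functions of one variable\<close>

text \<open>Three obstacles shape the argument. \<open>rho f\<close> may leave (-R, R), where
  \<open>\<Phi>\<close> is arbitrary, so the regularity of \<open>g\<close> has to be recovered from
  \<open>f\<close>, whose restrictions to lines v = const with v nonzero are analytic in x. The
  recovery needs that \<open>F\<close> distinguishes any two shifts of the energy. A period is
  excluded because dv = dE / sqrt (2 (E - g)): the slice integral of a nonzero periodic function of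
  E diverges like the integral of 1 / sqrt E. Moreover \<open>h\<close> is determined only almost
  everywhere, while the characteristic argument needs a slope at every single x. A product of
  \<open>h\<close> with a continuous factor is therefore frozen at a point: the error, the integral
  of \<open>h\<close> times the increment of the factor, is of smaller order than the length of the
  interval. The same device serves for the slope \<open>d\<close> and for the jump across v = 0.
  Finally, integrability of every slice does not by itself give local integrability in the plane,
  since \<open>F\<close> may be singular at the least energy and nothing is assumed uniformly in
  x.\<close>

definition cx_ext :: "(real \<Rightarrow> real) \<Rightarrow> real \<Rightarrow> real \<Rightarrow> (complex \<Rightarrow> complex) \<Rightarrow> bool" where
  "cx_ext F a r \<phi> \<longleftrightarrow> r > 0 \<and> \<phi> holomorphic_on ball (of_real a) r \<and>
     (\<forall>x. \<bar>x - a\<bar> < r \<longrightarrow> \<phi> (of_real x) = of_real (F x))"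

text \<open>Real parts of the Taylor series at a real centre have real coefficients. Only the real
  part of \<open>\<phi>\<close> has to agree with \<open>F\<close> on the axis, which suits the
  local inverse below: its values on the axis are not shown to be real.\<close>

lemma real_analytic_on_Re:
  assumes "\<phi> holomorphic_on ball (of_real a) r" "r > 0"
    and "\<And>x. \<bar>x - a\<bar> < r \<Longrightarrow> F x = Re (\<phi> (of_real x))"
  shows "F real_analytic_on {a}"
proof -
  let ?d = "\<lambda>n. (deriv ^^ n) \<phi> (of_real a) / fact n"
  have "(\<lambda>n. Re (?d n) * (x - a) ^ n) sums F x" if "\<bar>x - a\<bar> < r" for x
  proof -
    have "complex_of_real x \<in> ball (of_real a) r"
      using that by (simp add: dist_of_real dist_real_def abs_minus_commute)
    from holomorphic_power_series[OF assms(1) this]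
    have "(\<lambda>n. Re (?d n * (of_real x - of_real a) ^ n)) sums Re (\<phi> (of_real x))"
      by (rule sums_Re)
    moreover have "Re (?d n * (of_real x - of_real a) ^ n) = Re (?d n) * (x - a) ^ n" for n
    proof -
      have "(complex_of_real x - of_real a) ^ n = of_real ((x - a) ^ n)" by simp
      then show ?thesis by (simp del: of_real_power of_real_diff times_divide_eq_left)
    qed
    ultimately show ?thesis using assms(3)[OF that] by (simp del: times_divide_eq_left)
  qed
  then show ?thesis unfolding real_analytic_on_def using assms(2)
    by (intro ballI exI[of _ "\<lambda>n. Re (?d n)"] exI[of _ r]) auto
qed

lemma real_analytic_on_singletonI: "(\<And>a. a \<in> S \<Longrightarrow> F real_analytic_on {a}) \<Longrightarrow> F real_analytic_on S"
  unfolding real_analytic_on_def by blast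

lemma real_analytic_on_subset: "F real_analytic_on S \<Longrightarrow> T \<subseteq> S \<Longrightarrow> F real_analytic_on T"
  unfolding real_analytic_on_def by blast

text \<open>The same coefficients define the extension; at a complex point the series converges
  because it does so at a real point farther from \<open>a\<close>. Closure properties, the identity
  theorem and local inversion are imported from holomorphic functions in this way.\<close>

lemma real_analytic_on_cx_ext:
  assumes "F real_analytic_on S" "a \<in> S"
  obtains r \<phi> where "cx_ext F a r \<phi>"
proof -
  obtain c r where r: "r > 0" and c: "\<And>x. \<bar>x - a\<bar> < r \<Longrightarrow> (\<lambda>n. c n * (x - a) ^ n) sums F x"
    using assms unfolding real_analytic_on_def by meson
  define \<phi> where "\<phi> z = (\<Sum>n. complex_of_real (c n) * (z - of_real a) ^ n)" for z
  have summ: "summable (\<lambda>n. complex_of_real (c n) * (z - of_real a) ^ n)"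
    if z: "z \<in> ball (of_real a) r" for z
  proof -
    define t where "t = (cmod (z - of_real a) + r) / 2"
    have t: "cmod (z - of_real a) < t" "t < r" "0 < t"
      using z r by (auto simp: t_def dist_norm norm_minus_commute add_pos_nonneg add_nonneg_pos)
    have "summable (\<lambda>n. c n * t ^ n)"
      using c[of "a + t"] t by (auto simp: sums_iff)
    then have "summable (\<lambda>n. complex_of_real (c n * t ^ n))" by (rule summable_of_real)
    then have "summable (\<lambda>n. complex_of_real (c n) * complex_of_real t ^ n)" by simp
    then show ?thesis by (rule powser_inside) (use t in simp)
  qed
  have "\<phi> holomorphic_on ball (of_real a) r"
    by (rule power_series_holomorphic) (use summ in \<open>auto simp: \<phi>_def intro: summable_sums\<close>)
  moreover have "\<phi> (of_real x) = of_real (F x)" if "\<bar>x - a\<bar> < r" for x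
  proof -
    have "(\<lambda>n. complex_of_real (c n * (x - a) ^ n)) sums of_real (F x)"
      using c[OF that] by (rule sums_of_real)
    then show ?thesis by (simp add: \<phi>_def sums_iff)
  qed
  ultimately show ?thesis using that r unfolding cx_ext_def by blast
qed

lemma cx_ext_imp_real_analytic: "cx_ext F a r \<phi> \<Longrightarrow> F real_analytic_on {a}"
  by (rule real_analytic_on_Re[of \<phi> a r]) (auto simp: cx_ext_def)

lemma cx_ext_shrink: "cx_ext F a r \<phi> \<Longrightarrow> 0 < s \<Longrightarrow> s \<le> r \<Longrightarrow> cx_ext F a s \<phi>"
  unfolding cx_ext_def by (auto intro: holomorphic_on_subset)

lemma cx_ext_deriv:
  assumes "cx_ext F a r \<phi>" "\<bar>x - a\<bar> < r"
  shows "(F has_real_derivative deriv F x) (at x)"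
    and "deriv \<phi> (of_real x) = of_real (deriv F x)"
proof -
  have xb: "complex_of_real x \<in> ball (of_real a) r"
    using assms(2) by (simp add: dist_of_real dist_real_def abs_minus_commute)
  have "(\<phi> has_field_derivative deriv \<phi> (of_real x)) (at (of_real x))"
    using assms(1) xb holomorphic_derivI[of \<phi> "ball (of_real a) r" "of_real x"]
    unfolding cx_ext_def by auto
  then have "((\<lambda>x. \<phi> (of_real x)) has_vector_derivative deriv \<phi> (of_real x)) (at x)"
    by (rule has_vector_derivative_real_field)
  then have vd: "((\<lambda>x. complex_of_real (F x)) has_vector_derivative deriv \<phi> (of_real x)) (at x)"
    by (rule has_vector_derivative_transform_within_open[where S = "ball a r"])
       (use assms in \<open>auto simp: cx_ext_def dist_real_def abs_minus_commute\<close>)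
  have re: "(F has_real_derivative Re (deriv \<phi> (of_real x))) (at x)"
    using bounded_linear.has_vector_derivative[OF bounded_linear_Re vd]
    by (simp add: has_real_derivative_iff_has_vector_derivative)
  \<comment> \<open>The extension is real on the axis, so the imaginary part of its derivative is
    the derivative of the zero function.\<close>
  have "((\<lambda>x. 0::real) has_vector_derivative Im (deriv \<phi> (of_real x))) (at x)"
    using bounded_linear.has_vector_derivative[OF bounded_linear_Im vd] by simp
  then have "Im (deriv \<phi> (of_real x)) = 0"
    using vector_derivative_unique_at has_vector_derivative_const by blast
  moreover have "deriv F x = Re (deriv \<phi> (of_real x))" using re by (rule DERIV_imp_deriv)
  ultimately show "(F has_real_derivative deriv F x) (at x)"
    "deriv \<phi> (of_real x) = of_real (deriv F x)" using re by (auto simp: complex_eq_iff)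
qed

lemma real_analytic_on_has_deriv:
  assumes "F real_analytic_on S" "a \<in> S"
  shows "(F has_real_derivative deriv F a) (at a)"
  using real_analytic_on_cx_ext[OF assms] cx_ext_deriv(1)[of F a _ _ a] by (metis abs_zero cx_ext_def diff_self)

lemma real_analytic_on_isCont: "F real_analytic_on S \<Longrightarrow> a \<in> S \<Longrightarrow> isCont F a"
  using real_analytic_on_has_deriv DERIV_isCont by blast

lemma real_analytic_on_continuous_on: "F real_analytic_on S \<Longrightarrow> continuous_on S F"
  by (meson continuous_at_imp_continuous_on real_analytic_on_isCont)

lemma cx_ext_deriv_ext: "cx_ext F a r \<phi> \<Longrightarrow> cx_ext (deriv F) a r (deriv \<phi>)"
  using cx_ext_deriv(2)[of F a r \<phi>] unfolding cx_ext_def by (auto intro: holomorphic_deriv)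

lemma real_analytic_on_deriv:
  assumes "F real_analytic_on S" shows "deriv F real_analytic_on S"
  by (meson assms cx_ext_deriv_ext cx_ext_imp_real_analytic real_analytic_on_cx_ext real_analytic_on_singletonI)

lemma real_analytic_on_cong_nhds:
  assumes "F real_analytic_on {a}" "eventually (\<lambda>x. F x = G x) (nhds a)"
  shows "G real_analytic_on {a}"
proof -
  obtain r \<phi> where r: "cx_ext F a r \<phi>" using real_analytic_on_cx_ext[OF assms(1)] by blast
  obtain d where d: "d > 0" "\<And>x. dist x a < d \<Longrightarrow> F x = G x"
    using assms(2) unfolding eventually_nhds_metric by blast
  have "cx_ext F a (min r d) \<phi>" by (rule cx_ext_shrink[OF r]) (use r d in \<open>auto simp: cx_ext_def\<close>)
  then have "cx_ext G a (min r d) \<phi>" using d unfolding cx_ext_def by (simp add: dist_real_def)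
  then show ?thesis by (rule cx_ext_imp_real_analytic)
qed

section \<open>Closure properties of real-analytic functions\<close>

lemma real_analytic_on_const: "(\<lambda>x. c) real_analytic_on S"
proof (rule real_analytic_on_singletonI)
  fix a have "cx_ext (\<lambda>x. c) a 1 (\<lambda>z. of_real c)" by (simp add: cx_ext_def)
  then show "(\<lambda>x. c) real_analytic_on {a}" by (rule cx_ext_imp_real_analytic)
qed

lemma real_analytic_on_ident: "(\<lambda>x. x) real_analytic_on S"
proof (rule real_analytic_on_singletonI)
  fix a have "cx_ext (\<lambda>x. x) a 1 (\<lambda>z. z)" by (simp add: cx_ext_def)
  then show "(\<lambda>x. x) real_analytic_on {a}" by (rule cx_ext_imp_real_analytic)
qed

text \<open>Sum, difference and product share one argument: \<open>opc\<close> is the complex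
  operation, \<open>opr\<close> its restriction to the reals, and the two radii are replaced by
  their minimum.\<close>

lemma real_analytic_on_binop:
  assumes "F real_analytic_on S" "G real_analytic_on S"
    and hol: "\<And>\<phi> \<psi> U. \<phi> holomorphic_on U \<Longrightarrow> \<psi> holomorphic_on U \<Longrightarrow> (\<lambda>z. opc (\<phi> z) (\<psi> z)) holomorphic_on U"
    and op: "\<And>x y. opc (complex_of_real x) (of_real y) = of_real (opr x y)"
  shows "(\<lambda>x. opr (F x) (G x)) real_analytic_on S"
proof (rule real_analytic_on_singletonI)
  fix a assume a: "a \<in> S"
  obtain r \<phi> where r: "cx_ext F a r \<phi>" using real_analytic_on_cx_ext[OF assms(1) a] by blast
  obtain s \<psi> where s: "cx_ext G a s \<psi>" using real_analytic_on_cx_ext[OF assms(2) a] by blast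
  have pos: "0 < min r s" using r s by (auto simp: cx_ext_def)
  have "cx_ext F a (min r s) \<phi>" "cx_ext G a (min r s) \<psi>"
    using cx_ext_shrink[OF r pos] cx_ext_shrink[OF s pos] by auto
  then have "cx_ext (\<lambda>x. opr (F x) (G x)) a (min r s) (\<lambda>z. opc (\<phi> z) (\<psi> z))"
    unfolding cx_ext_def by (auto intro!: hol simp: op)
  then show "(\<lambda>x. opr (F x) (G x)) real_analytic_on {a}" by (rule cx_ext_imp_real_analytic)
qed

lemma real_analytic_on_add:
  "F real_analytic_on S \<Longrightarrow> G real_analytic_on S \<Longrightarrow> (\<lambda>x. F x + G x) real_analytic_on S"
  by (rule real_analytic_on_binop[where opc = "(+)"]) (auto intro: holomorphic_intros)

lemma real_analytic_on_diff:
  "F real_analytic_on S \<Longrightarrow> G real_analytic_on S \<Longrightarrow> (\<lambda>x. F x - G x) real_analytic_on S"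
  by (rule real_analytic_on_binop[where opc = "(-)"]) (auto intro: holomorphic_intros)

lemma real_analytic_on_mult:
  "F real_analytic_on S \<Longrightarrow> G real_analytic_on S \<Longrightarrow> (\<lambda>x. F x * G x) real_analytic_on S"
  by (rule real_analytic_on_binop[where opc = "(*)"]) (auto intro: holomorphic_intros)

lemma real_analytic_on_compose:
  assumes F: "F real_analytic_on T" and G: "G real_analytic_on S" and sub: "G ` S \<subseteq> T"
  shows "(\<lambda>x. F (G x)) real_analytic_on S"
proof (rule real_analytic_on_singletonI)
  fix a assume a: "a \<in> S"
  obtain r \<phi> where r: "cx_ext F (G a) r \<phi>" using real_analytic_on_cx_ext[OF F] a sub by blast
  obtain s \<psi> where s: "cx_ext G a s \<psi>" using real_analytic_on_cx_ext[OF G a] by blast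
  have "isCont \<psi> (of_real a)"
    using s unfolding cx_ext_def
    by (metis centre_in_ball continuous_on_interior holomorphic_on_imp_continuous_on interior_ball)
  then obtain d where d: "d > 0" "\<And>z. dist z (of_real a) < d \<Longrightarrow> dist (\<psi> z) (\<psi> (of_real a)) < r"
    using r unfolding continuous_at_eps_delta cx_ext_def by (metis dist_commute)
  have pos: "0 < min s d" using s d by (auto simp: cx_ext_def)
  have s': "cx_ext G a (min s d) \<psi>" using cx_ext_shrink[OF s pos] by auto
  have \<psi>a: "\<psi> (of_real a) = of_real (G a)" using s by (simp add: cx_ext_def)
  have "(\<phi> \<circ> \<psi>) holomorphic_on ball (of_real a) (min s d)"
    by (rule holomorphic_on_compose_gen[of _ _ _ "ball (of_real (G a)) r"])
       (use s' r d \<psi>a in \<open>auto simp: cx_ext_def dist_commute\<close>)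
  moreover have "\<phi> (\<psi> (of_real x)) = of_real (F (G x))" if "\<bar>x - a\<bar> < min s d" for x
  proof -
    have e: "\<psi> (of_real x) = of_real (G x)" using s' that by (auto simp: cx_ext_def)
    have "dist (complex_of_real x) (of_real a) < d" using that by (simp add: dist_of_real dist_real_def)
    then have "dist (complex_of_real (G x)) (of_real (G a)) < r" using d(2) e \<psi>a by metis
    then have "\<bar>G x - G a\<bar> < r" by (simp add: dist_of_real dist_real_def)
    then show ?thesis using r e by (auto simp: cx_ext_def)
  qed
  ultimately have "cx_ext (\<lambda>x. F (G x)) a (min s d) (\<phi> \<circ> \<psi>)"
    using pos by (auto simp: cx_ext_def)
  then show "(\<lambda>x. F (G x)) real_analytic_on {a}" by (rule cx_ext_imp_real_analytic)
qed

lemma real_analytic_on_sqrt: "sqrt real_analytic_on {0<..}"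
proof (rule real_analytic_on_singletonI)
  fix a :: real assume "a \<in> {0<..}"
  then have a: "a > 0" by simp
  have sub: "ball (complex_of_real a) a \<subseteq> - \<real>\<^sub>\<le>\<^sub>0"
  proof
    fix z assume "z \<in> ball (complex_of_real a) a"
    then have "cmod (of_real a - z) < a" by (simp add: dist_norm)
    then have "Re (of_real a - z) < a" using complex_Re_le_cmod[of "of_real a - z"] by linarith
    then show "z \<in> - \<real>\<^sub>\<le>\<^sub>0" by (auto simp: complex_nonpos_Reals_iff)
  qed
  have "cx_ext sqrt a a csqrt"
    unfolding cx_ext_def using a by (auto intro: holomorphic_on_subset[OF holomorphic_on_csqrt sub] simp: csqrt_of_real_nonneg)
  then show "sqrt real_analytic_on {a}" by (rule cx_ext_imp_real_analytic)
qed

section \<open>Zeros, the identity theorem and local inversion\<close>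

lemma cx_ext_zeros:
  assumes "cx_ext F a r \<phi>" and "a islimpt {x. F x = 0}" and "z \<in> ball (of_real a) r"
  shows "\<phi> z = 0"
proof -
  let ?U = "complex_of_real ` {x. F x = 0 \<and> \<bar>x - a\<bar> < r}"
  have r: "r > 0" using assms(1) by (simp add: cx_ext_def)
  have "complex_of_real a islimpt ?U"
    unfolding islimpt_approachable
  proof (intro allI impI)
    fix e :: real assume "e > 0"
    then have "0 < min e r" using r by simp
    then obtain x where "F x = 0" "x \<noteq> a" "dist x a < min e r"
      using assms(2) unfolding islimpt_approachable by blast
    then show "\<exists>x'\<in>?U. x' \<noteq> complex_of_real a \<and> dist x' (complex_of_real a) < e"
      by (intro bexI[of _ "of_real x"]) (auto simp: dist_of_real dist_real_def)
  qed
  then show ?thesis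
    by (rule analytic_continuation[where U = ?U and S = "ball (of_real a) r" and f = \<phi>, rotated 5])
       (use assms r in \<open>auto simp: cx_ext_def dist_of_real dist_real_def abs_minus_commute\<close>)
qed

lemma real_analytic_on_locally_zero:
  assumes "F real_analytic_on {a}" "a islimpt {x. F x = 0}"
  shows "eventually (\<lambda>x. F x = 0) (nhds a)"
proof -
  obtain r \<phi> where r: "cx_ext F a r \<phi>" using real_analytic_on_cx_ext[OF assms(1)] by blast
  have "F x = 0" if "dist x a < r" for x
    using cx_ext_zeros[OF r assms(2), of "of_real x"] r that
    by (auto simp: cx_ext_def dist_of_real dist_real_def abs_minus_commute)
  then show ?thesis using r unfolding eventually_nhds_metric cx_ext_def by blast
qed

text \<open>The limit points of the zero set that lie in \<open>U\<close> form a relatively closed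
  set, and an open one because \<open>F\<close> vanishes near each of them; connectedness
  finishes.\<close>

lemma real_analytic_identity:
  assumes F: "F real_analytic_on U" and U: "open U" "connected U"
    and a: "a \<in> U" "a islimpt {x. F x = 0}" and x: "x \<in> U"
  shows "F x = 0"
proof -
  let ?A = "{y\<in>U. y islimpt {x. F x = 0}}"
  have nz: "eventually (\<lambda>x. F x = 0) (nhds y)" if "y \<in> ?A" for y
    using real_analytic_on_locally_zero[of F y] F that real_analytic_on_subset[of F U "{y}"] by auto
  have "openin (top_of_set U) ?A"
  proof (subst openin_open_eq[OF U(1)], intro conjI)
    show "open ?A"
    proof (rule Topological_Spaces.openI)
      fix y assume y: "y \<in> ?A"
      obtain T where T: "open T" "y \<in> T" "\<And>x. x \<in> T \<Longrightarrow> F x = 0"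
        using nz[OF y] unfolding eventually_nhds by blast
      have "z islimpt {x. F x = 0}" if "z \<in> T" for z
      proof -
        have "z islimpt T" using T(1) that by (simp add: interior_limit_point interior_open)
        then show ?thesis by (rule islimpt_subset) (use T in auto)
      qed
      then show "\<exists>T. open T \<and> y \<in> T \<and> T \<subseteq> ?A"
        using T U y by (intro exI[of _ "T \<inter> U"]) auto
    qed
  qed auto
  moreover have "closedin (top_of_set U) ?A"
  proof -
    have "closed {y. y islimpt {x. F x = 0}}" by (rule closed_limpts)
    moreover have "?A = U \<inter> {y. y islimpt {x. F x = 0}}" by auto
    ultimately show ?thesis by (metis closedin_closed)
  qed
  ultimately have "?A = U" using U(2) a unfolding connected_clopen by blast
  then show ?thesis using nz[of x] x eventually_nhds_x_imp_x by blast
qed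

lemma real_analytic_identity_on_open:
  assumes F: "F real_analytic_on U" and U: "open U" "connected U"
    and T: "open T" "a \<in> T" "a \<in> U" "\<And>y. y \<in> T \<Longrightarrow> F y = 0" and x: "x \<in> U"
  shows "F x = 0"
proof (rule real_analytic_identity[OF F U T(3) _ x])
  have "a islimpt T" using T(1,2) by (simp add: interior_limit_point interior_open)
  then show "a islimpt {x. F x = 0}" by (rule islimpt_subset) (use T in auto)
qed

text \<open>The extension is injective near \<open>a\<close> and has a holomorphic inverse on a
  neighbourhood of \<open>F a\<close>. Two radii are needed: \<open>\<psi>\<close> is analytic on a
  full interval about \<open>F a\<close>, but it inverts \<open>F\<close> only near
  \<open>a\<close>, and a remote \<open>x\<close> with \<open>F x\<close> in that interval need not
  be recovered.\<close>

lemma real_analytic_local_inverse: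
  assumes "F real_analytic_on {a}" "deriv F a \<noteq> 0"
  obtains \<psi> \<delta> \<epsilon> where "\<delta> > 0" "\<epsilon> > 0" "\<And>x. \<bar>x - a\<bar> < \<delta> \<Longrightarrow> \<psi> (F x) = x"
    "\<psi> real_analytic_on ball (F a) \<epsilon>"
proof -
  obtain r \<phi> where r: "cx_ext F a r \<phi>" using real_analytic_on_cx_ext[OF assms(1)] by blast
  then have rp: "r > 0" and hol: "\<phi> holomorphic_on ball (of_real a) r"
    and ext: "\<And>x. \<bar>x - a\<bar> < r \<Longrightarrow> \<phi> (of_real x) = of_real (F x)" by (auto simp: cx_ext_def)
  have dnz: "deriv \<phi> (of_real a) \<noteq> 0" using cx_ext_deriv(2)[OF r, of a] rp assms(2) by simp
  have cin: "complex_of_real a \<in> ball (of_real a) r" using rp by simp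
  obtain s where s: "s > 0" "ball (complex_of_real a) s \<subseteq> ball (of_real a) r" "inj_on \<phi> (ball (of_real a) s)"
    by (rule has_complex_derivative_locally_injective[OF hol cin open_ball dnz]) (rule that)
  have hol': "\<phi> holomorphic_on ball (of_real a) s" by (rule holomorphic_on_subset[OF hol s(2)])
  obtain g where g: "g holomorphic_on (\<phi> ` ball (of_real a) s)" "\<And>z. z \<in> ball (of_real a) s \<Longrightarrow> g (\<phi> z) = z"
    using holomorphic_has_inverse[OF hol' open_ball s(3)] by metis
  have "open (\<phi> ` ball (of_real a) s)" by (rule open_mapping_thm3[OF hol' open_ball s(3)])
  moreover have "of_real (F a) \<in> \<phi> ` ball (of_real a) s"
    using ext[of a] rp s(1) by (metis abs_zero centre_in_ball diff_self image_eqI)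
  ultimately obtain e where e: "e > 0" "ball (of_real (F a)) e \<subseteq> \<phi> ` ball (of_real a) s"
    using open_contains_ball by blast
  define \<psi> where "\<psi> y = Re (g (of_real y))" for y
  have "\<psi> real_analytic_on ball (F a) e"
  proof (rule real_analytic_on_singletonI)
    fix b assume b: "b \<in> ball (F a) e"
    have sub: "ball (of_real b) (e - dist (F a) b) \<subseteq> ball (complex_of_real (F a)) e"
      by (rule subset_trans[OF subset_refl], rule ball_subset_ball_iff[THEN iffD2]) (use b in \<open>auto simp: dist_of_real dist_commute\<close>)
    show "\<psi> real_analytic_on {b}"
      by (rule real_analytic_on_Re[of g b "e - dist (F a) b"])
         (use b e sub g(1) in \<open>auto simp: \<psi>_def intro: holomorphic_on_subset\<close>)
  qed
  moreover have "\<psi> (F x) = x" if "\<bar>x - a\<bar> < min r s" for x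
  proof -
    have "g (\<phi> (of_real x)) = of_real x"
      by (rule g) (use that in \<open>simp add: dist_of_real dist_real_def abs_minus_commute\<close>)
    then show ?thesis using ext[of x] that by (simp add: \<psi>_def)
  qed
  ultimately show ?thesis using that[of "min r s" e \<psi>] rp s(1) e(1) by auto
qed

text \<open>The logarithmic derivative of an analytic function at a zero of order \<open>n \<ge> 1\<close> behaves like
  \<open>n / (x - a)\<close>.\<close>

lemma real_analytic_zero_log_deriv:
  assumes "F real_analytic_on {a}" "F a = 0" "\<not> eventually (\<lambda>x. F x = 0) (nhds a)"
  obtains \<delta> where "\<delta> > 0" "\<And>x. 0 < \<bar>x - a\<bar> \<Longrightarrow> \<bar>x - a\<bar> < \<delta> \<Longrightarrow> F x \<noteq> 0"
    "\<And>x. 0 < \<bar>x - a\<bar> \<Longrightarrow> \<bar>x - a\<bar> < \<delta> \<Longrightarrow> (x - a) * deriv F x / F x \<ge> 1 / 2"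
proof -
  obtain r \<phi> where r: "cx_ext F a r \<phi>" using real_analytic_on_cx_ext[OF assms(1)] by blast
  then have rp: "r > 0" and hol: "\<phi> holomorphic_on ball (of_real a) r"
    and ext: "\<And>x. \<bar>x - a\<bar> < r \<Longrightarrow> \<phi> (of_real x) = of_real (F x)" by (auto simp: cx_ext_def)
  have \<phi>a: "\<phi> (of_real a) = 0" using ext[of a] rp assms(2) by simp
  have nc: "\<not> \<phi> constant_on ball (of_real a) r"
  proof
    assume "\<phi> constant_on ball (of_real a) r"
    then have z: "\<And>z. z \<in> ball (of_real a) r \<Longrightarrow> \<phi> z = 0"
      unfolding constant_on_def using \<phi>a rp centre_in_ball by metis
    have "F x = 0" if "dist x a < r" for x
      using z[of "of_real x"] ext[of x] that by (simp add: dist_of_real dist_real_def abs_minus_commute)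
    then show False using assms(3) rp unfolding eventually_nhds_metric by blast
  qed
  have cin: "complex_of_real a \<in> ball (of_real a) r" using rp by simp
  obtain k s n where n: "0 < n" and s: "0 < s" "ball (complex_of_real a) s \<subseteq> ball (of_real a) r"
    and k: "k holomorphic_on ball (of_real a) s"
      "\<And>w. w \<in> ball (of_real a) s \<Longrightarrow> \<phi> w = (w - of_real a) ^ n * k w"
      "\<And>w. w \<in> ball (of_real a) s \<Longrightarrow> k w \<noteq> 0"
    by (rule holomorphic_factor_zero_nonconstant[OF hol open_ball connected_ball cin \<phi>a nc]) (rule that)
  \<comment> \<open>With \<open>\<phi> z = (z - a) ^ n * k z\<close> one has
    \<open>(z - a) * deriv \<phi> z / \<phi> z = n + q z\<close>, and \<open>q\<close> vanishes at
    \<open>a\<close>. Where \<open>q\<close> is smaller than 1/2, the real part is at least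
    \<open>n - 1/2\<close>, hence at least 1/2.\<close>
  define q where "q z = (z - of_real a) * deriv k z / k z" for z
  have "q holomorphic_on ball (of_real a) s"
    unfolding q_def using k by (intro holomorphic_intros) auto
  then have "isCont q (of_real a)"
    using s by (metis centre_in_ball continuous_on_interior holomorphic_on_imp_continuous_on interior_ball)
  then obtain d where d: "d > 0" "\<And>z. dist z (of_real a) < d \<Longrightarrow> dist (q z) (q (of_real a)) < 1 / 2"
    unfolding continuous_at_eps_delta by (metis dist_commute half_gt_zero_iff zero_less_one)
  have main: "F x \<noteq> 0 \<and> (x - a) * deriv F x / F x \<ge> 1 / 2"
    if x: "0 < \<bar>x - a\<bar>" "\<bar>x - a\<bar> < min r (min s d)" for x
  proof -
    let ?z = "complex_of_real x"
    have zb: "?z \<in> ball (of_real a) s" using x by (simp add: dist_of_real dist_real_def abs_minus_commute)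
    have ne: "?z - of_real a \<noteq> 0" using x by (metis abs_zero eq_iff_diff_eq_0 less_irrefl of_real_eq_iff)
    have "((\<lambda>w. (w - of_real a) ^ n * k w) has_field_derivative
       (of_nat n * (?z - of_real a) ^ (n - 1) * k ?z + (?z - of_real a) ^ n * deriv k ?z)) (at ?z)"
      using holomorphic_derivI[OF k(1) open_ball zb] by (auto intro!: derivative_eq_intros)
    then have "(\<phi> has_field_derivative
       (of_nat n * (?z - of_real a) ^ (n - 1) * k ?z + (?z - of_real a) ^ n * deriv k ?z)) (at ?z)"
      by (rule has_field_derivative_transform_within_open[OF _ open_ball zb]) (use k in auto)
    then have dz: "deriv \<phi> ?z = of_nat n * (?z - of_real a) ^ (n - 1) * k ?z + (?z - of_real a) ^ n * deriv k ?z"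
      by (rule DERIV_imp_deriv)
    have pw: "(?z - of_real a) * (?z - of_real a) ^ (n - 1) = (?z - of_real a) ^ n"
      using n by (metis power_eq_if less_irrefl)
    have "(?z - of_real a) * deriv \<phi> ?z = (?z - of_real a) ^ n * k ?z * (of_nat n + q ?z)"
      unfolding dz q_def using k(3)[OF zb]
      by (simp add: pw[symmetric] field_simps)
    then have eq: "(?z - of_real a) * deriv \<phi> ?z / \<phi> ?z = of_nat n + q ?z"
      using k(2,3)[OF zb] ne by simp
    have \<phi>x: "\<phi> ?z = of_real (F x)" using ext x by simp
    have nz: "F x \<noteq> 0" using \<phi>x k(2,3)[OF zb] ne by auto
    have "(?z - of_real a) * deriv \<phi> ?z / \<phi> ?z = of_real ((x - a) * deriv F x / F x)"
      using cx_ext_deriv(2)[OF r, of x] x \<phi>x by simp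
    then have "(x - a) * deriv F x / F x = Re (of_nat n + q ?z)" using eq by (metis Re_complex_of_real)
    moreover have "dist (q ?z) (q (of_real a)) < 1 / 2"
      by (rule d) (use x in \<open>simp add: dist_of_real dist_real_def\<close>)
    then have "cmod (q ?z) < 1 / 2" by (simp add: q_def dist_norm)
    then have "Re (q ?z) \<ge> - (1 / 2)" using abs_Re_le_cmod[of "q ?z"] by linarith
    ultimately show ?thesis using nz n by simp
  qed
  show ?thesis
    by (rule that[of "min r (min s d)"]) (use main rp s d in auto)
qed

section \<open>Double power series\<close>

text \<open>Coefficients and radius are parameters here instead of being hidden behind quantifiers,
  so that the differentiated and the transposed series can be named.\<close>

definition double_power_series :: "(real \<times> real \<Rightarrow> real) \<Rightarrow> real \<Rightarrow> real \<Rightarrow> (nat \<Rightarrow> nat \<Rightarrow> real) \<Rightarrow> real \<Rightarrow> bool" where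
  "double_power_series f a b c r \<longleftrightarrow> r > 0 \<and> (\<forall>x v. \<bar>x - a\<bar> < r \<and> \<bar>v - b\<bar> < r \<longrightarrow>
        ((\<lambda>(i, j). c i j * (x - a) ^ i * (v - b) ^ j) has_sum f (x, v)) UNIV)"

lemma double_power_seriesD:
  "double_power_series f a b c r \<Longrightarrow> \<bar>x - a\<bar> < r \<Longrightarrow> \<bar>v - b\<bar> < r \<Longrightarrow>
    ((\<lambda>(i, j). c i j * (x - a) ^ i * (v - b) ^ j) has_sum f (x, v)) UNIV"
  unfolding double_power_series_def by blast

text \<open>Unconditional summability of reals is absolute summability. The series is evaluated at
  the corner \<open>(a + s, b + s)\<close>, where every term attains its largest modulus on the
  closed box of half-width \<open>s\<close>; this gives the majorant for the Weierstrass
  test.\<close>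

lemma double_power_series_abs_summable:
  assumes "double_power_series f a b c r" "0 < s" "s < r"
  shows "(\<lambda>(i, j). \<bar>c i j\<bar> * s ^ i * s ^ j) summable_on UNIV"
proof -
  have "((\<lambda>(i, j). c i j * ((a + s) - a) ^ i * ((b + s) - b) ^ j) has_sum f (a + s, b + s)) UNIV"
    using assms(1)[unfolded double_power_series_def, THEN conjunct2, rule_format, of "a + s" "b + s"] assms(2,3) by simp
  then have "(\<lambda>(i, j). c i j * s ^ i * s ^ j) summable_on UNIV"
    by (auto simp: summable_on_def)
  then have "(\<lambda>p. norm (case p of (i, j) \<Rightarrow> c i j * s ^ i * s ^ j)) summable_on UNIV"
    by (subst (asm) summable_on_iff_abs_summable_on_real)
  then show ?thesis
    by (rule summable_on_cong[THEN iffD1, rotated]) (use assms(2) in \<open>auto simp: abs_mult\<close>)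
qed

lemma double_power_series_continuous:
  assumes "double_power_series f a b c r" "0 < s" "s < r"
  shows "continuous_on ({a - s..a + s} \<times> {b - s..b + s}) f"
proof -
  let ?B = "{a - s..a + s} \<times> {b - s..b + s}"
  let ?t = "\<lambda>p y. c (fst p) (snd p) * (fst y - a) ^ fst p * (snd y - b) ^ snd p"
  have "uniform_limit ?B (\<lambda>X y. \<Sum>p\<in>X. ?t p y) (\<lambda>y. \<Sum>\<^sub>\<infinity>p\<in>UNIV. ?t p y) (finite_subsets_at_top UNIV)"
  proof (rule Weierstrass_m_test_general)
    show "(\<lambda>(i, j). \<bar>c i j\<bar> * s ^ i * s ^ j) summable_on UNIV"
      by (rule double_power_series_abs_summable[OF assms])
    fix p :: "nat \<times> nat" and y assume "y \<in> ?B"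
    then have "\<bar>fst y - a\<bar> ^ fst p \<le> s ^ fst p" "\<bar>snd y - b\<bar> ^ snd p \<le> s ^ snd p"
      by (auto intro!: power_mono)
    then show "norm (?t p y) \<le> (case p of (i, j) \<Rightarrow> \<bar>c i j\<bar> * s ^ i * s ^ j)"
      using assms(2) by (auto simp: abs_mult power_abs split: prod.split intro!: mult_mono)
  qed
  then have "continuous_on ?B (\<lambda>y. \<Sum>\<^sub>\<infinity>p\<in>UNIV. ?t p y)"
    by (rule uniform_limit_theorem[rotated]) (auto intro!: always_eventually continuous_intros)
  moreover have "(\<Sum>\<^sub>\<infinity>p\<in>UNIV. ?t p y) = f y" if "y \<in> ?B" for y
  proof -
    have "((\<lambda>(i, j). c i j * (fst y - a) ^ i * (snd y - b) ^ j) has_sum f (fst y, snd y)) UNIV"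
      by (rule double_power_seriesD[OF assms(1)]) (use that assms(3) in auto)
    then show ?thesis by (auto simp: case_prod_unfold dest: infsumI)
  qed
  ultimately show ?thesis by (simp cong: continuous_on_cong)
qed

text \<open>Absorbs the factor \<open>Suc i\<close> produced by termwise differentiation into the
  quotient of two radii.\<close>

lemma Suc_mult_power_bounded:
  fixes q :: real assumes "0 \<le> q" "q < 1"
  obtains B where "B > 0" "\<And>i. real (Suc i) * q ^ i \<le> B"
proof -
  have "(\<lambda>n. real n * q ^ n) \<longlonglongrightarrow> 0"
    using assms powser_times_n_limit_0[of q] by simp
  then have "(\<lambda>n. real n * q ^ n + q ^ n) \<longlonglongrightarrow> 0 + 0"
    using assms by (intro tendsto_add LIMSEQ_power_zero) auto
  then have "Bseq (\<lambda>n. real n * q ^ n + q ^ n)"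
    by (intro convergent_imp_Bseq) (auto simp: convergent_def)
  then obtain K where K: "K > 0" "\<And>n. norm (real n * q ^ n + q ^ n) \<le> K"
    unfolding Bseq_def by auto
  have "real (Suc i) * q ^ i \<le> K" for i
  proof -
    have "real (Suc i) * q ^ i = real i * q ^ i + q ^ i" by (simp add: algebra_simps)
    then show ?thesis using K(2)[of i] by simp
  qed
  then show ?thesis using that K(1) by blast
qed

text \<open>Summing over the second index for each fixed power of \<open>x - a\<close> turns the
  double series into an ordinary power series in \<open>x - a\<close>, to which the one-variable
  theory applies.\<close>

lemma double_power_series_sums_fst:
  assumes "double_power_series f a b c r" "\<bar>x - a\<bar> < r" "\<bar>v - b\<bar> < r"
  shows "(\<lambda>i. (\<Sum>\<^sub>\<infinity>j. c i j * (v - b) ^ j) * (x - a) ^ i) sums f (x, v)"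
proof -
  let ?t = "\<lambda>(i, j). c i j * (x - a) ^ i * (v - b) ^ j"
  have hs: "(?t has_sum f (x, v)) UNIV"
    using assms unfolding double_power_series_def by auto
  \<comment> \<open>At \<open>x = a\<close> the terms with positive \<open>i\<close> vanish and say
    nothing about the inner sums. Their summability is read off at an auxiliary point
    \<open>y\<close> different from \<open>a\<close>, where \<open>(y - a) ^ i\<close> can be
    divided out.\<close>
  define y where "y = (if x = a then a + r / 2 else x)"
  have y: "\<bar>y - a\<bar> < r" "y \<noteq> a" using assms unfolding y_def double_power_series_def by (auto simp: split: if_splits)
  have "((\<lambda>(i, j). c i j * (y - a) ^ i * (v - b) ^ j) has_sum f (y, v)) UNIV"
    using assms y unfolding double_power_series_def by auto
  then have "(\<lambda>(i, j). c i j * (y - a) ^ i * (v - b) ^ j) summable_on Sigma UNIV (\<lambda>_. UNIV)"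
    by (auto simp: summable_on_def)
  then have sy: "(\<lambda>j. c i j * (y - a) ^ i * (v - b) ^ j) summable_on UNIV" for i
    by (rule summable_on_SigmaD1) simp
  have inner: "(\<lambda>j. c i j * (v - b) ^ j) summable_on UNIV" for i
  proof -
    have "(\<lambda>j. inverse ((y - a) ^ i) * (c i j * (y - a) ^ i * (v - b) ^ j)) summable_on UNIV"
      using sy by (rule summable_on_cmult_right)
    then show ?thesis using y(2) by (simp add: field_simps)
  qed
  have "((\<lambda>i. (x - a) ^ i * (\<Sum>\<^sub>\<infinity>j. c i j * (v - b) ^ j)) has_sum f (x, v)) UNIV"
  proof (rule has_sum_SigmaD[where B = "\<lambda>_. UNIV"])
    show "(?t has_sum f (x, v)) (Sigma UNIV (\<lambda>_. UNIV))" using hs by simp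
    show "((\<lambda>j. ?t (i, j)) has_sum (x - a) ^ i * (\<Sum>\<^sub>\<infinity>j. c i j * (v - b) ^ j)) UNIV" for i
      using has_sum_cmult_right[OF has_sum_infsum[OF inner[of i]], of "(x - a) ^ i"]
      by (simp add: mult_ac)
  qed
  then show ?thesis using has_sum_imp_sums by (simp add: mult.commute)
qed

text \<open>The differentiated series on the box of half-width \<open>t\<close> is majorised by the
  original one at a larger radius. That its sum is the derivative follows from termwise
  differentiation of the rearranged one-variable series.\<close>

lemma double_power_series_deriv:
  assumes f: "double_power_series f a b c r" and t: "0 < t" "t < r"
  obtains g where "double_power_series g a b (\<lambda>i j. real (Suc i) * c (Suc i) j) t"
    "\<And>x v. \<bar>x - a\<bar> < t \<Longrightarrow> \<bar>v - b\<bar> < t \<Longrightarrow> ((\<lambda>x. f (x, v)) has_real_derivative g (x, v)) (at x)"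
proof -
  \<comment> \<open>Strictly between \<open>t\<close> and \<open>r\<close>: below \<open>r\<close>
    the original series converges absolutely, and \<open>t / s < 1\<close> absorbs the factor
    \<open>Suc i\<close>.\<close>
  define s where "s = (t + r) / 2"
  have s: "t < s" "s < r" "0 < s" using t by (auto simp: s_def)
  obtain B where B: "B > 0" "\<And>i. real (Suc i) * (t / s) ^ i \<le> B"
    using Suc_mult_power_bounded[of "t / s"] s t by auto
  let ?d = "\<lambda>i j. real (Suc i) * c (Suc i) j"
  have sm: "(\<lambda>(i, j). \<bar>?d i j\<bar> * t ^ i * t ^ j) summable_on UNIV"
  proof -
    have "(\<lambda>(i, j). \<bar>c i j\<bar> * s ^ i * s ^ j) summable_on UNIV"
      using double_power_series_abs_summable[OF f s(3,2)] .
    then have "(\<lambda>(i, j). \<bar>c i j\<bar> * s ^ i * s ^ j) summable_on ((\<lambda>(i, j). (Suc i, j)) ` UNIV)"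
      by (rule summable_on_subset_banach) simp
    then have "((\<lambda>(i, j). \<bar>c i j\<bar> * s ^ i * s ^ j) \<circ> (\<lambda>(i, j). (Suc i, j))) summable_on UNIV"
      by (subst (asm) summable_on_reindex) (auto simp: inj_on_def)
    then have "(\<lambda>(i, j). \<bar>c (Suc i) j\<bar> * s ^ Suc i * s ^ j) summable_on UNIV"
      by (simp add: o_def case_prod_unfold)
    then have "(\<lambda>p. (B / s) * (case p of (i, j) \<Rightarrow> \<bar>c (Suc i) j\<bar> * s ^ Suc i * s ^ j)) summable_on UNIV"
      by (rule summable_on_cmult_right)
    then have "(\<lambda>p. norm ((B / s) * (case p of (i, j) \<Rightarrow> \<bar>c (Suc i) j\<bar> * s ^ Suc i * s ^ j))) summable_on UNIV"
      by (subst (asm) summable_on_iff_abs_summable_on_real)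
    note majorant = this
    have "(\<lambda>p. norm (case p of (i, j) \<Rightarrow> \<bar>?d i j\<bar> * t ^ i * t ^ j)) summable_on UNIV"
    proof (rule Infinite_Sum.abs_summable_on_comparison_test)
      show "(\<lambda>p. norm ((B / s) * (case p of (i, j) \<Rightarrow> \<bar>c (Suc i) j\<bar> * s ^ Suc i * s ^ j))) summable_on UNIV"
        by (rule majorant)
      fix p :: "nat \<times> nat"
      obtain i j where p: "p = (i, j)" by (cases p)
      have 1: "real (Suc i) * t ^ i \<le> B * s ^ i"
        using B(2)[of i] s by (simp add: power_divide field_simps del: of_nat_Suc)
      have 2: "t ^ j \<le> s ^ j" using s t by (intro power_mono) auto
      have "(real (Suc i) * t ^ i) * t ^ j \<le> (B * s ^ i) * s ^ j"
        by (rule mult_mono[OF 1 2]) (use B s t in auto)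
      then have "\<bar>c (Suc i) j\<bar> * ((real (Suc i) * t ^ i) * t ^ j) \<le> \<bar>c (Suc i) j\<bar> * ((B * s ^ i) * s ^ j)"
        by (intro mult_left_mono) auto
      moreover have "\<bar>?d i j\<bar> * t ^ i * t ^ j = \<bar>c (Suc i) j\<bar> * ((real (Suc i) * t ^ i) * t ^ j)"
        by (simp add: abs_mult del: of_nat_Suc)
      moreover have "(B / s) * (\<bar>c (Suc i) j\<bar> * s ^ Suc i * s ^ j) = \<bar>c (Suc i) j\<bar> * ((B * s ^ i) * s ^ j)"
        using s by simp
      ultimately have "\<bar>?d i j\<bar> * t ^ i * t ^ j \<le> (B / s) * (\<bar>c (Suc i) j\<bar> * s ^ Suc i * s ^ j)" by argo
      moreover have "0 \<le> \<bar>?d i j\<bar> * t ^ i * t ^ j" using t by simp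
      ultimately show "norm (case p of (i, j) \<Rightarrow> \<bar>?d i j\<bar> * t ^ i * t ^ j)
          \<le> norm (B / s * (case p of (i, j) \<Rightarrow> \<bar>c (Suc i) j\<bar> * s ^ Suc i * s ^ j))"
        unfolding p prod.case real_norm_def by linarith
    qed
    then show ?thesis by (subst summable_on_iff_abs_summable_on_real)
  qed
  define g where "g y = (\<Sum>\<^sub>\<infinity>(i, j). ?d i j * (fst y - a) ^ i * (snd y - b) ^ j)" for y
  have g: "double_power_series g a b ?d t"
    unfolding double_power_series_def
  proof (intro conjI allI impI)
    fix x v assume xv: "\<bar>x - a\<bar> < t \<and> \<bar>v - b\<bar> < t"
    have "(\<lambda>p. norm (case p of (i, j) \<Rightarrow> ?d i j * (x - a) ^ i * (v - b) ^ j)) summable_on UNIV"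
    proof (rule Infinite_Sum.abs_summable_on_comparison_test)
      show "(\<lambda>p. norm (case p of (i, j) \<Rightarrow> \<bar>?d i j\<bar> * t ^ i * t ^ j)) summable_on UNIV"
        using sm by (subst (asm) summable_on_iff_abs_summable_on_real)
      fix p :: "nat \<times> nat"
      have "\<bar>x - a\<bar> ^ fst p \<le> t ^ fst p" "\<bar>v - b\<bar> ^ snd p \<le> t ^ snd p" using xv by (auto intro!: power_mono)
      then show "norm (case p of (i, j) \<Rightarrow> ?d i j * (x - a) ^ i * (v - b) ^ j) \<le> norm (case p of (i, j) \<Rightarrow> \<bar>?d i j\<bar> * t ^ i * t ^ j)"
        using t by (auto simp: abs_mult power_abs split: prod.split intro!: mult_mono)
    qed
    then have "(\<lambda>(i, j). ?d i j * (x - a) ^ i * (v - b) ^ j) summable_on UNIV"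
      by (subst summable_on_iff_abs_summable_on_real)
    then show "((\<lambda>(i, j). ?d i j * (x - a) ^ i * (v - b) ^ j) has_sum g (x, v)) UNIV"
      by (simp add: g_def has_sum_infsum)
  qed (use t in simp)
  have "((\<lambda>x. f (x, v)) has_real_derivative g (x, v)) (at x)" if xv: "\<bar>x - a\<bar> < t" "\<bar>v - b\<bar> < t" for x v
  proof -
    define A where "A i = (\<Sum>\<^sub>\<infinity>j. c i j * (v - b) ^ j)" for i
    have fs: "(\<lambda>i. A i * (y - a) ^ i) sums f (y, v)" if "\<bar>y - a\<bar> < r" for y
      unfolding A_def by (rule double_power_series_sums_fst[OF f that]) (use xv t in simp)
    have sA: "summable (\<lambda>i. A i * h ^ i)" if "norm h < r" for h
      using fs[of "a + h"] that by (auto simp: sums_iff)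
    have "((\<lambda>h. \<Sum>i. A i * h ^ i) has_real_derivative (\<Sum>i. diffs A i * (x - a) ^ i)) (at (x - a))"
      by (rule termdiffs_strong'[of r]) (use sA xv t in auto)
    then have "((\<lambda>y. \<Sum>i. A i * (y - a) ^ i) has_real_derivative (\<Sum>i. diffs A i * (x - a) ^ i)) (at x)"
      using DERIV_shift[of "\<lambda>h. \<Sum>i. A i * h ^ i" _ x "- a"] by simp
    then have D: "((\<lambda>y. f (y, v)) has_real_derivative (\<Sum>i. diffs A i * (x - a) ^ i)) (at x)"
    proof (rule has_field_derivative_transform_within_open[where S = "ball a r"])
      show "x \<in> ball a r" using xv t by (simp add: dist_real_def abs_minus_commute)
      show "(\<Sum>i. A i * (y - a) ^ i) = f (y, v)" if "y \<in> ball a r" for y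
        using fs[of y] that by (simp add: sums_iff dist_real_def abs_minus_commute)
    qed simp
    have "(\<lambda>i. (\<Sum>\<^sub>\<infinity>j. ?d i j * (v - b) ^ j) * (x - a) ^ i) sums g (x, v)"
      by (rule double_power_series_sums_fst[OF g xv])
    moreover have "(\<Sum>\<^sub>\<infinity>j. ?d i j * (v - b) ^ j) = diffs A i" for i
      by (simp add: diffs_def A_def mult.assoc infsum_cmult_right' del: of_nat_Suc)
    ultimately show ?thesis using D by (simp add: sums_iff)
  qed
  then show ?thesis using that g by blast
qed

text \<open>Exchanging the variables transposes the coefficients, so everything proved for the first
  variable is available for the second.\<close>

lemma double_power_series_swap:
  assumes "double_power_series f a b c r"
  shows "double_power_series (f \<circ> prod.swap) b a (\<lambda>i j. c j i) r"
  unfolding double_power_series_def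
proof (intro conjI allI impI)
  fix x v assume xv: "\<bar>x - b\<bar> < r \<and> \<bar>v - a\<bar> < r"
  have "((\<lambda>(i, j). c i j * (v - a) ^ i * (x - b) ^ j) has_sum f (v, x)) UNIV"
    using assms xv unfolding double_power_series_def by auto
  then have "((\<lambda>p. (\<lambda>(i, j). c i j * (v - a) ^ i * (x - b) ^ j) (prod.swap p)) has_sum f (v, x)) UNIV"
    by (subst has_sum_reindex_bij_betw[of prod.swap UNIV UNIV]) auto
  then show "((\<lambda>(i, j). c j i * (x - b) ^ i * (v - a) ^ j) has_sum (f \<circ> prod.swap) (x, v)) UNIV"
    by (simp add: case_prod_unfold mult_ac)
qed (use assms in \<open>simp add: double_power_series_def\<close>)

lemma real_analytic2_onE:
  assumes "f real_analytic2_on S" "(a, b) \<in> S"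
  obtains c r where "double_power_series f a b c r"
  using assms unfolding real_analytic2_on_def double_power_series_def by blast

lemma real_analytic2_on_swap:
  assumes "f real_analytic2_on S" shows "(f \<circ> prod.swap) real_analytic2_on (prod.swap ` S)"
  unfolding real_analytic2_on_def
proof (rule ballI)
  fix q assume "q \<in> prod.swap ` S"
  then obtain a b where q: "q = prod.swap (a, b)" and "(a, b) \<in> S" by auto
  then obtain c r where "double_power_series f a b c r" using real_analytic2_onE[OF assms] by metis
  from double_power_series_swap[OF this]
  show "case q of (a, b) \<Rightarrow> \<exists>c r. r > 0 \<and> (\<forall>x v. \<bar>x - a\<bar> < r \<and> \<bar>v - b\<bar> < r \<longrightarrow>
        ((\<lambda>(i, j). c i j * (x - a) ^ i * (v - b) ^ j) has_sum (f \<circ> prod.swap) (x, v)) UNIV)"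
    unfolding double_power_series_def
    by (auto simp: q intro!: exI[of _ "\<lambda>i j. c j i"] exI[of _ r])
qed

section \<open>Partial derivatives and total differentiability\<close>

definition dx :: "(real \<times> real \<Rightarrow> real) \<Rightarrow> real \<times> real \<Rightarrow> real" where
  "dx f p = deriv (\<lambda>x. f (x, snd p)) (fst p)"

definition dv :: "(real \<times> real \<Rightarrow> real) \<Rightarrow> real \<times> real \<Rightarrow> real" where
  "dv f p = deriv (\<lambda>v. f (fst p, v)) (snd p)"

lemma real_analytic2_dx:
  assumes "f real_analytic2_on S" "p \<in> S"
  shows "((\<lambda>x. f (x, snd p)) has_real_derivative dx f p) (at (fst p))"
    and "isCont (dx f) p" and "isCont f p"
    and "(\<lambda>x. f (x, snd p)) real_analytic_on {fst p}"
proof -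
  obtain a b where p: "p = (a, b)" by (cases p)
  obtain c r where f: "double_power_series f a b c r" using real_analytic2_onE[OF assms(1)] assms(2) p by blast
  then have r: "r > 0" by (simp add: double_power_series_def)
  obtain g where g: "double_power_series g a b (\<lambda>i j. real (Suc i) * c (Suc i) j) (r / 2)"
    "\<And>x v. \<bar>x - a\<bar> < r / 2 \<Longrightarrow> \<bar>v - b\<bar> < r / 2 \<Longrightarrow> ((\<lambda>x. f (x, v)) has_real_derivative g (x, v)) (at x)"
    by (rule double_power_series_deriv[OF f, of "r / 2"]) (use r in auto)
  have dxg: "dx f (x, v) = g (x, v)" if "\<bar>x - a\<bar> < r / 2" "\<bar>v - b\<bar> < r / 2" for x v
    unfolding dx_def using g(2)[OF that] by (simp add: DERIV_imp_deriv)
  show "((\<lambda>x. f (x, snd p)) has_real_derivative dx f p) (at (fst p))"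
    using g(2)[of a b] dxg[of a b] r by (simp add: p)
  let ?B = "\<lambda>s. {a - s<..<a + s} \<times> {b - s<..<b + s}"
  have opn: "open (?B s)" for s by (intro open_Times) auto
  have isC: "isCont h p" if "double_power_series h a b d s" for h d s
  proof -
    have s: "s > 0" using that by (simp add: double_power_series_def)
    have "continuous_on ({a - s / 2..a + s / 2} \<times> {b - s / 2..b + s / 2}) h"
      by (rule double_power_series_continuous[OF that]) (use s in auto)
    then have "continuous_on (?B (s / 2)) h" by (rule continuous_on_subset) auto
    moreover have "p \<in> ?B (s / 2)" using s p by simp
    ultimately show ?thesis using continuous_on_eq_continuous_at[OF opn] by blast
  qed
  have "isCont g p" using isC[OF g(1)] .
  moreover have "eventually (\<lambda>q. g q = dx f q) (nhds p)"
    unfolding eventually_nhds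
  proof (intro exI[of _ "?B (r / 2)"] conjI ballI)
    fix q assume "q \<in> ?B (r / 2)"
    then have "\<bar>fst q - a\<bar> < r / 2 \<and> \<bar>snd q - b\<bar> < r / 2"
      unfolding mem_Times_iff greaterThanLessThan_iff by linarith
    then show "g q = dx f q" using dxg[of "fst q" "snd q"] by simp
  qed (use opn r in \<open>auto simp: p\<close>)
  ultimately show "isCont (dx f) p"
    using isCont_cong[of g "dx f" p] by simp
  show "isCont f p" using isC[OF f] .
  show "(\<lambda>x. f (x, snd p)) real_analytic_on {fst p}"
    unfolding real_analytic_on_def using double_power_series_sums_fst[OF f, of _ b] r
    by (intro ballI exI[of _ "\<lambda>i. \<Sum>\<^sub>\<infinity>j. c i j * (b - b) ^ j"] exI[of _ r]) (auto simp: p)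
qed

lemma real_analytic2_dv:
  assumes "f real_analytic2_on S" "p \<in> S"
  shows "((\<lambda>v. f (fst p, v)) has_real_derivative dv f p) (at (snd p))"
    and "isCont (dv f) p"
    and "(\<lambda>v. f (fst p, v)) real_analytic_on {snd p}"
proof -
  have sp: "prod.swap p \<in> prod.swap ` S" using assms by auto
  have eq: "dx (f \<circ> prod.swap) q = dv f (prod.swap q)" for q by (simp add: dx_def dv_def)
  note * = real_analytic2_dx[OF real_analytic2_on_swap[OF assms(1)] sp]
  show "((\<lambda>v. f (fst p, v)) has_real_derivative dv f p) (at (snd p))"
    using *(1) by (simp add: eq)
  show "(\<lambda>v. f (fst p, v)) real_analytic_on {snd p}" using *(4) by simp
  have "isCont prod.swap p"
    unfolding prod.swap_def by (intro continuous_intros)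
  then have "isCont (\<lambda>q. dx (f \<circ> prod.swap) (prod.swap q)) p"
    using *(2) by (rule isCont_o2)
  then show "isCont (dv f) p" by (simp add: eq)
qed

text \<open>Existence of \<open>dx f\<close> at the point and continuity of \<open>dv f\<close> near
  it already give total differentiability. The second variable is restricted to a ball because the
  criterion asks for a convex set in that direction.\<close>

lemma real_analytic2_has_derivative:
  assumes f: "f real_analytic2_on S" and S: "open S" "(a, b) \<in> S"
  shows "(f has_derivative (\<lambda>h. dx f (a, b) * fst h + dv f (a, b) * snd h)) (at (a, b))"
proof -
  obtain A B where AB: "open A" "open B" "a \<in> A" "b \<in> B" "A \<times> B \<subseteq> S"
    using open_prod_elim[OF S] by (metis mem_Sigma_iff)
  obtain e where e: "e > 0" "ball b e \<subseteq> B" using AB open_contains_ball by blast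
  have sub: "(x, v) \<in> S" if "x \<in> A" "v \<in> ball b e" for x v using AB e that by auto
  have "((\<lambda>(x, v). f (x, v)) has_derivative (\<lambda>(tx, ty). dx f (a, b) * tx + blinfun_mult_right (dv f (a, b)) ty)) (at (a, b) within A \<times> ball b e)"
  proof (rule has_derivative_partialsI)
    show "((\<lambda>x. f (x, b)) has_derivative (*) (dx f (a, b))) (at a within A)"
      using real_analytic2_dx(1)[OF f S(2)] by (simp add: has_field_derivative_def has_derivative_at_withinI)
    show "((\<lambda>v. f (x, v)) has_derivative blinfun_apply (blinfun_mult_right (dv f (x, y)))) (at y within ball b e)"
      if "x \<in> A" "y \<in> ball b e" for x y
      using real_analytic2_dv(1)[OF f sub[OF that]] by (simp add: has_field_derivative_def has_derivative_at_withinI)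
    have "isCont (\<lambda>p. blinfun_mult_right (dv f p)) (a, b)"
      by (rule bounded_linear.isCont[OF bounded_linear_blinfun_mult_right real_analytic2_dv(2)[OF f S(2)]])
    then show "continuous (at (a, b) within A \<times> ball b e) (\<lambda>(x, v). blinfun_mult_right (dv f (x, v)))"
      by (simp add: case_prod_unfold continuous_at_imp_continuous_at_within)
  qed (use e in auto)
  moreover have "at (a, b) within A \<times> ball b e = at (a, b)"
    by (rule at_within_open) (use AB e in \<open>auto intro: open_Times\<close>)
  ultimately show ?thesis by (simp add: case_prod_unfold)
qed

section \<open>Test functions and the lemma of du Bois-Reymond\<close>

lemma C_order_SucI:
  assumes "\<And>p. (\<psi> has_derivative D p) (at p)" "\<And>e. e \<in> Basis \<Longrightarrow> C_order k (\<lambda>p. D p e)"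
  shows "C_order (Suc k) \<psi>"
proof -
  have "D p = frechet_derivative \<psi> (at p)" for p
    using assms(1) by (rule frechet_derivative_at)
  then show ?thesis using assms by (auto intro: differentiableI)
qed

lemma C_order_SucD:
  assumes "C_order (Suc k) \<psi>"
  shows "(\<psi> has_derivative frechet_derivative \<psi> (at p)) (at p)"
    and "e \<in> Basis \<Longrightarrow> C_order k (\<lambda>p. frechet_derivative \<psi> (at p) e)"
  using assms by (auto simp: frechet_derivative_works)

lemma C_order_le_Suc: "C_order (Suc k) \<psi> \<Longrightarrow> C_order k \<psi>"
proof (induction k arbitrary: \<psi>)
  case 0
  then show ?case
    by (auto simp: continuous_on_eq_continuous_at differentiable_imp_continuous_within)
next
  case (Suc k)
  show ?case
    by (rule C_order_SucI[OF C_order_SucD(1)[OF Suc.prems]])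
       (rule Suc.IH, rule C_order_SucD(2)[OF Suc.prems])
qed

lemma C_order_continuous: "C_order k \<psi> \<Longrightarrow> continuous_on UNIV \<psi>"
  by (induction k) (auto dest: C_order_le_Suc simp del: C_order.simps(2))

lemma C_order_const: "C_order k (\<lambda>p. c)"
proof (induction k arbitrary: c)
  case (Suc k)
  show ?case by (rule C_order_SucI[of _ "\<lambda>_ _. 0"]) (use Suc in auto)
qed simp

lemma C_order_add: "C_order k \<phi> \<Longrightarrow> C_order k \<psi> \<Longrightarrow> C_order k (\<lambda>p. \<phi> p + \<psi> p)"
proof (induction k arbitrary: \<phi> \<psi>)
  case 0 then show ?case by (auto intro: continuous_intros)
next
  case (Suc k)
  show ?case
    by (rule C_order_SucI[OF has_derivative_add[OF C_order_SucD(1)[OF Suc.prems(1)] C_order_SucD(1)[OF Suc.prems(2)]]])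
       (rule Suc.IH; rule C_order_SucD(2)[OF Suc.prems(1)] C_order_SucD(2)[OF Suc.prems(2)]; assumption)
qed

lemma C_order_mult: "C_order k \<phi> \<Longrightarrow> C_order k \<psi> \<Longrightarrow> C_order k (\<lambda>p. \<phi> p * \<psi> p)"
proof (induction k arbitrary: \<phi> \<psi>)
  case 0 then show ?case by (auto intro: continuous_intros)
next
  case (Suc k)
  show ?case
  proof (rule C_order_SucI[OF has_derivative_mult[OF C_order_SucD(1)[OF Suc.prems(1)] C_order_SucD(1)[OF Suc.prems(2)]]])
    fix e :: 'a assume e: "e \<in> Basis"
    show "C_order k (\<lambda>p. \<phi> p * frechet_derivative \<psi> (at p) e + frechet_derivative \<phi> (at p) e * \<psi> p)"
      by (rule C_order_add; rule Suc.IH)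
         (rule C_order_le_Suc[OF Suc.prems(1)] C_order_SucD(2)[OF Suc.prems(2) e]
           C_order_SucD(2)[OF Suc.prems(1) e] C_order_le_Suc[OF Suc.prems(2)])+
  qed
qed

lemma C_order_sum: "finite I \<Longrightarrow> (\<And>i. i \<in> I \<Longrightarrow> C_order k (\<phi> i)) \<Longrightarrow> C_order k (\<lambda>p. \<Sum>i\<in>I. \<phi> i p)"
  by (induction I rule: finite_induct) (auto intro: C_order_add C_order_const simp del: C_order.simps)

lemma C_order_diff: "C_order k \<phi> \<Longrightarrow> C_order k \<psi> \<Longrightarrow> C_order k (\<lambda>p. \<phi> p - \<psi> p)"
  using C_order_add[of k \<phi> "\<lambda>p. - 1 * \<psi> p"] C_order_mult[OF C_order_const, of k \<psi> "- 1"]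
  by simp

lemma C_order_inverse: "C_order k \<psi> \<Longrightarrow> (\<And>p. \<psi> p \<noteq> 0) \<Longrightarrow> C_order k (\<lambda>p. inverse (\<psi> p))"
proof (induction k arbitrary: \<psi>)
  case 0 then show ?case by (auto intro: continuous_intros)
next
  case (Suc k)
  have IH: "C_order k (\<lambda>p. inverse (\<psi> p))"
    by (rule Suc.IH[OF C_order_le_Suc[OF Suc.prems(1)] Suc.prems(2)])
  show ?case
  proof (rule C_order_SucI[OF Deriv.has_derivative_inverse[OF Suc.prems(2) C_order_SucD(1)[OF Suc.prems(1)]]])
    fix e :: 'a assume e: "e \<in> Basis"
    have "C_order k (\<lambda>p. - 1 * (inverse (\<psi> p) * frechet_derivative \<psi> (at p) e * inverse (\<psi> p)))"
      by (intro C_order_mult C_order_const IH C_order_SucD(2)[OF Suc.prems(1) e])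
    then show "C_order k (\<lambda>p. - (inverse (\<psi> p) * frechet_derivative \<psi> (at p) e * inverse (\<psi> p)))"
      by simp
  qed
qed

text \<open>By the chain rule a partial derivative of the composite is a linear combination of
  partial derivatives of \<open>\<psi>\<close> composed with the same affine map, so the induction
  closes.\<close>

lemma C_order_affine:
  fixes L :: "'a::euclidean_space \<Rightarrow> 'b::euclidean_space"
  assumes L: "bounded_linear L" and "C_order k \<psi>"
  shows "C_order k (\<lambda>p. \<psi> (c + L p))"
  using assms(2)
proof (induction k arbitrary: \<psi>)
  case 0
  have "continuous_on UNIV (\<lambda>p. c + L p)"
    by (intro continuous_intros linear_continuous_on[OF L])
  then show ?case using 0 continuous_on_compose2[of UNIV \<psi> UNIV "\<lambda>p. c + L p"] by simp
next
  case (Suc k)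
  let ?D = "\<lambda>p e. \<Sum>b\<in>Basis. (L e \<bullet> b) * frechet_derivative \<psi> (at (c + L p)) b"
  show ?case
  proof (rule C_order_SucI[of _ ?D])
    fix p
    have "((\<lambda>p. c + L p) has_derivative L) (at p)"
      using bounded_linear_imp_has_derivative[OF L] by (auto intro!: derivative_eq_intros)
    from has_derivative_compose[OF this C_order_SucD(1)[OF Suc.prems]]
    have "((\<lambda>p. \<psi> (c + L p)) has_derivative (\<lambda>e. frechet_derivative \<psi> (at (c + L p)) (L e))) (at p)" .
    moreover have "frechet_derivative \<psi> (at (c + L p)) (L e) = ?D p e" for e
    proof -
      have lin: "linear (frechet_derivative \<psi> (at (c + L p)))"
        using C_order_SucD(1)[OF Suc.prems] has_derivative_linear by blast
      have "frechet_derivative \<psi> (at (c + L p)) (\<Sum>b\<in>Basis. (L e \<bullet> b) *\<^sub>R b) = ?D p e"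
        by (simp add: linear_sum[OF lin] linear_cmul[OF lin])
      then show ?thesis by (simp add: euclidean_representation)
    qed
    ultimately show "((\<lambda>p. \<psi> (c + L p)) has_derivative ?D p) (at p)" by simp
  next
    fix e :: 'a assume "e \<in> Basis"
    show "C_order k (\<lambda>p. ?D p e)"
      by (intro C_order_sum C_order_mult C_order_const) (auto intro: Suc.IH[OF C_order_SucD(2)[OF Suc.prems]])
  qed
qed

lemma C_order_fst: "C_order k \<phi> \<Longrightarrow> C_order k (\<lambda>p. \<phi> (fst p))"
  using C_order_affine[OF bounded_linear_fst, of k \<phi> 0] by simp

lemma C_order_snd: "C_order k \<phi> \<Longrightarrow> C_order k (\<lambda>p. \<phi> (snd p))"
  using C_order_affine[OF bounded_linear_snd, of k \<phi> 0] by simp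

lemma C_order_real_affine: "C_order k \<phi> \<Longrightarrow> C_order k (\<lambda>x::real. \<phi> (c + a * x))"
  using C_order_affine[OF bounded_linear_mult_right, of k \<phi> c a] by simp

lemma C_order_real_SucI:
  assumes "\<And>x. (\<phi> has_real_derivative \<phi>' x) (at x)" "C_order k \<phi>'"
  shows "C_order (Suc k) \<phi>"
  by (rule C_order_SucI[of _ "\<lambda>x h. \<phi>' x * h"]) (use assms in \<open>auto simp: has_field_derivative_def\<close>)

lemma C_order_real_deriv:
  assumes "C_order (Suc k) \<phi>"
  shows "(\<phi> has_real_derivative deriv \<phi> x) (at x)" "C_order k (deriv \<phi>)"
proof -
  have *: "(\<phi> has_real_derivative deriv \<phi> x) (at x)" for x
    using assms by (simp add: DERIV_deriv_iff_real_differentiable)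
  show "(\<phi> has_real_derivative deriv \<phi> x) (at x)" by (rule *)
  have "frechet_derivative \<phi> (at x) 1 = deriv \<phi> x" for x
    using frechet_derivative_at[OF *[of x, unfolded has_field_derivative_def]] by (metis mult.right_neutral)
  then show "C_order k (deriv \<phi>)" using assms by simp
qed

text \<open>The family \<open>q (1/x) * exp (-1/x)\<close>, extended by zero, is closed under
  differentiation: with t = 1/x, the polynomial \<open>q\<close> becomes t^2 (q - q'). Smoothness of
  all members thus follows from one induction.\<close>

definition exp_poly :: "real poly \<Rightarrow> real \<Rightarrow> real" where
  "exp_poly q x = (if x > 0 then poly q (1 / x) * exp (- (1 / x)) else 0)"

lemma poly_div_exp_tendsto_0: "((\<lambda>t::real. t ^ k * poly q t / exp t) \<longlongrightarrow> 0) at_top"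
proof (induction q arbitrary: k)
  case (pCons a q)
  have "((\<lambda>t. a * (t ^ k / exp t) + t ^ Suc k * poly q t / exp t) \<longlongrightarrow> a * 0 + 0) at_top"
    by (intro tendsto_intros tendsto_power_div_exp_0 pCons.IH)
  moreover have "(\<lambda>t. a * (t ^ k / exp t) + t ^ Suc k * poly q t / exp t) = (\<lambda>t. t ^ k * poly (pCons a q) t / exp t)"
    by (auto simp: field_simps)
  ultimately show ?case by simp
qed simp

lemma exp_poly_deriv:
  "(exp_poly q has_real_derivative exp_poly ([:0, 0, 1:] * (q - pderiv q)) x) (at x)"
proof -
  consider "x > 0" | "x < 0" | "x = 0" by linarith
  then show ?thesis
  proof cases
    case 1
    have "((\<lambda>x. poly q (1 / x) * exp (- (1 / x))) has_real_derivative
       exp_poly ([:0, 0, 1:] * (q - pderiv q)) x) (at x)"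
      using 1 by (auto intro!: derivative_eq_intros poly_DERIV[THEN DERIV_chain2]
          simp: exp_poly_def field_simps power2_eq_square)
    then show ?thesis
      by (rule has_field_derivative_transform_within_open[where S = "{0<..}"])
         (use 1 in \<open>auto simp: exp_poly_def\<close>)
  next
    case 2
    have "((\<lambda>x. 0) has_real_derivative exp_poly ([:0, 0, 1:] * (q - pderiv q)) x) (at x)"
      using 2 by (simp add: exp_poly_def)
    then show ?thesis
      by (rule has_field_derivative_transform_within_open[where S = "{..<0}"])
         (use 2 in \<open>auto simp: exp_poly_def\<close>)
  next
    case 3
    have "((\<lambda>h. (exp_poly q (0 + h) - exp_poly q 0) / h) \<longlongrightarrow> 0) (at 0)"
    proof (rule filterlim_split_at)
      have "((\<lambda>h. 0) \<longlongrightarrow> 0) (at_left (0::real))" by simp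
      moreover have "eventually (\<lambda>h. 0 = (exp_poly q (0 + h) - exp_poly q 0) / h) (at_left 0)"
        by (auto simp: eventually_at_filter exp_poly_def)
      ultimately show "((\<lambda>h. (exp_poly q (0 + h) - exp_poly q 0) / h) \<longlongrightarrow> 0) (at_left 0)"
        by (rule Lim_transform_eventually)
    next
      have "((\<lambda>h. inverse h ^ 1 * poly q (inverse h) / exp (inverse h)) \<longlongrightarrow> 0) (at_right 0)"
        by (rule filterlim_compose[OF poly_div_exp_tendsto_0 filterlim_inverse_at_top_right])
      moreover have "eventually (\<lambda>h. inverse h ^ 1 * poly q (inverse h) / exp (inverse h) =
          (exp_poly q (0 + h) - exp_poly q 0) / h) (at_right 0)"
        by (auto simp: eventually_at_filter exp_poly_def exp_minus field_simps)
      ultimately show "((\<lambda>h. (exp_poly q (0 + h) - exp_poly q 0) / h) \<longlongrightarrow> 0) (at_right 0)"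
        by (rule Lim_transform_eventually)
    qed
    then show ?thesis using 3 by (simp add: DERIV_def exp_poly_def)
  qed
qed

lemma C_order_exp_poly: "C_order k (exp_poly q)"
proof (induction k arbitrary: q)
  case 0
  show ?case using exp_poly_deriv DERIV_isCont by (fastforce simp: continuous_on_eq_continuous_at)
next
  case (Suc k)
  show ?case by (rule C_order_real_SucI[OF exp_poly_deriv Suc.IH])
qed

definition smooth_step :: "real \<Rightarrow> real" where
  "smooth_step x = exp_poly 1 x / (exp_poly 1 x + exp_poly 1 (1 - x))"

lemma smooth_step_denom: "exp_poly 1 x + exp_poly 1 (1 - x) > 0"
  by (auto simp: exp_poly_def add_pos_pos)

lemma C_order_smooth_step: "C_order k smooth_step"
proof -
  have "C_order k (\<lambda>x. exp_poly 1 x * inverse (exp_poly 1 x + exp_poly 1 (1 + (- 1) * x)))"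
    by (intro C_order_mult C_order_inverse C_order_add C_order_exp_poly C_order_real_affine)
       (use smooth_step_denom in \<open>simp add: less_imp_neq[symmetric]\<close>)
  then show ?thesis unfolding smooth_step_def[abs_def] by (simp add: divide_inverse)
qed

lemma smooth_step_simps:
  "x \<le> 0 \<Longrightarrow> smooth_step x = 0" "x \<ge> 1 \<Longrightarrow> smooth_step x = 1" "0 \<le> smooth_step x" "smooth_step x \<le> 1"
  using smooth_step_denom[of x] by (auto simp: smooth_step_def exp_poly_def divide_simps)

section \<open>Test functions: supports, products and smoothed indicators\<close>

lemma test_funI: "(\<And>k. C_order k \<psi>) \<Longrightarrow> bounded {p. \<psi> p \<noteq> 0} \<Longrightarrow> test_fun \<psi>"
  by (simp add: test_fun_def)

lemma test_fun_support:
  assumes "test_fun \<psi>" obtains M where "M > 0" "\<And>p. \<psi> p \<noteq> 0 \<Longrightarrow> norm p \<le> M"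
  using assms unfolding test_fun_def compact_closure bounded_pos by auto

lemma test_fun_affine:
  assumes "test_fun \<theta>" "a \<noteq> 0"
  shows "test_fun (\<lambda>x::real. \<theta> (c + a * x))"
proof (rule test_funI)
  show "C_order k (\<lambda>x. \<theta> (c + a * x))" for k
    using assms by (auto simp: test_fun_def intro: C_order_real_affine)
  obtain M where M: "\<And>p. \<theta> p \<noteq> 0 \<Longrightarrow> norm p \<le> M" using test_fun_support[OF assms(1)] by metis
  have "{p. \<theta> (c + a * p) \<noteq> 0} \<subseteq> cball 0 ((M + \<bar>c\<bar>) / \<bar>a\<bar>)"
  proof
    fix x assume "x \<in> {p. \<theta> (c + a * p) \<noteq> 0}"
    then have "\<bar>c + a * x\<bar> \<le> M" using M by auto
    then have "\<bar>a * x\<bar> \<le> M + \<bar>c\<bar>" by linarith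
    then show "x \<in> cball 0 ((M + \<bar>c\<bar>) / \<bar>a\<bar>)" using assms(2) by (simp add: abs_mult field_simps)
  qed
  then show "bounded {p. \<theta> (c + a * p) \<noteq> 0}" by (rule bounded_subset[OF bounded_cball])
qed

lemma test_fun_deriv_support:
  assumes "test_fun \<theta>" "\<And>x. \<theta> x \<noteq> 0 \<Longrightarrow> x \<in> {a..b}"
  shows "deriv \<theta> x \<noteq> 0 \<Longrightarrow> x \<in> {a..b}"
proof (rule ccontr)
  assume d: "deriv \<theta> x \<noteq> 0" and x: "x \<notin> {a..b}"
  have "((\<lambda>_. 0) has_real_derivative 0) (at x)" by simp
  then have "(\<theta> has_real_derivative 0) (at x)"
    by (rule has_field_derivative_transform_within_open[where S = "- {a..b}"])
       (use assms x in \<open>auto intro: closed_real_atLeastAtMost\<close>)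
  then show False using d DERIV_imp_deriv by blast
qed

lemma test_fun_prod:
  assumes "test_fun \<phi>" "test_fun \<theta>"
  shows "test_fun (\<lambda>p::real \<times> real. \<phi> (fst p) * \<theta> (snd p))"
    and "frechet_derivative (\<lambda>p::real \<times> real. \<phi> (fst p) * \<theta> (snd p)) (at p) (1, 0) = deriv \<phi> (fst p) * \<theta> (snd p)"
    and "frechet_derivative (\<lambda>p::real \<times> real. \<phi> (fst p) * \<theta> (snd p)) (at p) (0, 1) = \<phi> (fst p) * deriv \<theta> (snd p)"
proof -
  have C: "C_order k \<phi>" "C_order k \<theta>" for k using assms by (auto simp: test_fun_def)
  show "test_fun (\<lambda>p::real \<times> real. \<phi> (fst p) * \<theta> (snd p))"
  proof (rule test_funI)
    show "C_order k (\<lambda>p::real \<times> real. \<phi> (fst p) * \<theta> (snd p))" for k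
      by (intro C_order_mult C_order_fst C_order_snd C)
    have "bounded ({x. \<phi> x \<noteq> 0} \<times> {v. \<theta> v \<noteq> 0})"
      using assms by (intro bounded_Times) (auto simp: test_fun_def)
    then show "bounded {p::real \<times> real. \<phi> (fst p) * \<theta> (snd p) \<noteq> 0}"
      by (rule bounded_subset) auto
  qed
  have "((\<lambda>p. \<phi> (fst p)) has_derivative (\<lambda>h. deriv \<phi> (fst p) * fst h)) (at p)" for p :: "real \<times> real"
    using has_derivative_compose[OF bounded_linear_imp_has_derivative[OF bounded_linear_fst, of "at p"]
        C_order_real_deriv(1)[OF C(1), unfolded has_field_derivative_def]] by simp
  moreover have "((\<lambda>p. \<theta> (snd p)) has_derivative (\<lambda>h. deriv \<theta> (snd p) * snd h)) (at p)" for p :: "real \<times> real"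
    using has_derivative_compose[OF bounded_linear_imp_has_derivative[OF bounded_linear_snd, of "at p"]
        C_order_real_deriv(1)[OF C(2), unfolded has_field_derivative_def]] by simp
  ultimately have "((\<lambda>p. \<phi> (fst p) * \<theta> (snd p)) has_derivative
      (\<lambda>h. \<phi> (fst p) * (deriv \<theta> (snd p) * snd h) + deriv \<phi> (fst p) * fst h * \<theta> (snd p))) (at p)"
    by (rule has_derivative_mult)
  note * = frechet_derivative_at[OF this, symmetric]
  show "frechet_derivative (\<lambda>p::real \<times> real. \<phi> (fst p) * \<theta> (snd p)) (at p) (1, 0) = deriv \<phi> (fst p) * \<theta> (snd p)"
    "frechet_derivative (\<lambda>p::real \<times> real. \<phi> (fst p) * \<theta> (snd p)) (at p) (0, 1) = \<phi> (fst p) * deriv \<theta> (snd p)"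
    by (simp_all add: *)
qed

text \<open>A smooth version of the indicator of (a, b]: both edges lie to the right of their end
  point and have width 1 / (n + 1). As a difference of two translated steps, its derivative is a
  difference of two approximate point masses, for every \<open>n\<close> and without a condition on
  b - a.\<close>

definition bump :: "real \<Rightarrow> real \<Rightarrow> nat \<Rightarrow> real \<Rightarrow> real" where
  "bump a b n x = smooth_step (real (Suc n) * (x - a)) - smooth_step (real (Suc n) * (x - b))"

lemma bump_eq_affine:
  "bump a b n = (\<lambda>x. smooth_step (- real (Suc n) * a + real (Suc n) * x) - smooth_step (- real (Suc n) * b + real (Suc n) * x))"
  by (rule ext) (simp add: bump_def algebra_simps)

lemma bump_support: 
  assumes "a < b" "bump a b n x \<noteq> 0" shows "a < x" "x < b + 1 / real (Suc n)"
proof -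
  have "\<not> x \<le> a"
  proof
    assume "x \<le> a"
    then have "real (Suc n) * (x - a) \<le> 0" "real (Suc n) * (x - b) \<le> 0"
      using assms(1) by (auto intro!: mult_nonneg_nonpos)
    then show False using assms(2) by (simp add: bump_def smooth_step_simps)
  qed
  then show "a < x" by simp
  have "\<not> b + 1 / real (Suc n) \<le> x"
  proof
    assume "b + 1 / real (Suc n) \<le> x"
    then have b: "1 \<le> real (Suc n) * (x - b)" by (simp add: field_simps)
    have "real (Suc n) * (x - b) \<le> real (Suc n) * (x - a)" using assms(1) by (intro mult_left_mono) auto
    then have "smooth_step (real (Suc n) * (x - a)) = 1" "smooth_step (real (Suc n) * (x - b)) = 1"
      using smooth_step_simps(2)[OF b] smooth_step_simps(2)[OF order_trans[OF b]] by blast+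
    then show False using assms(2) unfolding bump_def by simp
  qed
  then show "x < b + 1 / real (Suc n)" by simp
qed

lemma bump_support': assumes "a < b" "bump a b n x \<noteq> 0" shows "x \<in> {a..b + 1}"
proof -
  have "1 / real (Suc n) \<le> 1" by simp
  then show ?thesis using bump_support[OF assms] unfolding atLeastAtMost_iff by linarith
qed

lemma test_fun_bump: assumes "a < b" shows "test_fun (bump a b n)"
proof (rule test_funI)
  show "C_order k (bump a b n)" for k
    unfolding bump_eq_affine by (intro C_order_diff C_order_real_affine C_order_smooth_step)
  show "bounded {p. bump a b n p \<noteq> 0}"
    by (rule bounded_subset[OF bounded_closed_interval[of a "b + 1"]]) (use bump_support'[OF assms] in auto)
qed

lemma bump_abs_le_1: "\<bar>bump a b n x\<bar> \<le> 1"
  using smooth_step_simps(3,4)[of "real (Suc n) * (x - a)"] smooth_step_simps(3,4)[of "real (Suc n) * (x - b)"]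
  unfolding bump_def by linarith

lemma smooth_step_tendsto:
  "(\<lambda>n. smooth_step (real (Suc n) * (x - a))) \<longlonglongrightarrow> indicator {a<..} x"
proof (cases "x > a")
  case True
  obtain N :: nat where N: "1 / (x - a) \<le> real N" using real_arch_simple by blast
  have "smooth_step (real (Suc n) * (x - a)) = indicator {a<..} x" if "n \<ge> N" for n
  proof -
    have "1 / (x - a) \<le> real (Suc n)" using N that by linarith
    then show ?thesis using True by (simp add: smooth_step_simps field_simps)
  qed
  then show ?thesis by (intro tendsto_eventually) (auto simp: eventually_sequentially)
next
  case False
  then have "real (Suc n) * (x - a) \<le> 0" for n by (intro mult_nonneg_nonpos) auto
  then have "smooth_step (real (Suc n) * (x - a)) = 0" for n by (rule smooth_step_simps(1))
  then show ?thesis using False by simp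
qed

lemma bump_tendsto: "(\<lambda>n. bump a b n x) \<longlonglongrightarrow> indicator {a<..} x - indicator {b<..} x"
  unfolding bump_def by (intro tendsto_diff smooth_step_tendsto)

lemma bump_integral_tendsto:
  fixes w :: "real \<Rightarrow> real"
  assumes w: "w \<in> borel_measurable borel" "\<And>a b. set_integrable lborel {a..b} w" and ab: "a < b"
  shows "(\<lambda>n. LINT x|lborel. w x * bump a b n x) \<longlonglongrightarrow> (LINT x:{a..b}|lborel. w x)"
proof -
  have cont: "continuous_on UNIV (bump a b n)" for n
    using test_fun_bump[OF ab] C_order_continuous unfolding test_fun_def by blast
  have lim: "(\<lambda>n. LINT x|lborel. w x * bump a b n x) \<longlonglongrightarrow>
      (LINT x|lborel. w x * (indicator {a<..} x - indicator {b<..} x))"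
  proof (rule integral_dominated_convergence[where w = "\<lambda>x. \<bar>indicator {a..b + 1} x *\<^sub>R w x\<bar>"])
    show "(\<lambda>x. w x * bump a b n x) \<in> borel_measurable lborel" for n
      using w(1) borel_measurable_continuous_onI[OF cont] by measurable
    show "integrable lborel (\<lambda>x. \<bar>indicator {a..b + 1} x *\<^sub>R w x\<bar>)"
      using w(2)[of a "b + 1"] unfolding set_integrable_def by (rule integrable_abs)
    show "AE x in lborel. (\<lambda>n. w x * bump a b n x) \<longlonglongrightarrow> w x * (indicator {a<..} x - indicator {b<..} x)"
      by (intro AE_I2 tendsto_mult tendsto_const bump_tendsto)
    show "AE x in lborel. norm (w x * bump a b n x) \<le> \<bar>indicator {a..b + 1} x *\<^sub>R w x\<bar>" for n
    proof (intro AE_I2)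
      fix x
      have "\<bar>w x\<bar> * \<bar>bump a b n x\<bar> \<le> \<bar>w x\<bar>" using bump_abs_le_1 mult_left_mono[of _ 1 "\<bar>w x\<bar>"] by simp
      then show "norm (w x * bump a b n x) \<le> \<bar>indicator {a..b + 1} x *\<^sub>R w x\<bar>"
        using bump_support'[OF ab, of n x] by (cases "bump a b n x = 0") (auto simp: abs_mult)
    qed
    show "(\<lambda>x. w x * (indicator {a<..} x - indicator {b<..} x)) \<in> borel_measurable lborel"
      using w(1) by measurable
  qed
  have "(LINT x|lborel. w x * (indicator {a<..} x - indicator {b<..} x)) = (LINT x:{a..b}|lborel. w x)"
    unfolding set_lebesgue_integral_def
  proof (rule integral_cong_AE)
    have "AE x in lborel. x \<noteq> a" by (rule AE_lborel_singleton)
    then show "AE x in lborel. w x * (indicator {a<..} x - indicator {b<..} x) = indicator {a..b} x *\<^sub>R w x"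
      by eventually_elim (use ab in \<open>auto simp: indicator_def\<close>)
  qed (use w(1) in measurable)
  then show ?thesis using lim by simp
qed

text \<open>The rescaled derivatives form an approximate identity at \<open>a\<close>: their
  supports shrink to \<open>a\<close> from the right, and their mass is
  \<open>smooth_step 1 - smooth_step 0 = 1\<close>. The substitution y = (n + 1) (x - a) brings them
  to a fixed support.\<close>

lemma smooth_step_deriv_integral_tendsto:
  fixes u :: "real \<Rightarrow> real"
  assumes u: "continuous_on UNIV u"
  shows "integrable lborel (\<lambda>x. u x * (real (Suc n) * deriv smooth_step (real (Suc n) * (x - a))))" (is ?int)
    and "(\<lambda>n. LINT x|lborel. u x * (real (Suc n) * deriv smooth_step (real (Suc n) * (x - a)))) \<longlonglongrightarrow> u a" (is ?lim)
proof -
  let ?\<eta> = "deriv smooth_step"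
  have d: "(smooth_step has_real_derivative ?\<eta> x) (at x)" for x by (rule C_order_real_deriv(1)[OF C_order_smooth_step])
  have c: "continuous_on UNIV ?\<eta>" by (rule C_order_continuous[OF C_order_real_deriv(2)[OF C_order_smooth_step, of 0]])
  have supp: "?\<eta> x = 0" if "x \<notin> {0..1}" for x
  proof -
    have "(smooth_step has_real_derivative 0) (at x)"
    proof (cases "x < 0")
      case True
      have "((\<lambda>_. 0) has_real_derivative 0) (at x)" by simp
      then show ?thesis
        by (rule has_field_derivative_transform_within_open[where S = "{..<0}"])
           (use True in \<open>auto simp: smooth_step_simps\<close>)
    next
      case False
      have "((\<lambda>_. 1) has_real_derivative 0) (at x)" by simp
      then show ?thesis
        by (rule has_field_derivative_transform_within_open[where S = "{1<..}"])
           (use False that in \<open>auto simp: smooth_step_simps\<close>)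
    qed
    then show ?thesis by (rule DERIV_imp_deriv)
  qed
  have int: "integrable lborel (\<lambda>y. u (a + y / t) * ?\<eta> y)" if "t > 0" for t
  proof -
    have "continuous_on {0..1} (\<lambda>y. u (a + y / t) * ?\<eta> y)"
      by (intro continuous_intros continuous_on_compose2[OF u] continuous_on_subset[OF c]) (use that in auto)
    then have "integrable lborel (\<lambda>y. indicator {0..1} y *\<^sub>R (u (a + y / t) * ?\<eta> y))"
      using borel_integrable_atLeastAtMost'[of 0 1 "\<lambda>y. u (a + y / t) * ?\<eta> y"] unfolding set_integrable_def by simp
    then show ?thesis
      by (rule Bochner_Integration.integrable_cong[THEN iffD1, rotated -1]) (use supp in \<open>auto simp: indicator_def\<close>)
  qed
  have aff: "u (a + 1 / t * y) * (t * ?\<eta> (t * (a + 1 / t * y - a))) = t * (u (a + y / t) * ?\<eta> y)" if "t > 0" for t y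
    using that by simp
  show ?int
  proof -
    let ?t = "real (Suc n)"
    have "integrable lborel (\<lambda>y. u (a + 1 / ?t * y) * (?t * ?\<eta> (?t * (a + 1 / ?t * y - a))))"
      unfolding aff[of ?t, simplified of_nat_0_less_iff, OF zero_less_Suc] by (intro integrable_mult_right int) simp
    then show ?thesis
      by (subst lborel_integrable_real_affine_iff[symmetric, of "1 / ?t" _ a]) simp_all
  qed
  have "(\<lambda>n. LINT y|lborel. u (a + y / real (Suc n)) * ?\<eta> y) \<longlonglongrightarrow> (LINT y|lborel. u a * ?\<eta> y)"
  proof -
    have "bounded (u ` {a..a + 1})"
      by (intro compact_imp_bounded compact_continuous_image continuous_on_subset[OF u]) auto
    then obtain B where B: "\<And>x. x \<in> {a..a + 1} \<Longrightarrow> \<bar>u x\<bar> \<le> B"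
      unfolding bounded_iff by (metis image_eqI real_norm_def)
    show ?thesis
    proof (rule integral_dominated_convergence[where w = "\<lambda>y. B * \<bar>?\<eta> y\<bar>"])
      show "integrable lborel (\<lambda>y. B * \<bar>?\<eta> y\<bar>)"
      proof -
        have "continuous_on {0..1} ?\<eta>" using c continuous_on_subset by blast
        then have "integrable lborel (\<lambda>y. indicator {0..1} y *\<^sub>R ?\<eta> y)"
          using borel_integrable_atLeastAtMost'[of 0 1 ?\<eta>] unfolding set_integrable_def by simp
        then have "integrable lborel ?\<eta>"
          by (rule Bochner_Integration.integrable_cong[THEN iffD1, rotated -1]) (use supp in \<open>auto simp: indicator_def\<close>)
        then show ?thesis by simp
      qed
      show "AE y in lborel. (\<lambda>n. u (a + y / real (Suc n)) * ?\<eta> y) \<longlonglongrightarrow> u a * ?\<eta> y"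
      proof (intro AE_I2 tendsto_mult tendsto_const)
        fix y
        have "(\<lambda>n. y * inverse (real (Suc n))) \<longlonglongrightarrow> y * 0"
          by (intro tendsto_mult tendsto_const LIMSEQ_inverse_real_of_nat)
        then have "(\<lambda>n. a + y / real (Suc n)) \<longlonglongrightarrow> a + 0"
          by (intro tendsto_add tendsto_const) (simp add: divide_inverse)
        then show "(\<lambda>n. u (a + y / real (Suc n))) \<longlonglongrightarrow> u a"
          using u isCont_tendsto_compose[of a u] by (simp add: continuous_on_eq_continuous_at)
      qed
      show "AE y in lborel. norm (u (a + y / real (Suc n)) * ?\<eta> y) \<le> B * \<bar>?\<eta> y\<bar>" for n
      proof (intro AE_I2)
        fix y
        show "norm (u (a + y / real (Suc n)) * ?\<eta> y) \<le> B * \<bar>?\<eta> y\<bar>"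
        proof (cases "y \<in> {0..1}")
          case True
          then have "y / real (Suc n) \<le> 1" by (simp add: field_simps)
          then have "a + y / real (Suc n) \<in> {a..a + 1}" using True by simp
          then show ?thesis using B by (simp add: abs_mult mult_right_mono)
        qed (simp add: supp)
      qed
    qed (use int[of "real (Suc _)"] c in \<open>auto intro!: borel_measurable_integrable borel_measurable_continuous_onI continuous_intros\<close>)
  qed
  also have "(LINT y|lborel. u a * ?\<eta> y) = u a"
  proof -
    have "(LINT y|lborel. ?\<eta> y) = (LINT y|lborel. indicator {0..1} y *\<^sub>R ?\<eta> y)"
      by (intro Bochner_Integration.integral_cong) (use supp in \<open>auto simp: indicator_def\<close>)
    also have "\<dots> = smooth_step 1 - smooth_step 0"
      by (rule integral_FTC_atLeastAtMost)
         (use d c in \<open>auto simp: has_real_derivative_iff_has_vector_derivative[symmetric]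
            intro: has_field_derivative_at_within continuous_on_subset\<close>)
    finally show ?thesis by (simp add: smooth_step_simps)
  qed
  finally have "(\<lambda>n. LINT y|lborel. u (a + y / real (Suc n)) * ?\<eta> y) \<longlonglongrightarrow> u a" .
  moreover have "(LINT y|lborel. u (a + y / real (Suc n)) * ?\<eta> y) =
      (LINT x|lborel. u x * (real (Suc n) * ?\<eta> (real (Suc n) * (x - a))))" for n
    using lborel_integral_real_affine[of "1 / real (Suc n)" "\<lambda>x. u x * (real (Suc n) * ?\<eta> (real (Suc n) * (x - a)))" a]
    unfolding aff[of "real (Suc n)", simplified of_nat_0_less_iff, OF zero_less_Suc] by simp
  ultimately show ?lim by simp
qed

text \<open>Test with \<open>bump a b n\<close>: its derivative tends to the point mass at
  \<open>a\<close> minus the point mass at \<open>b\<close>, while the bump itself tends boundedly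
  to the indicator of (a, b]. Continuity of \<open>u\<close> gives the increment at every pair of
  points, not only at almost every pair.\<close>

theorem du_bois_reymond:
  fixes u w :: "real \<Rightarrow> real"
  assumes u: "continuous_on UNIV u"
    and w: "w \<in> borel_measurable borel" "\<And>a b. set_integrable lborel {a..b} w"
    and weak: "\<And>\<phi>. test_fun \<phi> \<Longrightarrow> (LINT x|lborel. u x * deriv \<phi> x) = - (LINT x|lborel. w x * \<phi> x)"
    and ab: "a < b"
  shows "u b - u a = (LINT x:{a..b}|lborel. w x)"
proof -
  let ?\<eta> = "\<lambda>n a x. real (Suc n) * deriv smooth_step (real (Suc n) * (x - a))"
  have d: "deriv (bump a b n) x = ?\<eta> n a x - ?\<eta> n b x" for n x
  proof (rule DERIV_imp_deriv)
    have "((\<lambda>x. smooth_step (real (Suc n) * (x - c))) has_real_derivative ?\<eta> n c x) (at x)" for c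
    proof -
      have "((\<lambda>x. real (Suc n) * (x - c)) has_real_derivative real (Suc n)) (at x)"
        by (auto intro!: derivative_eq_intros)
      from DERIV_chain2[OF C_order_real_deriv(1)[OF C_order_smooth_step] this]
      show ?thesis by (simp only: mult.commute)
    qed
    then show "(bump a b n has_real_derivative ?\<eta> n a x - ?\<eta> n b x) (at x)"
      unfolding bump_def[abs_def] by (intro DERIV_diff)
  qed
  have eq: "(LINT x|lborel. u x * ?\<eta> n a x) - (LINT x|lborel. u x * ?\<eta> n b x) = - (LINT x|lborel. w x * bump a b n x)" for n
  proof -
    have "- (LINT x|lborel. w x * bump a b n x) = (LINT x|lborel. u x * deriv (bump a b n) x)"
      using weak[OF test_fun_bump[OF ab]] by simp
    also have "\<dots> = (LINT x|lborel. u x * ?\<eta> n a x - u x * ?\<eta> n b x)"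
      unfolding d by (simp only: right_diff_distrib[of "u _"])
    also have "\<dots> = (LINT x|lborel. u x * ?\<eta> n a x) - (LINT x|lborel. u x * ?\<eta> n b x)"
      by (rule Bochner_Integration.integral_diff) (rule smooth_step_deriv_integral_tendsto(1)[OF u])+
    finally show ?thesis by simp
  qed
  have "(\<lambda>n. (LINT x|lborel. u x * ?\<eta> n a x) - (LINT x|lborel. u x * ?\<eta> n b x)) \<longlonglongrightarrow> u a - u b"
    by (intro tendsto_diff smooth_step_deriv_integral_tendsto(2)[OF u])
  moreover have "(\<lambda>n. - (LINT x|lborel. w x * bump a b n x)) \<longlonglongrightarrow> - (LINT x:{a..b}|lborel. w x)"
    by (intro tendsto_minus bump_integral_tendsto w ab)
  ultimately have "u a - u b = - (LINT x:{a..b}|lborel. w x)"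
    unfolding eq using LIMSEQ_unique by blast
  then show ?thesis by simp
qed

section \<open>Constancy along characteristics\<close>

lemma DERIV_zeroI:
  fixes f :: "real \<Rightarrow> real"
  assumes "\<And>e. e > 0 \<Longrightarrow> \<exists>d>0. \<forall>y. \<bar>y - x\<bar> < d \<longrightarrow> \<bar>f y - f x\<bar> \<le> e * \<bar>y - x\<bar>"
  shows "(f has_real_derivative 0) (at x)"
  unfolding has_field_derivative_def has_derivative_at_alt
  using assms by (auto intro: bounded_linear_mult_right)

lemma AE_bounded_set_integral:
  fixes w :: "real \<Rightarrow> real"
  assumes w: "w \<in> borel_measurable borel" and ab: "a \<le> b"
    and bd: "AE x in lborel. x \<in> {a..b} \<longrightarrow> \<bar>w x\<bar> \<le> C"
  shows "set_integrable lborel {a..b} w" and "\<bar>LINT x:{a..b}|lborel. w x\<bar> \<le> C * (b - a)"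
proof -
  have i: "integrable lborel (\<lambda>x. C * indicator {a..b} x)"
    by (intro integrable_mult_right integrable_real_indicator) (auto simp: emeasure_lborel_Icc_eq)
  have le: "AE x in lborel. norm (indicator {a..b} x *\<^sub>R w x) \<le> C * indicator {a..b} x"
    using bd by eventually_elim (auto simp: indicator_def)
  show si: "set_integrable lborel {a..b} w"
    unfolding set_integrable_def
  proof (rule Bochner_Integration.integrable_bound[OF i])
    show "(\<lambda>x. indicator {a..b} x *\<^sub>R w x) \<in> borel_measurable lborel" using w by measurable
    show "AE x in lborel. norm (indicator {a..b} x *\<^sub>R w x) \<le> norm (C * indicator {a..b} x)"
      using le by eventually_elim simp
  qed
  have "\<bar>LINT x:{a..b}|lborel. w x\<bar> \<le> (LINT x|lborel. norm (indicator {a..b} x *\<^sub>R w x))"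
    unfolding set_lebesgue_integral_def real_norm_def[symmetric] by (rule integral_norm_bound)
  also have "\<dots> \<le> (LINT x|lborel. C * indicator {a..b} x)"
    by (rule integral_mono_AE) (use si i le in \<open>auto simp: set_integrable_def intro: integrable_norm\<close>)
  also have "\<dots> = C * (b - a)" using ab by simp
  finally show "\<bar>LINT x:{a..b}|lborel. w x\<bar> \<le> C * (b - a)" .
qed

text \<open>\<open>h\<close> has no meaningful value at \<open>x0\<close>, but it is locally
  bounded, and the factor \<open>l x0 - l x\<close> tends to 0. The increments of \<open>R\<close>
  are therefore of smaller order than the length of the interval. This transfers statements about
  \<open>h\<close> almost everywhere to a prescribed point.\<close>

lemma integral_increment_deriv_zero:
  fixes R h l :: "real \<Rightarrow> real"
  assumes hm: "h \<in> borel_measurable borel"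
    and hb: "\<And>a b. \<exists>B. AE x in lborel. x \<in> {a..b} \<longrightarrow> \<bar>h x\<bar> \<le> B"
    and lm: "l \<in> borel_measurable borel" and lc: "isCont l x0" and \<delta>: "0 < \<delta>"
    and R: "\<And>a b. a < b \<Longrightarrow> {a..b} \<subseteq> ball x0 \<delta> \<Longrightarrow> R b - R a = (LINT x:{a..b}|lborel. h x * (l x0 - l x))"
  shows "(R has_real_derivative 0) (at x0)"
proof (rule DERIV_zeroI)
  fix e :: real assume e: "e > 0"
  obtain B0 where B0: "AE x in lborel. x \<in> {x0 - 1..x0 + 1} \<longrightarrow> \<bar>h x\<bar> \<le> B0" using hb by blast
  define B where "B = max 0 B0"
  have B: "B \<ge> 0" "AE x in lborel. x \<in> {x0 - 1..x0 + 1} \<longrightarrow> \<bar>h x\<bar> \<le> B"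
    using B0 by (auto simp: B_def elim: eventually_mono)
  define e' where "e' = e / (B + 1)"
  have e': "e' > 0" "B * e' \<le> e" using e B(1) by (auto simp: e'_def field_simps)
  obtain d where d: "d > 0" "\<And>x. \<bar>x - x0\<bar> < d \<Longrightarrow> \<bar>l x - l x0\<bar> < e'"
    using lc e'(1) unfolding continuous_at_eps_delta by (metis dist_real_def)
  define d' where "d' = min (min d 1) \<delta>"
  have hlm: "(\<lambda>x. h x * (l x0 - l x)) \<in> borel_measurable borel" using hm lm by measurable
  have bound: "\<bar>R b - R a\<bar> \<le> (B * e') * (b - a)"
    if ab: "a < b" "\<And>x. x \<in> {a..b} \<Longrightarrow> \<bar>x - x0\<bar> < d'" for a b
  proof -
    have sub: "{a..b} \<subseteq> ball x0 \<delta>"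
    proof
      fix x assume "x \<in> {a..b}"
      then show "x \<in> ball x0 \<delta>" using ab(2)[of x] by (simp add: d'_def dist_real_def abs_minus_commute)
    qed
    show ?thesis
      unfolding R[OF ab(1) sub]
    proof (rule AE_bounded_set_integral(2)[OF hlm])
      show "AE x in lborel. x \<in> {a..b} \<longrightarrow> \<bar>h x * (l x0 - l x)\<bar> \<le> B * e'"
        using B(2)
      proof eventually_elim
        case (elim x)
        show ?case
        proof
          assume x: "x \<in> {a..b}"
          have "\<bar>x - x0\<bar> < 1" "\<bar>x - x0\<bar> < d" using ab(2)[OF x] by (auto simp: d'_def)
          then have "\<bar>h x\<bar> \<le> B" "\<bar>l x0 - l x\<bar> \<le> e'"
            using elim d(2)[of x] by (auto simp: abs_less_iff abs_minus_commute)
          then show "\<bar>h x * (l x0 - l x)\<bar> \<le> B * e'"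
            using B(1) by (auto simp: abs_mult intro!: mult_mono)
        qed
      qed
    qed (use ab in simp)
  qed
  have "\<bar>R y - R x0\<bar> \<le> e * \<bar>y - x0\<bar>" if y: "\<bar>y - x0\<bar> < d'" for y
  proof -
    have "\<bar>R y - R x0\<bar> \<le> (B * e') * \<bar>y - x0\<bar>"
    proof (cases y x0 rule: linorder_cases)
      case less
      have "\<bar>R x0 - R y\<bar> \<le> (B * e') * (x0 - y)" by (rule bound[OF less]) (use y in auto)
      then show ?thesis using less by (simp add: abs_minus_commute)
    next
      case greater
      have "\<bar>R y - R x0\<bar> \<le> (B * e') * (y - x0)" by (rule bound[OF greater]) (use y in auto)
      then show ?thesis using greater by simp
    qed simp
    also have "\<dots> \<le> e * \<bar>y - x0\<bar>" using e'(2) by (intro mult_right_mono) auto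
    finally show ?thesis .
  qed
  moreover have "d' > 0" using d(1) \<delta> by (simp add: d'_def)
  ultimately show "\<exists>d>0. \<forall>y. \<bar>y - x0\<bar> < d \<longrightarrow> \<bar>R y - R x0\<bar> \<le> e * \<bar>y - x0\<bar>" by blast
qed

lemma lborel_integral_indicator_continuous:
  fixes k :: "real \<Rightarrow> real"
  assumes "continuous_on {p..q} k"
  shows "(LINT v|lborel. indicator {p..q} v *\<^sub>R k v) = integral {p..q} k"
  using set_borel_integral_eq_integral(2)[OF borel_integrable_atLeastAtMost'[OF assms]]
  unfolding set_lebesgue_integral_def .

text \<open>Smoothed indicators show that \<open>w\<close> has vanishing integral over every compact
  interval in the half-line; differentiating in the upper end point gives
  \<open>w v = 0\<close>.\<close>

lemma fundamental_lemma_halfline: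
  fixes w :: "real \<Rightarrow> real"
  assumes w: "continuous_on {0<..} w"
    and zero: "\<And>\<theta> p q. test_fun \<theta> \<Longrightarrow> 0 < p \<Longrightarrow> p < q \<Longrightarrow> (\<And>v. \<theta> v \<noteq> 0 \<Longrightarrow> v \<in> {p..q}) \<Longrightarrow>
        integral {p..q} (\<lambda>v. \<theta> v * w v) = 0"
    and v: "v > 0"
  shows "w v = 0"
proof -
  have cw: "continuous_on {a..b} w" if "0 < a" for a b
    using w by (rule continuous_on_subset) (use that in auto)
  have int0: "integral {a..b} w = 0" if ab: "0 < a" "a < b" for a b
  proof -
    \<comment> \<open>The bumps live in \<open>{a..b + 1}\<close>; cutting \<open>w\<close> off
      there makes it Borel and integrable on the whole line, although \<open>w\<close> is only
      controlled on the half-line.\<close>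
    let ?w = "\<lambda>x. indicator {a..b + 1} x *\<^sub>R w x"
    have wm: "?w \<in> borel_measurable borel"
      by (rule borel_measurable_continuous_on_indicator) (use cw[OF ab(1)] in auto)
    have wi: "integrable lborel ?w"
      using borel_integrable_atLeastAtMost'[OF cw[OF ab(1)]] unfolding set_integrable_def .
    have "(LINT x|lborel. ?w x * bump a b n x) = 0" for n
    proof -
      have C: "continuous_on {a..b + 1} (bump a b n)"
        using test_fun_bump[OF ab(2)] C_order_continuous unfolding test_fun_def
        by (meson continuous_on_subset subset_UNIV)
      have "(LINT x|lborel. ?w x * bump a b n x) = (LINT x|lborel. indicator {a..b + 1} x *\<^sub>R (bump a b n x * w x))"
        by (simp add: mult_ac)
      also have "\<dots> = integral {a..b + 1} (\<lambda>v. bump a b n v * w v)"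
        by (intro lborel_integral_indicator_continuous continuous_on_mult C cw ab)
      also have "\<dots> = 0"
        by (rule zero) (use test_fun_bump[OF ab(2)] ab bump_support'[OF ab(2)] in auto)
      finally show ?thesis .
    qed
    moreover have "(\<lambda>n. LINT x|lborel. ?w x * bump a b n x) \<longlonglongrightarrow> (LINT x:{a..b}|lborel. ?w x)"
      by (rule bump_integral_tendsto[OF wm _ ab(2)]) (unfold set_integrable_def, rule integrable_mult_indicator[OF _ wi], simp)
    ultimately have "(LINT x:{a..b}|lborel. ?w x) = 0" by (simp add: LIMSEQ_const_iff)
    moreover have "(LINT x:{a..b}|lborel. ?w x) = (LINT v|lborel. indicator {a..b} v *\<^sub>R w v)"
      unfolding set_lebesgue_integral_def
      by (intro Bochner_Integration.integral_cong) (auto simp: indicator_def)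
    ultimately show ?thesis using lborel_integral_indicator_continuous[OF cw[OF ab(1), of b]] by simp
  qed
  have "((\<lambda>x. integral {v / 2..x} w) has_real_derivative w v) (at v within {v / 2..v + 1})"
    by (rule integral_has_real_derivative) (use cw v in auto)
  moreover have "((\<lambda>x. integral {v / 2..x} w) has_real_derivative 0) (at v within {v / 2..v + 1})"
  proof (rule has_field_derivative_transform_within[of "\<lambda>_. 0" _ _ _ 1])
    show "0 = integral {v / 2..x} w" if "x \<in> {v / 2..v + 1}" for x
      using int0[of "v / 2" x] that v by (cases "x = v / 2") auto
  qed (use v in auto)
  moreover have "at v within {v / 2..v + 1} = at v"
    using v by (intro at_within_Icc_at) auto
  ultimately show ?thesis using DERIV_unique by force
qed

text \<open>The data on v > 0 that the characteristic argument uses; each half plane of velocities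
  becomes an instance. \<open>g\<close> is a primitive of \<open>h\<close> and nothing more. Since
  \<open>\<theta>\<close> lives in a compact interval away from v = 0, the inner integrals can be
  differentiated under the integral sign.\<close>

locale half_state =
  fixes u ux uv :: "real \<times> real \<Rightarrow> real" and g h :: "real \<Rightarrow> real"
  assumes u_deriv: "\<And>x v. v > 0 \<Longrightarrow> (u has_derivative (\<lambda>k. ux (x, v) * fst k + uv (x, v) * snd k)) (at (x, v))"
    and ux_cont: "\<And>x v. v > 0 \<Longrightarrow> isCont ux (x, v)"
    and uv_cont: "\<And>x v. v > 0 \<Longrightarrow> isCont uv (x, v)"
    and u_slice: "\<And>x. (\<lambda>v. u (x, v)) real_analytic_on {0<..}"
    and h_meas: "h \<in> borel_measurable borel"
    and h_bounded: "\<And>a b. \<exists>B. AE x in lborel. x \<in> {a..b} \<longrightarrow> \<bar>h x\<bar> \<le> B"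
    and g_h: "\<And>a b. a < b \<Longrightarrow> g b - g a = (LINT x:{a..b}|lborel. h x)"
    and weak: "\<And>\<phi> \<theta> p q. test_fun \<phi> \<Longrightarrow> test_fun \<theta> \<Longrightarrow> 0 < p \<Longrightarrow> p < q \<Longrightarrow> (\<And>v. \<theta> v \<noteq> 0 \<Longrightarrow> v \<in> {p..q}) \<Longrightarrow>
        (LINT x|lborel. integral {p..q} (\<lambda>v. v * \<theta> v * u (x, v)) * deriv \<phi> x) =
        (LINT x|lborel. h x * integral {p..q} (\<lambda>v. deriv \<theta> v * u (x, v)) * \<phi> x)"
begin

lemma h_bound: obtains B where "B \<ge> 0" "AE x in lborel. x \<in> {a..b} \<longrightarrow> \<bar>h x\<bar> \<le> B"
proof -
  obtain B where B: "AE x in lborel. x \<in> {a..b} \<longrightarrow> \<bar>h x\<bar> \<le> B" using h_bounded by blast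
  have "AE x in lborel. x \<in> {a..b} \<longrightarrow> \<bar>h x\<bar> \<le> max 0 B"
    using B by eventually_elim auto
  then show ?thesis using that[of "max 0 B"] by simp
qed

lemma g_lipschitz:
  obtains B where "B \<ge> 0" "\<And>x y. x \<in> {a..b} \<Longrightarrow> y \<in> {a..b} \<Longrightarrow> \<bar>g x - g y\<bar> \<le> B * \<bar>x - y\<bar>"
proof -
  obtain B where B: "B \<ge> 0" "AE x in lborel. x \<in> {a..b} \<longrightarrow> \<bar>h x\<bar> \<le> B" by (rule h_bound)
  have *: "\<bar>g y - g x\<bar> \<le> B * (y - x)" if "x < y" "x \<in> {a..b}" "y \<in> {a..b}" for x y
    unfolding g_h[OF that(1)]
    by (rule AE_bounded_set_integral(2)[OF h_meas]) (use that B(2) in \<open>auto elim: eventually_mono\<close>)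
  have "\<bar>g x - g y\<bar> \<le> B * \<bar>x - y\<bar>" if "x \<in> {a..b}" "y \<in> {a..b}" for x y
    using *[of x y] *[of y x] that by (cases x y rule: linorder_cases) (auto simp: abs_minus_commute)
  then show ?thesis using that B(1) by blast
qed

lemma g_continuous: "continuous_on UNIV g"
proof (simp add: continuous_on_eq_continuous_at, rule allI)
  fix x
  obtain B where B: "B \<ge> 0" "\<And>y z. y \<in> {x - 1..x + 1} \<Longrightarrow> z \<in> {x - 1..x + 1} \<Longrightarrow> \<bar>g y - g z\<bar> \<le> B * \<bar>y - z\<bar>"
    using g_lipschitz by blast
  have "((\<lambda>y. B * \<bar>y - x\<bar>) \<longlongrightarrow> B * \<bar>x - x\<bar>) (at x)" by (intro tendsto_intros)
  moreover have "eventually (\<lambda>y. norm (g y - g x) \<le> B * \<bar>y - x\<bar>) (at x)"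
    unfolding eventually_at by (rule exI[of _ 1]) (use B(2) in \<open>auto simp: dist_real_def abs_less_iff\<close>)
  ultimately have "((\<lambda>y. g y - g x) \<longlongrightarrow> 0) (at x)"
    by (intro Lim_null_comparison[of "\<lambda>y. g y - g x" "\<lambda>y. B * \<bar>y - x\<bar>"]) auto
  then show "isCont g x" unfolding isCont_def by (simp add: LIM_zero_cancel)
qed

lemma u_cont: "v > 0 \<Longrightarrow> isCont u (x, v)"
  using u_deriv has_derivative_continuous by blast

lemma u_deriv_x: "v > 0 \<Longrightarrow> ((\<lambda>x. u (x, v)) has_real_derivative ux (x, v)) (at x)"
proof -
  assume v: "v > 0"
  have "((\<lambda>x. (x, v)) has_derivative (\<lambda>k. (k, 0))) (at x)" by (auto intro!: derivative_eq_intros)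
  from has_derivative_compose[OF this u_deriv[OF v]] show ?thesis by (simp add: has_field_derivative_def)
qed

lemma u_deriv_v: "v > 0 \<Longrightarrow> ((\<lambda>v. u (x, v)) has_real_derivative uv (x, v)) (at v)"
proof -
  assume v: "v > 0"
  have "((\<lambda>v. (x, v)) has_derivative (\<lambda>k. (0, k))) (at v)" by (auto intro!: derivative_eq_intros)
  from has_derivative_compose[OF this u_deriv[OF v]] show ?thesis by (simp add: has_field_derivative_def)
qed

lemma slice_cont:
  fixes k :: "real \<times> real \<Rightarrow> real"
  assumes "\<And>v. v > 0 \<Longrightarrow> isCont k (x, v)" shows "continuous_on {0<..} (\<lambda>v. k (x, v))"
proof (intro continuous_at_imp_continuous_on ballI)
  fix v :: real assume "v \<in> {0<..}"
  then have "isCont k (x, v)" using assms by simp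
  moreover have "isCont (\<lambda>v. (x, v)) v" by (intro continuous_intros)
  ultimately show "isCont (\<lambda>v. k (x, v)) v" using isCont_o2[of v "\<lambda>v. (x, v)" k] by blast
qed

lemma param_integral_deriv:
  assumes w: "continuous_on {p..q} w" and p: "0 < p"
  shows "((\<lambda>x. integral {p..q} (\<lambda>v. w v * u (x, v))) has_real_derivative
      integral {p..q} (\<lambda>v. w v * ux (x, v))) (at x)"
proof -
  have cu: "continuous_on (UNIV \<times> {p..q}) u" "continuous_on (UNIV \<times> {p..q}) ux"
    by (intro continuous_at_imp_continuous_on ballI; use p u_cont ux_cont in fastforce)+
  have "((\<lambda>x. integral (cbox p q) (\<lambda>v. w v * u (x, v))) has_field_derivative
      integral (cbox p q) (\<lambda>v. w v * ux (x, v))) (at x within UNIV)"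
  proof (rule leibniz_rule_field_derivative)
    show "((\<lambda>x. w v * u (x, v)) has_field_derivative w v * ux (x, v)) (at x within UNIV)" if "v \<in> cbox p q" for x v
      using that p u_deriv_x[of v x] by (auto intro!: derivative_eq_intros)
    show "(\<lambda>v. w v * u (x, v)) integrable_on cbox p q" for x
      by (intro integrable_continuous continuous_on_mult)
         (use w slice_cont[where k = u and x = x, OF u_cont] p in \<open>auto elim: continuous_on_subset\<close>)
    show "continuous_on (UNIV \<times> cbox p q) (\<lambda>(x, v). w v * ux (x, v))"
      unfolding case_prod_unfold prod.collapse
      by (intro continuous_on_mult continuous_on_compose2[OF w] continuous_on_snd continuous_on_id) (use cu in auto)
  qed auto
  then show ?thesis by simp
qed

text \<open>Let \<open>K\<close> and \<open>L\<close> be the integrals of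
  \<open>v \<theta> u\<close> and \<open>\<theta>' u\<close> over v. By du Bois-Reymond the
  increments of \<open>K\<close> are those of a primitive of \<open>- h L\<close>, so
  \<open>K + L x0 * g\<close> has increments the integral of \<open>h * (L x0 - L)\<close> and
  derivative zero at \<open>x0\<close>. Now \<open>K\<close> is differentiable with derivative the
  first coefficient, and integration by parts turns \<open>L x0\<close> into minus the second one.
  The statement avoids dividing by that coefficient, which may vanish.\<close>

lemma weak_linearization:
  assumes \<theta>: "test_fun \<theta>" and pq: "0 < p" "p < q" and supp: "\<And>v. \<theta> v \<noteq> 0 \<Longrightarrow> v \<in> {p..q}"
  shows "((\<lambda>x. integral {p..q} (\<lambda>v. \<theta> v * (v * ux (x0, v))) * x - integral {p..q} (\<lambda>v. \<theta> v * uv (x0, v)) * g x)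
     has_real_derivative 0) (at x0)"
proof -
  define K where "K x = integral {p..q} (\<lambda>v. v * \<theta> v * u (x, v))" for x
  define L where "L x = integral {p..q} (\<lambda>v. deriv \<theta> v * u (x, v))" for x
  define \<alpha> where "\<alpha> = integral {p..q} (\<lambda>v. \<theta> v * (v * ux (x0, v)))"
  define \<beta> where "\<beta> = integral {p..q} (\<lambda>v. \<theta> v * uv (x0, v))"
  have C: "C_order k \<theta>" for k using \<theta> by (simp add: test_fun_def)
  have c\<theta>: "continuous_on A \<theta>" for A using C_order_continuous[OF C] continuous_on_subset by blast
  have c\<theta>': "continuous_on A (deriv \<theta>)" for A
    using C_order_continuous[OF C_order_real_deriv(2)[OF C, of 0]] continuous_on_subset by blast
  have Kd: "(K has_real_derivative integral {p..q} (\<lambda>v. v * \<theta> v * ux (x, v))) (at x)" for x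
    unfolding K_def by (rule param_integral_deriv) (use pq c\<theta> in \<open>auto intro!: continuous_intros\<close>)
  have Ld: "(L has_real_derivative integral {p..q} (\<lambda>v. deriv \<theta> v * ux (x, v))) (at x)" for x
    unfolding L_def by (rule param_integral_deriv) (use pq c\<theta>' in auto)
  have Kc: "continuous_on UNIV K" and Lc: "continuous_on UNIV L"
    using DERIV_isCont[OF Kd] DERIV_isCont[OF Ld] by (simp_all add: continuous_on_eq_continuous_at)
  have Lm: "L \<in> borel_measurable borel" by (rule borel_measurable_continuous_onI[OF Lc])
  have hLm: "(\<lambda>x. h x * (c - L x)) \<in> borel_measurable borel" for c using h_meas Lm by measurable
  have bdd: "\<exists>M. \<forall>x\<in>{a..b}. \<bar>c - L x\<bar> \<le> M" for a b c
  proof -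
    have "bounded ((\<lambda>x. c - L x) ` {a..b})"
      by (intro compact_imp_bounded compact_continuous_image continuous_intros continuous_on_subset[OF Lc]) auto
    then show ?thesis unfolding bounded_iff by auto
  qed
  have hLi: "set_integrable lborel {a..b} (\<lambda>x. h x * (c - L x))" for a b c
  proof (cases "a \<le> b")
    case True
    obtain B where B: "B \<ge> 0" "AE x in lborel. x \<in> {a..b} \<longrightarrow> \<bar>h x\<bar> \<le> B" by (rule h_bound)
    obtain M where M: "\<forall>x\<in>{a..b}. \<bar>c - L x\<bar> \<le> M" using bdd by blast
    show ?thesis
    proof (rule AE_bounded_set_integral(1)[OF hLm True])
      show "AE x in lborel. x \<in> {a..b} \<longrightarrow> \<bar>h x * (c - L x)\<bar> \<le> B * M"
        using B(2) by eventually_elim (use M B(1) in \<open>auto simp: abs_mult intro!: mult_mono\<close>)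
    qed
  qed (simp add: set_integrable_def)
  have dbr: "K b - K a = (LINT x:{a..b}|lborel. h x * (0 - L x))" if "a < b" for a b
  proof (rule du_bois_reymond[OF Kc hLm hLi _ that])
    fix \<phi> :: "real \<Rightarrow> real" assume "test_fun \<phi>"
    from weak[OF this \<theta> pq supp]
    have "(LINT x|lborel. K x * deriv \<phi> x) = (LINT x|lborel. h x * L x * \<phi> x)"
      unfolding K_def L_def by blast
    then show "(LINT x|lborel. K x * deriv \<phi> x) = - (LINT x|lborel. h x * (0 - L x) * \<phi> x)" by simp
  qed
  define R where "R x = K x + L x0 * g x" for x
  have R: "R b - R a = (LINT x:{a..b}|lborel. h x * (L x0 - L x))" if "a < b" for a b
  proof -
    have hi: "set_integrable lborel {a..b} h"
      by (meson AE_bounded_set_integral(1) h_bounded h_meas less_imp_le that)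
    have "R b - R a = (LINT x:{a..b}|lborel. h x * (0 - L x)) + L x0 * (LINT x:{a..b}|lborel. h x)"
      unfolding R_def dbr[OF that, symmetric] g_h[OF that, symmetric] by (simp add: algebra_simps)
    also have "\<dots> = (LINT x:{a..b}|lborel. h x * (0 - L x) + L x0 * h x)"
      using hLi[of a b 0] hi by (subst set_integral_add(2)) (auto intro!: set_integrable_mult_right)
    also have "\<dots> = (LINT x:{a..b}|lborel. h x * (L x0 - L x))"
      by (simp add: algebra_simps)
    finally show ?thesis .
  qed
  have Rd: "(R has_real_derivative 0) (at x0)"
    by (rule integral_increment_deriv_zero[OF h_meas h_bounded Lm _ zero_less_one R])
       (use Lc in \<open>simp add: continuous_on_eq_continuous_at\<close>)
  have L\<beta>: "L x0 = - \<beta>"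
  proof -
    have cu: "continuous_on {p..q} (\<lambda>v. u (x0, v))" "continuous_on {p..q} (\<lambda>v. uv (x0, v))"
      by (rule continuous_on_subset[OF slice_cont[OF u_cont]] continuous_on_subset[OF slice_cont[OF uv_cont]]; use pq in auto)+
    \<comment> \<open>The support condition allows nonzero end values; continuity from outside the
      interval excludes them, so integration by parts leaves no boundary terms.\<close>
    have "\<theta> p = 0" "\<theta> q = 0"
    proof -
      have "eventually (\<lambda>x. \<theta> x = 0) (at_left p)" "eventually (\<lambda>x. \<theta> x = 0) (at_right q)"
        unfolding eventually_at_filter by (intro always_eventually; use supp in force)+
      moreover have "(\<theta> \<longlongrightarrow> \<theta> p) (at_left p)" "(\<theta> \<longlongrightarrow> \<theta> q) (at_right q)"
        using c\<theta>[of UNIV] by (auto simp: continuous_on_eq_continuous_at isCont_def filterlim_at_split)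
      ultimately show "\<theta> p = 0" "\<theta> q = 0"
        using tendsto_eventually[of \<theta> 0] tendsto_unique[of "at_left p" \<theta>] tendsto_unique[of "at_right q" \<theta>] by force+
    qed
    have "((\<lambda>v. deriv \<theta> v * u (x0, v) + \<theta> v * uv (x0, v)) has_integral \<theta> q * u (x0, q) - \<theta> p * u (x0, p)) {p..q}"
    proof (rule fundamental_theorem_of_calculus)
      fix v assume "v \<in> {p..q}"
      then have "v > 0" using pq by simp
      then have "((\<lambda>v. \<theta> v * u (x0, v)) has_real_derivative deriv \<theta> v * u (x0, v) + \<theta> v * uv (x0, v)) (at v)"
        using u_deriv_v C_order_real_deriv(1)[OF C] by (auto intro!: derivative_eq_intros)
      then show "((\<lambda>v. \<theta> v * u (x0, v)) has_vector_derivative deriv \<theta> v * u (x0, v) + \<theta> v * uv (x0, v)) (at v within {p..q})"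
        by (simp add: has_real_derivative_iff_has_vector_derivative has_vector_derivative_at_within)
    qed (use pq in simp)
    then have "integral {p..q} (\<lambda>v. deriv \<theta> v * u (x0, v) + \<theta> v * uv (x0, v)) = 0"
      using \<open>\<theta> p = 0\<close> \<open>\<theta> q = 0\<close> by (simp add: integral_unique)
    moreover have "integral {p..q} (\<lambda>v. deriv \<theta> v * u (x0, v) + \<theta> v * uv (x0, v)) = L x0 + \<beta>"
      unfolding L_def \<beta>_def
      by (rule Henstock_Kurzweil_Integration.integral_add) (intro integrable_continuous_interval continuous_on_mult c\<theta> c\<theta>' cu)+
    ultimately show ?thesis by simp
  qed
  have "((\<lambda>x. R x - (K x - \<alpha> * x)) has_real_derivative 0 - (\<alpha> - \<alpha>)) (at x0)"
    using Rd Kd[of x0] unfolding \<alpha>_def by (auto intro!: derivative_eq_intros simp: mult_ac)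
  moreover have "(\<lambda>x. R x - (K x - \<alpha> * x)) = (\<lambda>x. \<alpha> * x - \<beta> * g x)"
    by (rule ext) (simp add: R_def L\<beta>)
  ultimately have "((\<lambda>x. \<alpha> * x - \<beta> * g x) has_real_derivative 0) (at x0)"
    by (simp only: diff_self)
  then show ?thesis by (simp only: \<alpha>_def \<beta>_def)
qed

text \<open>If some test function pairs nontrivially with \<open>uv (x0, \<cdot>)\<close>, dividing
  in the linearised relation shows that \<open>g\<close> is differentiable at \<open>x0\<close> with
  slope \<open>d\<close>, and the relations for all other test functions then use the same
  \<open>d\<close>. If none does, \<open>uv\<close> and hence \<open>ux\<close> vanish over
  \<open>x0\<close>; any \<open>d\<close> works, and \<open>g\<close> need not be differentiable
  there.\<close>

lemma characteristic_dichotomy: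
  "\<exists>d. (\<forall>v>0. v * ux (x0, v) = d * uv (x0, v)) \<and>
     ((g has_real_derivative d) (at x0) \<or> (\<forall>v>0. uv (x0, v) = 0))"
proof -
  note wl = weak_linearization[of _ _ _ x0]
  have cx: "continuous_on {0<..} (\<lambda>v. ux (x0, v))" and cv: "continuous_on {0<..} (\<lambda>v. uv (x0, v))"
    using slice_cont ux_cont uv_cont by auto
  show ?thesis
  proof (cases "\<forall>\<theta> p q. test_fun \<theta> \<longrightarrow> 0 < p \<longrightarrow> p < q \<longrightarrow> (\<forall>v. \<theta> v \<noteq> 0 \<longrightarrow> v \<in> {p..q}) \<longrightarrow>
      integral {p..q} (\<lambda>v. \<theta> v * uv (x0, v)) = 0")
    case True
    have uv0: "uv (x0, v) = 0" if "v > 0" for v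
      by (rule fundamental_lemma_halfline[OF cv _ that]) (use True in blast)
    have "v * ux (x0, v) = 0" if "v > 0" for v
    proof (rule fundamental_lemma_halfline[OF _ _ that])
      show "continuous_on {0<..} (\<lambda>v. v * ux (x0, v))" by (intro continuous_intros cx)
      fix \<theta> p q assume a: "test_fun \<theta>" "0 < p" "p < q" "\<And>v. \<theta> v \<noteq> 0 \<Longrightarrow> v \<in> {p..q::real}"
      have "integral {p..q} (\<lambda>v. \<theta> v * uv (x0, v)) = 0" using True a by blast
      then have "((\<lambda>x. integral {p..q} (\<lambda>v. \<theta> v * (v * ux (x0, v))) * x) has_real_derivative 0) (at x0)"
        using wl[OF a] by simp
      moreover have "((\<lambda>x. integral {p..q} (\<lambda>v. \<theta> v * (v * ux (x0, v))) * x) has_real_derivative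
          integral {p..q} (\<lambda>v. \<theta> v * (v * ux (x0, v)))) (at x0)"
        by (auto intro!: derivative_eq_intros)
      ultimately show "integral {p..q} (\<lambda>v. \<theta> v * (v * ux (x0, v))) = 0" using DERIV_unique by blast
    qed
    then show ?thesis using uv0 by (intro exI[of _ 0]) auto
  next
    case False
    then obtain \<theta>0 p0 q0 where a0: "test_fun \<theta>0" "0 < p0" "p0 < q0" "\<And>v. \<theta>0 v \<noteq> 0 \<Longrightarrow> v \<in> {p0..q0}"
      and \<beta>: "integral {p0..q0} (\<lambda>v. \<theta>0 v * uv (x0, v)) \<noteq> 0" (is "?\<beta> \<noteq> 0") by blast
    let ?\<alpha> = "integral {p0..q0} (\<lambda>v. \<theta>0 v * (v * ux (x0, v)))"
    define d where "d = ?\<alpha> / ?\<beta>"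
    have "((\<lambda>x. (?\<alpha> * x - (?\<alpha> * x - ?\<beta> * g x)) / ?\<beta>) has_real_derivative (?\<alpha> - 0) / ?\<beta>) (at x0)"
      by (rule DERIV_cdivide[OF DERIV_diff[OF DERIV_cmult_Id wl[OF a0]]])
    moreover have "(\<lambda>x. (?\<alpha> * x - (?\<alpha> * x - ?\<beta> * g x)) / ?\<beta>) = g" using \<beta> by auto
    ultimately have gd: "(g has_real_derivative d) (at x0)" by (simp add: d_def)
    have "v * ux (x0, v) - d * uv (x0, v) = 0" if "v > 0" for v
    proof (rule fundamental_lemma_halfline[OF _ _ that])
      show "continuous_on {0<..} (\<lambda>v. v * ux (x0, v) - d * uv (x0, v))" by (intro continuous_intros cx cv)
      fix \<theta> p q assume a: "test_fun \<theta>" "0 < p" "p < q" "\<And>v. \<theta> v \<noteq> 0 \<Longrightarrow> v \<in> {p..q::real}"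
      let ?a = "integral {p..q} (\<lambda>v. \<theta> v * (v * ux (x0, v)))"
      let ?b = "integral {p..q} (\<lambda>v. \<theta> v * uv (x0, v))"
      have c\<theta>: "continuous_on {p..q} \<theta>"
        using a(1) C_order_continuous continuous_on_subset unfolding test_fun_def by blast
      have c: "continuous_on {p..q} (\<lambda>v. ux (x0, v))" "continuous_on {p..q} (\<lambda>v. uv (x0, v))"
        using cx cv a(2) by (auto elim!: continuous_on_subset)
      have "((\<lambda>x. ?a * x - ?b * g x) has_real_derivative ?a - ?b * d) (at x0)"
        using gd by (auto intro!: derivative_eq_intros)
      then have "?a - ?b * d = 0" using wl[OF a] DERIV_unique by blast
      moreover have "integral {p..q} (\<lambda>v. \<theta> v * (v * ux (x0, v) - d * uv (x0, v))) = ?a - ?b * d"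
      proof -
        have "(\<lambda>v. \<theta> v * (v * ux (x0, v) - d * uv (x0, v))) = (\<lambda>v. \<theta> v * (v * ux (x0, v)) - \<theta> v * uv (x0, v) * d)"
          by (auto simp: algebra_simps)
        then show ?thesis
          by (simp only:, subst Henstock_Kurzweil_Integration.integral_diff)
             (auto intro!: integrable_continuous_interval continuous_intros c\<theta> c)
      qed
      ultimately show "integral {p..q} (\<lambda>v. \<theta> v * (v * ux (x0, v) - d * uv (x0, v))) = 0" by simp
    qed
    then show ?thesis using gd by auto
  qed
qed

definition level :: "real \<Rightarrow> real \<Rightarrow> real" where
  "level E x = u (x, sqrt (2 * (E - g x)))"

text \<open>Where \<open>g\<close> is differentiable this is the chain rule along a characteristic.
  In the other case the whole gradient of \<open>u\<close> vanishes at the point in question, and it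
  is enough that the curve of constant energy is Lipschitz, which follows from the Lipschitz bound
  for \<open>g\<close>.\<close>

lemma level_deriv_zero:
  assumes E: "g x0 < E" shows "(level E has_real_derivative 0) (at x0)"
proof -
  define w where "w x = sqrt (2 * (E - g x))" for x
  define w0 where "w0 = w x0"
  have w0: "w0 > 0" using E by (simp add: w0_def w_def)
  obtain d where d: "\<And>v. v > 0 \<Longrightarrow> v * ux (x0, v) = d * uv (x0, v)"
    and alt: "(g has_real_derivative d) (at x0) \<or> (\<forall>v>0. uv (x0, v) = 0)"
    using characteristic_dichotomy by blast
  have ud: "(u has_derivative (\<lambda>k. ux (x0, w0) * fst k + uv (x0, w0) * snd k)) (at (x0, w x0))"
    using u_deriv[OF w0] by (simp add: w0_def)
  have lev: "level E = (\<lambda>x. u (x, w x))" by (auto simp: level_def w_def)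
  from alt show ?thesis
  proof
    assume gd: "(g has_real_derivative d) (at x0)"
    have "(w has_real_derivative - d / w0) (at x0)"
      unfolding w_def[abs_def] w0_def using gd E by (auto intro!: derivative_eq_intros simp: field_simps)
    then have "((\<lambda>x. (x, w x)) has_derivative (\<lambda>k. (k, (- d / w0) * k))) (at x0)"
      by (intro has_derivative_Pair has_derivative_ident) (simp only: has_field_derivative_def)
    from has_derivative_compose[OF this ud]
    have "((\<lambda>x. u (x, w x)) has_real_derivative ux (x0, w0) + uv (x0, w0) * (- d / w0)) (at x0)"
      unfolding has_field_derivative_def
      by (rule has_derivative_eq_rhs) (auto simp: fun_eq_iff algebra_simps)
    moreover have "ux (x0, w0) + uv (x0, w0) * (- d / w0) = 0"
      using d[OF w0] w0 by (simp add: field_simps)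
    ultimately show ?thesis by (simp add: lev)
  next
    assume z: "\<forall>v>0. uv (x0, v) = 0"
    have "ux (x0, w0) = 0" using d[OF w0] z w0 by simp
    then have ud0: "(u has_derivative (\<lambda>k. 0)) (at (x0, w0))" using ud z w0 by (simp add: w0_def)
    obtain B where B: "B \<ge> 0" "\<And>y z. y \<in> {x0 - 1..x0 + 1} \<Longrightarrow> z \<in> {x0 - 1..x0 + 1} \<Longrightarrow> \<bar>g y - g z\<bar> \<le> B * \<bar>y - z\<bar>"
      using g_lipschitz[of "x0 - 1" "x0 + 1"] by blast
    have gc: "isCont g x0" using g_continuous by (simp add: continuous_on_eq_continuous_at)
    obtain d1 where d1: "d1 > 0" "\<And>x. \<bar>x - x0\<bar> < d1 \<Longrightarrow> g x < E"
    proof -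
      obtain d1 where "d1 > 0" "\<And>x. dist x x0 < d1 \<Longrightarrow> dist (g x) (g x0) < E - g x0"
        using gc E unfolding continuous_at_eps_delta by (metis diff_gt_0_iff_gt)
      then show ?thesis using that[of d1] by (force simp: dist_real_def)
    qed
    \<comment> \<open>The summand 1 bounds the first component of the curve. The other comes from
      \<open>(w x - w0) * (w x + w0) = 2 * (g x0 - g x)\<close>, with
      \<open>w x + w0 \<ge> w0\<close> and the Lipschitz constant \<open>B\<close>.\<close>
    define C where "C = 1 + 2 * B / w0"
    have C: "C > 0" using B(1) w0 by (simp add: C_def add_pos_nonneg)
    have wl: "norm ((x, w x) - (x0, w0)) \<le> C * \<bar>x - x0\<bar>" if x: "\<bar>x - x0\<bar> < min d1 1" for x
    proof -
      have gx: "g x < E" using d1(2) x by simp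
      have "(w x)\<^sup>2 = 2 * (E - g x)" "w0\<^sup>2 = 2 * (E - g x0)" using gx E by (auto simp: w_def w0_def)
      then have "(w x - w0) * (w x + w0) = 2 * (g x0 - g x)" by (simp add: power2_eq_square algebra_simps)
      then have "\<bar>w x - w0\<bar> * \<bar>w x + w0\<bar> = 2 * \<bar>g x0 - g x\<bar>" by (metis abs_mult abs_numeral)
      moreover have "w x \<ge> 0" using gx by (simp add: w_def)
      then have "\<bar>w x - w0\<bar> * w0 \<le> \<bar>w x - w0\<bar> * \<bar>w x + w0\<bar>" using w0 by (intro mult_left_mono) auto
      moreover have "\<bar>g x0 - g x\<bar> \<le> B * \<bar>x - x0\<bar>"
        using B(2)[of x0 x] x by (simp add: abs_less_iff abs_minus_commute)
      ultimately have "\<bar>w x - w0\<bar> * w0 \<le> 2 * (B * \<bar>x - x0\<bar>)" by linarith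
      then have "\<bar>w x - w0\<bar> \<le> 2 * B / w0 * \<bar>x - x0\<bar>" using w0 by (simp add: field_simps)
      moreover have "norm ((x, w x) - (x0, w0)) \<le> \<bar>x - x0\<bar> + \<bar>w x - w0\<bar>"
        using norm_Pair_le[of "x - x0" "w x - w0"] by simp
      ultimately show ?thesis by (simp add: C_def distrib_right)
    qed
    show ?thesis
    proof (rule DERIV_zeroI)
      fix e :: real assume e: "e > 0"
      then have "e / C > 0" using C by simp
      then obtain d2 where d2: "d2 > 0" "\<And>y. norm (y - (x0, w0)) < d2 \<Longrightarrow> norm (u y - u (x0, w0)) \<le> e / C * norm (y - (x0, w0))"
        using ud0 unfolding has_derivative_at_alt by fastforce
      define \<delta> where "\<delta> = min (min d1 1) (d2 / C)"
      have "\<bar>level E y - level E x0\<bar> \<le> e * \<bar>y - x0\<bar>" if y: "\<bar>y - x0\<bar> < \<delta>" for y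
      proof -
        have n: "norm ((y, w y) - (x0, w0)) \<le> C * \<bar>y - x0\<bar>" using wl y by (simp add: \<delta>_def)
        also have "\<dots> < d2" using y C by (simp add: \<delta>_def field_simps)
        finally have "norm (u (y, w y) - u (x0, w0)) \<le> e / C * norm ((y, w y) - (x0, w0))" by (rule d2(2))
        also have "\<dots> \<le> e / C * (C * \<bar>y - x0\<bar>)" using n e C by (intro mult_left_mono) auto
        also have "\<dots> = e * \<bar>y - x0\<bar>" using C by simp
        finally show ?thesis by (simp add: lev w0_def)
      qed
      moreover have "\<delta> > 0" using d1 d2 C by (simp add: \<delta>_def)
      ultimately show "\<exists>d>0. \<forall>y. \<bar>y - x0\<bar> < d \<longrightarrow> \<bar>level E y - level E x0\<bar> \<le> e * \<bar>y - x0\<bar>" by blast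
    qed
  qed
qed

lemma level_analytic: "(\<lambda>E. level E x) real_analytic_on {g x<..}"
  unfolding level_def
proof (rule real_analytic_on_compose[OF u_slice])
  have "(\<lambda>E. 2 * (E - g x)) real_analytic_on {g x<..}"
    by (intro real_analytic_on_mult real_analytic_on_const real_analytic_on_diff real_analytic_on_ident)
  then show "(\<lambda>E. sqrt (2 * (E - g x))) real_analytic_on {g x<..}"
    by (rule real_analytic_on_compose[OF real_analytic_on_sqrt]) auto
qed auto

text \<open>The points may lie in different components of {g < E}, so constancy along x does not
  apply at energy \<open>E\<close>. For energies above the maximum of |g| between them it does, and
  both sides are analytic in the energy down to the larger of \<open>g x\<close> and
  \<open>g y\<close>.\<close>

lemma level_unique:
  assumes "g x < E" "g y < E" shows "level E x = level E y"
proof -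
  have *: "level E x = level E y" if xy: "x \<le> y" and E: "g x < E" "g y < E" for x y
  proof -
    let ?m = "max (g x) (g y)"
    have "compact (g ` {x..y})"
      by (intro compact_continuous_image continuous_on_subset[OF g_continuous]) auto
    then have "bounded (g ` {x..y})" by (rule compact_imp_bounded)
    then obtain M where M: "\<And>z. z \<in> {x..y} \<Longrightarrow> \<bar>g z\<bar> \<le> M"
      unfolding bounded_iff by (metis image_eqI real_norm_def)
    have eq: "level e x - level e y = 0" if e: "e > M" for e
    proof -
      have "\<exists>c. \<forall>z\<in>{x..y}. level e z = c"
      proof (rule has_field_derivative_zero_constant)
        fix z assume "z \<in> {x..y}"
        then have "g z < e" using M e by force
        then show "(level e has_field_derivative 0) (at z within {x..y})"
          using level_deriv_zero has_field_derivative_at_within by blast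
      qed auto
      then show ?thesis using xy by auto
    qed
    have "level E x - level E y = 0"
    proof (rule real_analytic_identity_on_open[of "\<lambda>E. level E x - level E y" "{?m<..}" "{M<..}" "max M ?m + 1"])
      show "(\<lambda>E. level E x - level E y) real_analytic_on {?m<..}"
        by (rule real_analytic_on_diff) (rule real_analytic_on_subset[OF level_analytic]; auto)+
    qed (use eq E in \<open>auto intro: convex_connected\<close>)
    then show ?thesis by simp
  qed
  show ?thesis using *[of x y] *[of y x] assms by linarith
qed

theorem energy_profile_exists:
  obtains F where "F real_analytic_on {z. \<exists>x. g x < z}"
    "\<And>x v. v > 0 \<Longrightarrow> u (x, v) = F (v\<^sup>2 / 2 + g x)"
proof
  define F where "F E = level E (SOME x. g x < E)" for E
  have F: "F E = level E x" if "g x < E" for x E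
    unfolding F_def by (rule level_unique) (use that in \<open>auto intro: someI\<close>)
  show "F real_analytic_on {z. \<exists>x. g x < z}"
  proof (rule real_analytic_on_singletonI)
    fix E assume "E \<in> {z. \<exists>x. g x < z}"
    then obtain x where x: "g x < E" by auto
    show "F real_analytic_on {E}"
    proof (rule real_analytic_on_cong_nhds)
      show "(\<lambda>E. level E x) real_analytic_on {E}"
        using real_analytic_on_subset[OF level_analytic] x by auto
      show "eventually (\<lambda>E. level E x = F E) (nhds E)"
        unfolding eventually_nhds by (rule exI[of _ "{g x<..}"]) (use x F in auto)
    qed
  qed
  fix x v :: real assume v: "v > 0"
  then have "g x < v\<^sup>2 / 2 + g x" by simp
  then have "F (v\<^sup>2 / 2 + g x) = level (v\<^sup>2 / 2 + g x) x" by (rule F)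
  then show "u (x, v) = F (v\<^sup>2 / 2 + g x)" using v by (simp add: level_def)
qed

end

section \<open>The weak equation in product form\<close>

lemma AE_lborel_fst:
  assumes "AE x in lborel. P (x::real)"
  shows "AE p in (lborel :: (real \<times> real) measure). P (fst p)"
proof -
  obtain N where N: "{x \<in> space lborel. \<not> P x} \<subseteq> N" "emeasure lborel N = 0" "N \<in> sets lborel"
    using assms by (rule AE_E)
  have "N \<times> UNIV \<in> null_sets ((lborel :: real measure) \<Otimes>\<^sub>M (lborel :: real measure))"
    by (rule lborel.times_in_null_sets1) (use N in \<open>auto simp: null_sets_def\<close>)
  then have "N \<times> UNIV \<in> null_sets (lborel :: (real \<times> real) measure)" by (simp add: lborel_prod)
  then show ?thesis by (rule AE_I') (use N in auto)
qed

lemma AE_lborel_snd_nonzero: "AE p in (lborel :: (real \<times> real) measure). snd p \<noteq> 0"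
proof -
  have "UNIV \<times> {0} \<in> null_sets ((lborel :: real measure) \<Otimes>\<^sub>M (lborel :: real measure))"
    by (rule lborel.times_in_null_sets2) (auto simp: null_sets_def)
  then have "UNIV \<times> {0} \<in> null_sets (lborel :: (real \<times> real) measure)" by (simp add: lborel_prod)
  then show ?thesis by (rule AE_I') auto
qed

lemma test_fun_bounds:
  fixes \<theta> :: "real \<Rightarrow> real"
  assumes "test_fun \<theta>"
  obtains M C where "M > 0" "C \<ge> 0" "\<And>v. v \<notin> {-M..M} \<Longrightarrow> \<theta> v = 0" "\<And>v. v \<notin> {-M..M} \<Longrightarrow> deriv \<theta> v = 0"
    "\<And>v. \<bar>\<theta> v\<bar> \<le> C" "\<And>v. \<bar>deriv \<theta> v\<bar> \<le> C"
proof -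
  obtain M where M: "M > 0" "\<And>v. \<theta> v \<noteq> 0 \<Longrightarrow> norm v \<le> M" using test_fun_support[OF assms] by metis
  then have supp: "\<theta> v \<noteq> 0 \<Longrightarrow> v \<in> {-M..M}" for v by (force simp: abs_le_iff)
  have supp': "deriv \<theta> v \<noteq> 0 \<Longrightarrow> v \<in> {-M..M}" for v by (rule test_fun_deriv_support[OF assms supp])
  have C: "C_order k \<theta>" for k using assms by (simp add: test_fun_def)
  have bd: "\<exists>B. \<forall>v\<in>{-M..M}. \<bar>k v\<bar> \<le> B" if "continuous_on UNIV k" for k :: "real \<Rightarrow> real"
  proof -
    have "bounded (k ` {-M..M})"
      by (intro compact_imp_bounded compact_continuous_image continuous_on_subset[OF that]) auto
    then show ?thesis unfolding bounded_iff by auto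
  qed
  obtain B1 where B1: "\<forall>v\<in>{-M..M}. \<bar>\<theta> v\<bar> \<le> B1" using bd[OF C_order_continuous[OF C]] by blast
  obtain B2 where B2: "\<forall>v\<in>{-M..M}. \<bar>deriv \<theta> v\<bar> \<le> B2"
    using bd[OF C_order_continuous[OF C_order_real_deriv(2)[OF C, of 0]]] by blast
  define B where "B = max 0 (max B1 B2)"
  have "\<bar>\<theta> v\<bar> \<le> B" for v using B1 supp[of v] by (cases "\<theta> v = 0") (auto simp: B_def le_max_iff_disj)
  moreover have "\<bar>deriv \<theta> v\<bar> \<le> B" for v using B2 supp'[of v] by (cases "deriv \<theta> v = 0") (auto simp: B_def le_max_iff_disj)
  ultimately show ?thesis using that[of M B] M(1) supp supp' by (auto simp: B_def)
qed

lemma test_fun_measurable: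
  fixes \<theta> :: "real \<Rightarrow> real"
  assumes "test_fun \<theta>" shows "\<theta> \<in> borel_measurable borel" "deriv \<theta> \<in> borel_measurable borel"
proof -
  have C: "C_order k \<theta>" for k using assms by (simp add: test_fun_def)
  show "\<theta> \<in> borel_measurable borel" "deriv \<theta> \<in> borel_measurable borel"
    by (rule borel_measurable_continuous_onI[OF C_order_continuous[OF C]]
        borel_measurable_continuous_onI[OF C_order_continuous[OF C_order_real_deriv(2)[OF C, of 0]]])+
qed

locale analytic_density =
  fixes f :: "real \<times> real \<Rightarrow> real"
  assumes f_analytic: "f real_analytic2_on {(x, v). v < 0} \<union> {(x, v). v > 0}"
    and f_integrable: "\<And>x. integrable lebesgue (\<lambda>v. f (x, v))"
begin

lemma f_isCont: "v \<noteq> 0 \<Longrightarrow> isCont f (x, v)"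
  by (rule real_analytic2_dx(3)[OF f_analytic]) auto

text \<open>The values of \<open>f\<close> on v = 0 are arbitrary, so \<open>f\<close> need not be
  Borel. Replacing them by 0 gives a Borel function that agrees with \<open>f\<close> almost
  everywhere, in the plane and on each vertical line.\<close>

definition f0 :: "real \<times> real \<Rightarrow> real" where
  "f0 p = indicator {p. snd p \<noteq> 0} p * f p"

lemma f0_measurable [measurable]: "f0 \<in> borel_measurable borel"
proof -
  have "open {p::real \<times> real. snd p \<noteq> 0}"
    by (intro open_Collect_neq continuous_intros)
  moreover have "continuous_on {p::real \<times> real. snd p \<noteq> 0} f"
    by (intro continuous_at_imp_continuous_on ballI) (use f_isCont in auto)
  ultimately have "(\<lambda>p. indicator {p. snd p \<noteq> 0} p *\<^sub>R f p) \<in> borel_measurable borel"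
    by (intro borel_measurable_continuous_on_indicator borel_open)
  then show ?thesis unfolding f0_def[abs_def] real_scaleR_def .
qed

lemma AE_f0_2d: "AE p in (lborel :: (real \<times> real) measure). f0 p = f p"
  using AE_lborel_snd_nonzero by eventually_elim (simp add: f0_def)

lemma AE_f0_1d: "AE v in lborel. f0 (x, v) = f (x, v)"
  using AE_lborel_singleton[of 0] by eventually_elim (simp add: f0_def)

lemma slice_measurable [measurable]: "(\<lambda>v. f (x, v)) \<in> borel_measurable borel"
proof -
  have eq: "(\<lambda>v. f (x, v)) = (\<lambda>v. f0 (x, v) + indicator {0} v * f (x, 0))"
  proof
    fix v show "f (x, v) = f0 (x, v) + indicator {0} v * f (x, 0)" by (cases "v = 0") (simp_all add: f0_def)
  qed
  have "(\<lambda>v. f0 (x, v) + indicator {0} v * f (x, 0)) \<in> borel_measurable borel" by measurable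
  then show ?thesis by (rule subst[OF eq[symmetric], of "\<lambda>k. k \<in> borel_measurable borel"])
qed

lemma slice_integrable: "integrable lborel (\<lambda>v. f (x, v))"
  using f_integrable[of x] by (subst (asm) integrable_completion) simp_all

lemma f0_box_integrable:
  assumes "L1_loc f"
  shows "integrable lborel (\<lambda>p. indicator ({-M..M} \<times> {-M..M}) p * f0 p)"
proof -
  have "f absolutely_integrable_on ({-M..M} \<times> {-M..M})"
    using assms unfolding L1_loc_def by (simp add: compact_Times)
  then have i: "integrable lebesgue (\<lambda>p. indicator ({-M..M} \<times> {-M..M}) p *\<^sub>R f p)"
    unfolding set_integrable_def .
  have m: "(\<lambda>p. indicator ({-M..M} \<times> {-M..M}) p * f0 p) \<in> borel_measurable lborel"
  proof -
    have "closed ({-M..M} \<times> {-M..M::real})" by (intro closed_Times) auto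
    then have "{-M..M} \<times> {-M..M::real} \<in> sets borel" by (rule borel_closed)
    then show ?thesis by measurable
  qed
  have "AE p in lebesgue. indicator ({-M..M} \<times> {-M..M}) p *\<^sub>R f p = indicator ({-M..M} \<times> {-M..M}) p * f0 p"
    using AE_completion[OF AE_f0_2d] by eventually_elim simp
  then have "integrable lebesgue (\<lambda>p. indicator ({-M..M} \<times> {-M..M}) p * f0 p)"
    by (intro integrable_cong_AE_imp[OF i]) (use m in \<open>auto intro: measurable_completion\<close>)
  then show ?thesis using m by (subst (asm) integrable_completion) simp_all
qed

lemma slice_mult_integrable:
  assumes "k \<in> borel_measurable borel" "\<And>v. \<bar>k v\<bar> \<le> C"
  shows "integrable lborel (\<lambda>v. k v * f (x, v))"
proof (rule Bochner_Integration.integrable_bound[of _ "\<lambda>v. C * f (x, v)"])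
  show "AE v in lborel. norm (k v * f (x, v)) \<le> norm (C * f (x, v))"
  proof (intro AE_I2)
    fix v
    have "\<bar>k v\<bar> \<le> \<bar>C\<bar>" using assms(2)[of v] by linarith
    then show "norm (k v * f (x, v)) \<le> norm (C * f (x, v))" by (simp add: abs_mult mult_right_mono)
  qed
qed (use assms(1) slice_integrable in \<open>auto intro: integrable_mult_right\<close>)

text \<open>\<open>h\<close> is exchanged for a Borel representative and product test functions are
  inserted, after which Fubini gives iterated integrals over slices. There is no restriction on the
  support of \<open>\<theta>\<close>: the form is used away from v = 0 for the profiles and with
  \<open>\<theta>\<close> concentrating at v = 0 for their jump.\<close>

lemma stationary_weak_form:
  assumes W: "weak_stationary_state \<Phi> f"
  obtains h where "h \<in> borel_measurable borel"
    "\<And>a b. \<exists>B. AE x in lborel. x \<in> {a..b} \<longrightarrow> \<bar>h x\<bar> \<le> B"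
    "\<And>a b. a < b \<Longrightarrow> potential \<Phi> f b - potential \<Phi> f a = (LINT x:{a..b}|lborel. h x)"
    "\<And>\<phi> \<theta>. test_fun \<phi> \<Longrightarrow> test_fun \<theta> \<Longrightarrow>
       (LINT x|lborel. h x * \<phi> x * (LINT v|lborel. deriv \<theta> v * f (x, v))
          - deriv \<phi> x * (LINT v|lborel. v * \<theta> v * f (x, v))) = 0"
proof -
  let ?g = "potential \<Phi> f"
  obtain h1 where L1: "L1_loc f" and W1: "W1inf_loc ?g h1"
    and weak: "\<And>\<psi>. test_fun \<psi> \<Longrightarrow> (LINT p|lebesgue. f p *
              (h1 (fst p) * frechet_derivative \<psi> (at p) (0, 1)
               - snd p * frechet_derivative \<psi> (at p) (1, 0))) = 0"
    using W unfolding weak_stationary_state_def by blast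
  have gc: "continuous_on UNIV ?g" and h1m: "h1 \<in> borel_measurable lebesgue"
    and h1b: "\<And>K. compact K \<Longrightarrow> \<exists>B. AE p in lebesgue. p \<in> K \<longrightarrow> \<bar>h1 p\<bar> \<le> B"
    and wd: "weak_derivative ?g h1"
    using W1 unfolding W1inf_loc_def Linf_loc_def by auto
  obtain h where hm: "h \<in> borel_measurable lborel" and hh1: "AE x in lborel. h1 x = h x"
    using completion_ex_borel_measurable_real[OF h1m] by blast
  have hm': "h \<in> borel_measurable borel" using hm by simp
  have hb: "\<exists>B. AE x in lborel. x \<in> {a..b} \<longrightarrow> \<bar>h x\<bar> \<le> B" for a b
  proof -
    obtain B where "AE x in lebesgue. x \<in> {a..b} \<longrightarrow> \<bar>h1 x\<bar> \<le> B" using h1b[of "{a..b}"] by auto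
    then have "AE x in lborel. x \<in> {a..b} \<longrightarrow> \<bar>h1 x\<bar> \<le> B" by (simp add: AE_completion_iff)
    then have "AE x in lborel. x \<in> {a..b} \<longrightarrow> \<bar>h x\<bar> \<le> B" using hh1 by eventually_elim simp
    then show ?thesis by blast
  qed
  have hi: "set_integrable lborel {a..b} h" for a b
  proof (cases "a \<le> b")
    case True
    then show ?thesis using hb[of a b] AE_bounded_set_integral(1)[OF hm'] by blast
  qed (simp add: set_integrable_def)
  have gh: "?g b - ?g a = (LINT x:{a..b}|lborel. h x)" if "a < b" for a b
  proof (rule du_bois_reymond[OF gc hm' hi _ that])
    fix \<phi> :: "real \<Rightarrow> real" assume \<phi>: "test_fun \<phi>"
    note [measurable] = test_fun_measurable[OF \<phi>] borel_measurable_continuous_onI[OF gc] hm'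
    have "(LINT x|lborel. ?g x * deriv \<phi> x) = (LINT x|lebesgue. ?g x * deriv \<phi> x)"
      by (rule integral_completion[symmetric]) measurable
    also have "\<dots> = - (LINT x|lebesgue. h1 x * \<phi> x)"
      using wd \<phi> unfolding weak_derivative_def by blast
    also have "(LINT x|lebesgue. h1 x * \<phi> x) = (LINT x|lebesgue. h x * \<phi> x)"
    proof (rule integral_cong_AE)
      have "\<phi> \<in> borel_measurable lebesgue" by (rule measurable_completion) simp
      then show "(\<lambda>x. h1 x * \<phi> x) \<in> borel_measurable lebesgue" using h1m by measurable
      show "(\<lambda>x. h x * \<phi> x) \<in> borel_measurable lebesgue" by (rule measurable_completion) simp
      show "AE x in lebesgue. h1 x * \<phi> x = h x * \<phi> x"
        using AE_completion[OF hh1] by eventually_elim simp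
    qed
    also have "(LINT x|lebesgue. h x * \<phi> x) = (LINT x|lborel. h x * \<phi> x)"
      by (rule integral_completion) measurable
    finally show "(LINT x|lborel. ?g x * deriv \<phi> x) = - (LINT x|lborel. h x * \<phi> x)" .
  qed
  have "(LINT x|lborel. h x * \<phi> x * (LINT v|lborel. deriv \<theta> v * f (x, v))
          - deriv \<phi> x * (LINT v|lborel. v * \<theta> v * f (x, v))) = 0"
    if \<phi>: "test_fun \<phi>" and \<theta>: "test_fun \<theta>" for \<phi> \<theta>
  proof -
    note [measurable] = test_fun_measurable[OF \<phi>] test_fun_measurable[OF \<theta>] hm'
    obtain M1 C1 where 1: "M1 > 0" "C1 \<ge> 0" "\<And>v. v \<notin> {-M1..M1} \<Longrightarrow> \<phi> v = 0" "\<And>v. v \<notin> {-M1..M1} \<Longrightarrow> deriv \<phi> v = 0"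
      "\<And>v. \<bar>\<phi> v\<bar> \<le> C1" "\<And>v. \<bar>deriv \<phi> v\<bar> \<le> C1" using test_fun_bounds[OF \<phi>] by blast
    obtain M2 C2 where 2: "M2 > 0" "C2 \<ge> 0" "\<And>v. v \<notin> {-M2..M2} \<Longrightarrow> \<theta> v = 0" "\<And>v. v \<notin> {-M2..M2} \<Longrightarrow> deriv \<theta> v = 0"
      "\<And>v. \<bar>\<theta> v\<bar> \<le> C2" "\<And>v. \<bar>deriv \<theta> v\<bar> \<le> C2" using test_fun_bounds[OF \<theta>] by blast
    define M where "M = max M1 M2"
    define T where "T p = h (fst p) * (\<phi> (fst p) * deriv \<theta> (snd p)) - snd p * (deriv \<phi> (fst p) * \<theta> (snd p))" for p
    have Tm [measurable]: "T \<in> borel_measurable (lborel \<Otimes>\<^sub>M lborel)" unfolding T_def by measurable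
    then have Tm2 [measurable]: "T \<in> borel_measurable borel" by (simp add: lborel_prod)
    obtain B where B: "AE x in lborel. x \<in> {-M..M} \<longrightarrow> \<bar>h x\<bar> \<le> B" using hb by blast
    define D where "D = \<bar>B\<bar> * (C1 * C2) + M * (C1 * C2)"
    have M0: "M \<ge> 0" using 1 by (simp add: M_def)
    \<comment> \<open>The integrand is dominated by a multiple of \<open>f\<close> cut off to a box,
      which is integrable because \<open>f\<close> is locally integrable; this justifies
      Fubini.\<close>
    have Tb: "AE p in lborel. \<bar>f0 p * T p\<bar> \<le> \<bar>D * (indicator ({-M..M} \<times> {-M..M}) p * f0 p)\<bar>"
      using AE_lborel_fst[OF B]
    proof eventually_elim
      case (elim p)
      show ?case
      proof (cases "p \<in> {-M..M} \<times> {-M..M}")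
        case True
        then have p: "fst p \<in> {-M..M}" "\<bar>snd p\<bar> \<le> M" by auto
        have "\<bar>h (fst p) * (\<phi> (fst p) * deriv \<theta> (snd p))\<bar> \<le> \<bar>B\<bar> * (C1 * C2)"
          unfolding abs_mult using elim p 1 2 by (intro mult_mono) auto
        moreover have "\<bar>snd p * (deriv \<phi> (fst p) * \<theta> (snd p))\<bar> \<le> M * (C1 * C2)"
          unfolding abs_mult using p M0 1 2 by (intro mult_mono) auto
        ultimately have "\<bar>T p\<bar> \<le> D" unfolding T_def D_def by linarith
        then have "\<bar>f0 p\<bar> * \<bar>T p\<bar> \<le> \<bar>f0 p\<bar> * \<bar>D\<bar>" by (intro mult_left_mono) auto
        then show ?thesis using True by (simp add: abs_mult mult.commute)
      next
        case False
        then have "fst p \<notin> {-M1..M1} \<or> snd p \<notin> {-M2..M2}" by (cases p) (auto simp: M_def)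
        then have "T p = 0" using 1(3,4) 2(3,4) unfolding T_def by (metis mult_zero_left mult_zero_right diff_zero)
        then show ?thesis by simp
      qed
    qed
    have Ti: "integrable lborel (\<lambda>p. f0 p * T p)"
      by (rule Bochner_Integration.integrable_bound[OF integrable_mult_right[OF f0_box_integrable[OF L1, of M], of D]])
         (use Tb in simp_all)
    have "0 = (LINT p|lebesgue. f p * (h1 (fst p) * (\<phi> (fst p) * deriv \<theta> (snd p)) - snd p * (deriv \<phi> (fst p) * \<theta> (snd p))))"
      using weak[OF test_fun_prod(1)[OF \<phi> \<theta>]] unfolding test_fun_prod(2,3)[OF \<phi> \<theta>] by simp
    also have "\<dots> = (LINT p|lebesgue. f0 p * T p)"
    proof -
      have m: "(\<lambda>p. f0 p * T p) \<in> borel_measurable lebesgue"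
        by (rule measurable_completion) simp
      have ae: "AE p in lebesgue. f0 p * T p = f p * (h1 (fst p) * (\<phi> (fst p) * deriv \<theta> (snd p)) - snd p * (deriv \<phi> (fst p) * \<theta> (snd p)))"
        using AE_completion[OF AE_f0_2d] AE_completion[OF AE_lborel_fst[OF hh1]]
        by eventually_elim (simp add: T_def)
      show ?thesis
        by (rule integral_cong_AE[OF borel_measurable_AE[OF m ae] m AE_symmetric[OF ae]])
    qed
    also have "\<dots> = (LINT p|lborel. f0 p * T p)" by (rule integral_completion) simp
    also have "\<dots> = (LINT x|lborel. LINT v|lborel. f0 (x, v) * T (x, v))"
      using lborel_pair.integral_fst'[of "\<lambda>p. f0 p * T p"] Ti by (simp add: lborel_prod)
    also have "\<dots> = (LINT x|lborel. h x * \<phi> x * (LINT v|lborel. deriv \<theta> v * f (x, v))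
          - deriv \<phi> x * (LINT v|lborel. v * \<theta> v * f (x, v)))"
    proof (intro Bochner_Integration.integral_cong refl)
      fix x
      have i1: "integrable lborel (\<lambda>v. deriv \<theta> v * f (x, v))"
        by (rule slice_mult_integrable) (use 2 in auto)
      have i2: "integrable lborel (\<lambda>v. v * \<theta> v * f (x, v))"
      proof (rule slice_mult_integrable)
        show "\<bar>v * \<theta> v\<bar> \<le> M2 * C2" for v
        proof (cases "v \<in> {-M2..M2}")
          case True
          then show ?thesis unfolding abs_mult using 2 by (intro mult_mono) auto
        qed (use 2 in auto)
      qed simp
      have "(LINT v|lborel. f0 (x, v) * T (x, v)) =
          (LINT v|lborel. h x * \<phi> x * (deriv \<theta> v * f (x, v)) - deriv \<phi> x * (v * \<theta> v * f (x, v)))"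
      proof (rule integral_cong_AE)
        show "AE v in lborel. f0 (x, v) * T (x, v) = h x * \<phi> x * (deriv \<theta> v * f (x, v)) - deriv \<phi> x * (v * \<theta> v * f (x, v))"
          using AE_f0_1d[of x] by eventually_elim (simp add: T_def algebra_simps)
      qed measurable
      also have "\<dots> = h x * \<phi> x * (LINT v|lborel. deriv \<theta> v * f (x, v)) - deriv \<phi> x * (LINT v|lborel. v * \<theta> v * f (x, v))"
        using i1 i2 by (subst Bochner_Integration.integral_diff) auto
      finally show "(LINT v|lborel. f0 (x, v) * T (x, v)) = h x * \<phi> x * (LINT v|lborel. deriv \<theta> v * f (x, v))
          - deriv \<phi> x * (LINT v|lborel. v * \<theta> v * f (x, v))" .
    qed
    finally show ?thesis by simp
  qed
  then show ?thesis using that[OF hm' hb gh] by blast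
qed

text \<open>Both signs of \<open>v\<close> are treated at once: the reflection \<open>v \<mapsto> - v\<close> leaves the equation invariant.\<close>

lemma stationary_half_state:
  assumes W: "weak_stationary_state \<Phi> f" and s: "s = 1 \<or> s = - 1"
  obtains h where "half_state (\<lambda>(x, v). f (x, s * v)) (\<lambda>(x, v). dx f (x, s * v)) (\<lambda>(x, v). s * dv f (x, s * v))
     (potential \<Phi> f) h"
proof -
  obtain h where h: "h \<in> borel_measurable borel"
    "\<And>a b. \<exists>B. AE x in lborel. x \<in> {a..b} \<longrightarrow> \<bar>h x\<bar> \<le> B"
    "\<And>a b. a < b \<Longrightarrow> potential \<Phi> f b - potential \<Phi> f a = (LINT x:{a..b}|lborel. h x)"
    and weak: "\<And>\<phi> \<theta>. test_fun \<phi> \<Longrightarrow> test_fun \<theta> \<Longrightarrow>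
       (LINT x|lborel. h x * \<phi> x * (LINT v|lborel. deriv \<theta> v * f (x, v))
          - deriv \<phi> x * (LINT v|lborel. v * \<theta> v * f (x, v))) = 0"
    by (rule stationary_weak_form[OF W]) (rule that)
  have s0: "s \<noteq> 0" and ss: "s * s = 1" and sa: "\<bar>s\<bar> = 1" using s by auto
  have sv: "(x, s * v) \<in> {(x, v). v < 0} \<union> {(x, v). v > 0}" if "v > 0" for x v :: real
    using s that by auto
  have opn: "open ({(x, v). v < 0} \<union> {(x::real, v::real). v > 0})"
    unfolding case_prod_unfold by (intro open_Un open_Collect_less continuous_intros)
  have refl_cont: "isCont (\<lambda>p::real \<times> real. (fst p, s * snd p)) q" for q by (intro continuous_intros)
  let ?u = "\<lambda>(x, v). f (x, s * v)"
  have uc: "v > 0 \<Longrightarrow> isCont ?u (x, v)" for x v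
    using isCont_o2[OF refl_cont, of "(x, v)" f] f_isCont[of "s * v" x] s0 by (simp add: case_prod_unfold)
  have "half_state ?u (\<lambda>(x, v). dx f (x, s * v)) (\<lambda>(x, v). s * dv f (x, s * v)) (potential \<Phi> f) h"
  proof
    fix x v :: real assume v: "v > 0"
    have "((\<lambda>p. (fst p, s * snd p)) has_derivative (\<lambda>k. (fst k, s * snd k))) (at (x, v))"
      by (auto intro!: derivative_eq_intros)
    moreover have "(f has_derivative (\<lambda>h. dx f (x, s * v) * fst h + dv f (x, s * v) * snd h)) (at (fst (x, v), s * snd (x, v)))"
      using real_analytic2_has_derivative[OF f_analytic opn sv[OF v], of x] by simp
    ultimately have "((\<lambda>p. f (fst p, s * snd p)) has_derivative (\<lambda>k. dx f (x, s * v) * fst (fst k, s * snd k) + dv f (x, s * v) * snd (fst k, s * snd k))) (at (x, v))"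
      by (rule has_derivative_compose)
    then show "(?u has_derivative (\<lambda>k. (case (x, v) of (x, v) \<Rightarrow> dx f (x, s * v)) * fst k + (case (x, v) of (x, v) \<Rightarrow> s * dv f (x, s * v)) * snd k)) (at (x, v))"
      by (simp add: case_prod_unfold mult_ac)
    show "isCont (\<lambda>(x, v). dx f (x, s * v)) (x, v)"
      using isCont_o2[OF refl_cont, of "(x, v)" "dx f"] real_analytic2_dx(2)[OF f_analytic sv[OF v]] by (simp add: case_prod_unfold)
    have "isCont (\<lambda>(x, v). dv f (x, s * v)) (x, v)"
      using isCont_o2[OF refl_cont, of "(x, v)" "dv f"] real_analytic2_dv(2)[OF f_analytic sv[OF v]] by (simp add: case_prod_unfold)
    then show "isCont (\<lambda>(x, v). s * dv f (x, s * v)) (x, v)"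
      by (simp add: case_prod_unfold)
  next
    fix x
    have "(\<lambda>v. f (x, v)) real_analytic_on (\<lambda>v. s * v) ` {0<..}"
    proof (rule real_analytic_on_singletonI)
      fix w assume "w \<in> (\<lambda>v. s * v) ` {0<..}"
      then obtain v where "v > 0" "w = s * v" by auto
      then show "(\<lambda>v. f (x, v)) real_analytic_on {w}"
        using real_analytic2_dv(3)[OF f_analytic sv, of v x] by simp
    qed
    from real_analytic_on_compose[OF this real_analytic_on_mult[OF real_analytic_on_const real_analytic_on_ident], of s]
    show "(\<lambda>v. case (x, v) of (x, v) \<Rightarrow> f (x, s * v)) real_analytic_on {0<..}" by simp
  next
    fix \<phi> \<theta> :: "real \<Rightarrow> real" and p q
    assume a: "test_fun \<phi>" "test_fun \<theta>" "0 < p" "p < q" and supp: "\<And>v. \<theta> v \<noteq> 0 \<Longrightarrow> v \<in> {p..q::real}"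
    define K where "K x = integral {p..q} (\<lambda>v. v * \<theta> v * ?u (x, v))" for x
    define L where "L x = integral {p..q} (\<lambda>v. deriv \<theta> v * ?u (x, v))" for x
    \<comment> \<open>The test function pulled back by \<open>v \<mapsto> s * v\<close>.
      Substituting gives \<open>s * L x\<close> and \<open>s * K x\<close> for the two slice
      integrals, so that the common factor \<open>s\<close> cancels at the end.\<close>
    define \<theta>s where "\<theta>s v = \<theta> (0 + s * v)" for v
    have C: "C_order k \<theta>" for k using a(2) by (simp add: test_fun_def)
    have c\<theta>: "continuous_on A \<theta>" for A using C_order_continuous[OF C] continuous_on_subset by blast
    have c\<theta>': "continuous_on A (deriv \<theta>)" for A
      using C_order_continuous[OF C_order_real_deriv(2)[OF C, of 0]] continuous_on_subset by blast
    have supp': "deriv \<theta> v \<noteq> 0 \<Longrightarrow> v \<in> {p..q}" for v by (rule test_fun_deriv_support[OF a(2) supp])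
    have t\<theta>s: "test_fun \<theta>s" unfolding \<theta>s_def by (rule test_fun_affine[OF a(2) s0])
    have d\<theta>s: "deriv \<theta>s v = s * deriv \<theta> (s * v)" for v
    proof (rule DERIV_imp_deriv)
      have "((\<lambda>v. 0 + s * v) has_real_derivative s) (at v)" by (auto intro!: derivative_eq_intros)
      from DERIV_chain2[OF C_order_real_deriv(1)[OF C] this]
      show "(\<theta>s has_real_derivative s * deriv \<theta> (s * v)) (at v)" unfolding \<theta>s_def[abs_def] by (simp add: mult.commute)
    qed
    have cu: "continuous_on {p..q} (\<lambda>v. ?u (x, v))" for x
    proof (intro continuous_at_imp_continuous_on ballI)
      fix v assume "v \<in> {p..q}"
      then have v: "v > 0" using a(3) by simp
      have "isCont (\<lambda>v. (x, v)) v" by (intro continuous_intros)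
      from isCont_o2[OF this uc[OF v]] show "isCont (\<lambda>v. ?u (x, v)) v" .
    qed
    have L1: "(LINT v|lborel. deriv \<theta>s v * f (x, v)) = s * L x" for x
    proof -
      have "(LINT v|lborel. deriv \<theta>s v * f (x, v)) = (LINT v|lborel. s * (deriv \<theta> v * ?u (x, v)))"
        using lborel_integral_real_affine[OF s0, of "\<lambda>v. deriv \<theta>s v * f (x, v)" 0]
        by (simp add: d\<theta>s sa ss mult.assoc[symmetric])
      also have "\<dots> = s * (LINT v|lborel. indicator {p..q} v *\<^sub>R (deriv \<theta> v * ?u (x, v)))"
        by (subst integral_mult_right_zero, intro arg_cong[of _ _ "\<lambda>t. s * t"] Bochner_Integration.integral_cong)
           (use supp' in \<open>auto simp: indicator_def\<close>)
      also have "\<dots> = s * L x"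
        unfolding L_def by (subst lborel_integral_indicator_continuous) (intro continuous_on_mult c\<theta>' cu, simp)
      finally show ?thesis .
    qed
    have K1: "(LINT v|lborel. v * \<theta>s v * f (x, v)) = s * K x" for x
    proof -
      have "(LINT v|lborel. v * \<theta>s v * f (x, v)) = (LINT v|lborel. s * (v * \<theta> v * ?u (x, v)))"
        using lborel_integral_real_affine[OF s0, of "\<lambda>v. v * \<theta>s v * f (x, v)" 0]
        by (simp add: \<theta>s_def sa ss mult.assoc[symmetric])
      also have "\<dots> = s * (LINT v|lborel. indicator {p..q} v *\<^sub>R (v * \<theta> v * ?u (x, v)))"
        by (subst integral_mult_right_zero, intro arg_cong[of _ _ "\<lambda>t. s * t"] Bochner_Integration.integral_cong)
           (use supp in \<open>auto simp: indicator_def\<close>)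
      also have "\<dots> = s * K x"
        unfolding K_def by (subst lborel_integral_indicator_continuous) (intro continuous_on_mult continuous_on_id c\<theta> cu, simp)
      finally show ?thesis .
    qed
    have param_cont: "continuous_on UNIV (\<lambda>x. integral {p..q} (\<lambda>v. w v * ?u (x, v)))" if "continuous_on {p..q} w" for w
    proof -
      have "continuous_on UNIV (\<lambda>x. integral (cbox p q) (\<lambda>v. w v * ?u (x, v)))"
      proof (rule integral_continuous_on_param)
        have "continuous_on (UNIV \<times> cbox p q) ?u"
          by (intro continuous_at_imp_continuous_on ballI) (use uc a(3) in fastforce)
        then show "continuous_on (UNIV \<times> cbox p q) (\<lambda>(x, v). w v * ?u (x, v))"
          unfolding case_prod_unfold
          by (intro continuous_on_mult continuous_on_compose2[OF that] continuous_on_snd continuous_on_id) auto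
      qed
      then show ?thesis by simp
    qed
    have Kc: "continuous_on UNIV K" unfolding K_def by (intro param_cont continuous_on_mult continuous_on_id c\<theta>)
    have Lc: "continuous_on UNIV L" unfolding L_def by (intro param_cont c\<theta>')
    note [measurable] = borel_measurable_continuous_onI[OF Kc] borel_measurable_continuous_onI[OF Lc]
      test_fun_measurable[OF a(1)] h(1)
    obtain M C where MC: "M > 0" "C \<ge> 0" "\<And>v. v \<notin> {-M..M} \<Longrightarrow> \<phi> v = 0" "\<And>v. v \<notin> {-M..M} \<Longrightarrow> deriv \<phi> v = 0"
      "\<And>v. \<bar>\<phi> v\<bar> \<le> C" "\<And>v. \<bar>deriv \<phi> v\<bar> \<le> C" using test_fun_bounds[OF a(1)] by blast
    have bd: "\<exists>B. \<forall>x\<in>{-M..M}. \<bar>k x\<bar> \<le> B" if "continuous_on UNIV k" for k :: "real \<Rightarrow> real"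
    proof -
      have "bounded (k ` {-M..M})"
        by (intro compact_imp_bounded compact_continuous_image continuous_on_subset[OF that]) auto
      then show ?thesis unfolding bounded_iff by auto
    qed
    obtain BK where BK: "\<forall>x\<in>{-M..M}. \<bar>K x\<bar> \<le> BK" using bd[OF Kc] by blast
    obtain BL where BL: "\<forall>x\<in>{-M..M}. \<bar>L x\<bar> \<le> BL" using bd[OF Lc] by blast
    obtain B where B: "AE x in lborel. x \<in> {-M..M} \<longrightarrow> \<bar>h x\<bar> \<le> B" using h(2) by blast
    have box: "integrable lborel k" if k: "k \<in> borel_measurable borel" "\<And>x. x \<notin> {-M..M} \<Longrightarrow> k x = 0"
      "AE x in lborel. x \<in> {-M..M} \<longrightarrow> \<bar>k x\<bar> \<le> D" for k :: "real \<Rightarrow> real" and D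
    proof -
      have "set_integrable lborel {-M..M} k"
        by (rule AE_bounded_set_integral(1)[OF k(1) _ k(3)]) (use MC in simp)
      then show ?thesis unfolding set_integrable_def
        by (rule Bochner_Integration.integrable_cong[THEN iffD1, rotated -1]) (use k(2) in \<open>auto simp: indicator_def\<close>)
    qed
    have iK: "integrable lborel (\<lambda>x. deriv \<phi> x * K x)"
    proof (rule box)
      show "AE x in lborel. x \<in> {-M..M} \<longrightarrow> \<bar>deriv \<phi> x * K x\<bar> \<le> C * BK"
        by (intro AE_I2 impI) (use MC BK in \<open>auto simp: abs_mult intro!: mult_mono\<close>)
    qed (use MC in auto)
    have iL: "integrable lborel (\<lambda>x. h x * \<phi> x * L x)"
    proof (rule box)
      show "AE x in lborel. x \<in> {-M..M} \<longrightarrow> \<bar>h x * \<phi> x * L x\<bar> \<le> \<bar>B\<bar> * C * BL"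
        using B
      proof (eventually_elim, intro impI)
        fix x assume "x \<in> {-M..M} \<longrightarrow> \<bar>h x\<bar> \<le> B" "x \<in> {-M..M}"
        then show "\<bar>h x * \<phi> x * L x\<bar> \<le> \<bar>B\<bar> * C * BL"
          unfolding abs_mult using MC BL by (intro mult_mono mult_nonneg_nonneg) auto
      qed
    qed (use MC in auto)
    have "0 = (LINT x|lborel. h x * \<phi> x * (s * L x) - deriv \<phi> x * (s * K x))"
      using weak[OF a(1) t\<theta>s] by (simp add: L1 K1)
    also have "\<dots> = (LINT x|lborel. s * (h x * \<phi> x * L x) - s * (deriv \<phi> x * K x))"
      by (simp add: mult_ac)
    also have "\<dots> = s * (LINT x|lborel. h x * \<phi> x * L x) - s * (LINT x|lborel. deriv \<phi> x * K x)"
      using iK iL by (subst Bochner_Integration.integral_diff) auto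
    finally have "(LINT x|lborel. deriv \<phi> x * K x) = (LINT x|lborel. h x * \<phi> x * L x)"
      using s0 by (simp add: right_diff_distrib[symmetric])
    then show "(LINT x|lborel. integral {p..q} (\<lambda>v. v * \<theta> v * ?u (x, v)) * deriv \<phi> x) =
        (LINT x|lborel. h x * integral {p..q} (\<lambda>v. deriv \<theta> v * ?u (x, v)) * \<phi> x)"
      unfolding K_def[symmetric] L_def[symmetric] by (simp add: mult_ac)
  qed (use h in auto)
  then show ?thesis by (rule that)
qed

end

section \<open>Analyticity of the potential\<close>

lemma halfline_integrable_constant_zero:
  fixes k :: "real \<Rightarrow> real"
  assumes k: "set_integrable lborel {0<..} k" and M: "M \<ge> 0" and c: "\<And>v. v > M \<Longrightarrow> k v = c"
  shows "c = 0"
proof (rule ccontr)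
  assume "c \<noteq> 0"
  define C where "C = (LINT v|lborel. \<bar>indicator {0<..} v * k v\<bar>)"
  have ik: "integrable lborel (\<lambda>v. \<bar>indicator {0<..} v * k v\<bar>)"
    using k unfolding set_integrable_def by simp
  have le: "real n * \<bar>c\<bar> \<le> C" for n
  proof -
    have "(LINT v|lborel. indicator {M<..M + real n} v * \<bar>c\<bar>) \<le> C"
      unfolding C_def
    proof (rule integral_mono[OF _ ik])
      show "integrable lborel (\<lambda>v. indicator {M<..M + real n} v * \<bar>c\<bar>)"
        by (intro integrable_mult_left integrable_real_indicator) (auto simp: emeasure_lborel_Ioc)
      show "indicator {M<..M + real n} v * \<bar>c\<bar> \<le> \<bar>indicator {0<..} v * k v\<bar>" for v
        using c[of v] M by (auto simp: indicator_def)
    qed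
    then show ?thesis by simp
  qed
  obtain n :: nat where "C / \<bar>c\<bar> < real n" using reals_Archimedean2 by blast
  then have "C < real n * \<bar>c\<bar>" using \<open>c \<noteq> 0\<close> by (simp add: field_simps)
  then show False using le[of n] by simp
qed

text \<open>A connected unbounded set of reals is an interval longer than any
  \<open>\<Delta>\<close>. It will be the set of values of \<open>g\<close> near a presumed singular
  point, with \<open>\<Delta>\<close> the difference of two kinetic energies.\<close>

lemma connected_unbounded_translate:
  fixes S :: "real set"
  assumes S: "connected S" and unb: "\<And>B. \<exists>s\<in>S. \<bar>s\<bar> > B"
  shows "\<exists>t\<in>S. t + \<Delta> \<in> S"
proof -
  have iv: "is_interval S" using S by (simp add: is_interval_connected_1)
  obtain s where s: "s \<in> S" using unb by blast
  obtain r where r: "r \<in> S" "\<bar>r\<bar> > \<bar>s\<bar> + \<bar>\<Delta>\<bar>" using unb by blast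
  show ?thesis
  proof (cases "r > 0")
    case True
    then have "s + \<bar>\<Delta>\<bar> \<in> S"
      using mem_is_interval_1_I[OF iv s r(1), of "s + \<bar>\<Delta>\<bar>"] r(2) by linarith
    then show ?thesis using s by (cases "\<Delta> \<ge> 0") (force intro: bexI[of _ "s + \<bar>\<Delta>\<bar>"])+
  next
    case False
    then have "s - \<bar>\<Delta>\<bar> \<in> S"
      using mem_is_interval_1_I[OF iv r(1) s, of "s - \<bar>\<Delta>\<bar>"] r(2) by linarith
    then show ?thesis using s by (cases "\<Delta> \<ge> 0") (force intro: bexI[of _ "s - \<bar>\<Delta>\<bar>"])+
  qed
qed

text \<open>One half-line of velocities with its profile. No regularity of \<open>g\<close> is
  assumed: everything known about it comes from the analytic dependence of \<open>u x v\<close> on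
  \<open>x\<close>. Negative velocities are covered by \<open>u x v = f (x, - v)\<close>.\<close>

locale energy_density =
  fixes u :: "real \<Rightarrow> real \<Rightarrow> real" and F g :: "real \<Rightarrow> real"
  assumes F_analytic: "F real_analytic_on {z. \<exists>x. g x < z}"
    and u_F: "\<And>x v. v > 0 \<Longrightarrow> u x v = F (v\<^sup>2 / 2 + g x)"
    and u_slice: "\<And>v. v > 0 \<Longrightarrow> (\<lambda>x. u x v) real_analytic_on UNIV"
    and u_integrable: "\<And>x. set_integrable lborel {0<..} (u x)"
    and F_nonzero: "\<exists>z. (\<exists>x. g x < z) \<and> F z \<noteq> 0"
begin

abbreviation energies :: "real set" where "energies \<equiv> {z. \<exists>x. g x < z}"

section \<open>The profile is neither constant nor periodic at large energies\<close>

lemma energies_up: "g x < z \<Longrightarrow> z \<in> energies" by blast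

lemma energies_open: "open energies" and energies_connected: "connected energies"
proof -
  have "energies = (\<Union>x. {g x<..})" by auto
  then show "open energies" by auto
  have "is_interval energies" unfolding is_interval_1 by (blast intro: less_le_trans)
  then show "connected energies" by (simp add: is_interval_connected_1)
qed

lemma F_cont: "z \<in> energies \<Longrightarrow> isCont F z"
  using F_analytic real_analytic_on_isCont by blast

lemma F_not_locally_zero:
  assumes "open T" "t \<in> T" "t \<in> energies" "\<And>z. z \<in> T \<Longrightarrow> F z = 0" shows False
  using real_analytic_identity_on_open[OF F_analytic energies_open energies_connected assms] F_nonzero by blast

text \<open>Integrability of a single slice forces a constant value at large energies to be zero,
  and then \<open>F\<close> vanishes identically by analyticity.\<close>

lemma F_not_constant: "\<not> (\<forall>e>a. F e = c)"
proof
  assume c: "\<forall>e>a. F e = c"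
  fix x :: real
  \<comment> \<open>As \<open>M \<ge> 1\<close>, any \<open>v > 2 * M\<close> has
    \<open>v\<^sup>2 / 2 \<ge> 2 * M\<close>, which exceeds \<open>a - g x\<close>.\<close>
  define M where "M = \<bar>a - g x\<bar> + 1"
  have "u x v = c" if v: "v > 2 * M" for v
  proof -
    have M: "M \<ge> 1" "a - g x \<le> M - 1" by (simp_all add: M_def)
    from M(1) have "2 * M * (2 * M) \<le> v * v" using v by (intro mult_mono) auto
    moreover have "2 * M * 1 \<le> 2 * M * M" using M by (intro mult_left_mono) auto
    ultimately have "2 * M \<le> v\<^sup>2 / 2" by (simp add: power2_eq_square)
    then have "v\<^sup>2 / 2 + g x > a" using M \<open>a - g x \<le> M - 1\<close> by linarith
    then show ?thesis using c u_F[of v x] v M by simp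
  qed
  then have "c = 0" using halfline_integrable_constant_zero[OF u_integrable, of "2 * M" x c] by (simp add: M_def)
  then show False
    using F_not_locally_zero[of "{max a (g x)<..}" "max a (g x) + 1"] c energies_up[of x "max a (g x) + 1"] by auto
qed

text \<open>For a periodic \<open>F\<close>, the integral \<open>P\<close> of |F| over energies
  grows linearly, by \<open>c\<close> per period. Written in the velocity, the same integral up to
  speed \<open>t\<close> is at most \<open>t\<close> times the L1 norm of the slice, hence of the
  order of the square root of the energy. So \<open>c = 0\<close>, and \<open>F\<close> vanishes on
  a whole period.\<close>

lemma F_aperiodic_aux:
  assumes T: "T > 0" and per: "\<And>s. s > s0 \<Longrightarrow> F (s + T) = F s" shows False
proof -
  fix x0 :: real
  \<comment> \<open>The speed \<open>b = 2 * a\<close> satisfies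
    \<open>b\<^sup>2 / 2 \<ge> 2 * a\<close>, so the energy \<open>s1\<close> reached at speed
    \<open>b\<close> over \<open>x0\<close> lies beyond \<open>s0\<close>, where the periodicity
    holds, and above \<open>g x0\<close>, where \<open>F\<close> is analytic.\<close>
  define a where "a = \<bar>s0 - g x0\<bar> + 1"
  have a: "a \<ge> 1" "s0 - g x0 \<le> a - 1" by (simp_all add: a_def)
  define b where "b = 2 * a"
  have b: "b \<ge> 2" using a by (simp add: b_def)
  have bs: "b\<^sup>2 / 2 + g x0 > s0" "b\<^sup>2 / 2 + g x0 > g x0"
  proof -
    have "2 * a * 1 \<le> 2 * a * a" using a by (intro mult_left_mono) auto
    then have "b\<^sup>2 / 2 \<ge> 2 * a" by (simp add: b_def power2_eq_square)
    then show "b\<^sup>2 / 2 + g x0 > s0" "b\<^sup>2 / 2 + g x0 > g x0" using a by linarith+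
  qed
  define s1 where "s1 = b\<^sup>2 / 2 + g x0"
  have Fc: "continuous_on {s1..s} (\<lambda>s. \<bar>F s\<bar>)" for s
  proof (intro continuous_on_rabs continuous_at_imp_continuous_on ballI F_cont)
    fix y assume "y \<in> {s1..s}"
    then have "g x0 < y" using bs(2) unfolding s1_def atLeastAtMost_iff by linarith
    then show "y \<in> energies" by blast
  qed
  define P where "P s = integral {s1..s} (\<lambda>s. \<bar>F s\<bar>)" for s
  have Pd: "(P has_real_derivative \<bar>F s\<bar>) (at s within {s1..})" if "s \<ge> s1" for s
  proof -
    have "(P has_real_derivative \<bar>F s\<bar>) (at s within {s1..s + 1})"
      unfolding P_def by (rule integral_has_real_derivative[OF Fc]) (use that in auto)
    moreover have "at s within {s1..s + 1} = at s within {s1..}"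
      by (rule at_within_nhd[of _ "{..<s + 1}"]) auto
    ultimately show ?thesis by simp
  qed
  define c where "c = P (s1 + T)"
  have shift: "P (s + T) - P s = c" if "s \<ge> s1" for s
  proof -
    have "\<exists>k. \<forall>s\<in>{s1..}. P (s + T) - P s = k"
    proof (rule has_field_derivative_zero_constant)
      fix s assume s: "s \<in> {s1..}"
      have "((\<lambda>s. P (s + T)) has_real_derivative \<bar>F (s + T)\<bar> * 1) (at s within {s1..})"
      proof (rule DERIV_image_chain[of P "\<bar>F (s + T)\<bar>" "\<lambda>s. s + T", unfolded o_def])
        show "(P has_real_derivative \<bar>F (s + T)\<bar>) (at (s + T) within (\<lambda>s. s + T) ` {s1..})"
          by (rule DERIV_subset[OF Pd]) (use s T in auto)
      qed (auto intro!: derivative_eq_intros)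
      then have "((\<lambda>s. P (s + T) - P s) has_real_derivative \<bar>F (s + T)\<bar> * 1 - \<bar>F s\<bar>) (at s within {s1..})"
        using Pd s by (intro DERIV_diff) auto
      then show "((\<lambda>s. P (s + T) - P s) has_real_derivative 0) (at s within {s1..})"
        using per[of s] s bs by (simp add: s1_def)
    qed simp
    then obtain k where k: "\<And>s. s \<ge> s1 \<Longrightarrow> P (s + T) - P s = k" by auto
    moreover have "P s1 = 0" by (simp add: P_def)
    ultimately show ?thesis using k[of s1] that by (simp add: c_def)
  qed
  have Pn: "P (s1 + real n * T) = real n * c" for n
  proof (induction n)
    case 0 then show ?case by (simp add: P_def)
  next
    case (Suc n)
    have "P (s1 + real n * T + T) - P (s1 + real n * T) = c" using shift[of "s1 + real n * T"] T by simp
    then show ?case using Suc by (simp add: algebra_simps)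
  qed
  define C where "C = (LINT v|lborel. \<bar>indicator {0<..} v * u x0 v\<bar>)"
  define I where "I t = integral {b..t} (\<lambda>v. \<bar>u x0 v\<bar>)" for t
  have ucont: "continuous_on {b..t} (\<lambda>v. \<bar>u x0 v\<bar>)" for t
  proof -
    have "continuous_on {b..t} (\<lambda>v. \<bar>F (v\<^sup>2 / 2 + g x0)\<bar>)"
    proof (intro continuous_intros continuous_at_imp_continuous_on ballI)
      fix v assume "v \<in> {b..t}"
      then have "isCont F (v\<^sup>2 / 2 + g x0)" using b by (intro F_cont energies_up[of x0]) auto
      then show "isCont (\<lambda>v. F (v\<^sup>2 / 2 + g x0)) v"
        by (rule isCont_o2[rotated]) (intro continuous_intros, simp)
    qed
    then show ?thesis by (rule continuous_on_eq) (use u_F b in auto)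
  qed
  have IC: "0 \<le> I t" "I t \<le> C" for t
  proof -
    show "0 \<le> I t" unfolding I_def by (rule integral_nonneg[OF integrable_continuous_interval[OF ucont]]) auto
    have "I t = (LINT v|lborel. indicator {b..t} v *\<^sub>R \<bar>u x0 v\<bar>)"
      unfolding I_def using lborel_integral_indicator_continuous[OF ucont] by simp
    also have "\<dots> \<le> C"
      unfolding C_def
    proof (rule integral_mono)
      show "integrable lborel (\<lambda>v. indicator {b..t} v *\<^sub>R \<bar>u x0 v\<bar>)"
        using borel_integrable_atLeastAtMost'[OF ucont] unfolding set_integrable_def .
      show "integrable lborel (\<lambda>v. \<bar>indicator {0<..} v * u x0 v\<bar>)"
        using u_integrable[of x0] unfolding set_integrable_def by simp
      show "indicator {b..t} v *\<^sub>R \<bar>u x0 v\<bar> \<le> \<bar>indicator {0<..} v * u x0 v\<bar>" for v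
        using b by (auto simp: indicator_def)
    qed
    finally show "I t \<le> C" .
  qed
  \<comment> \<open>The integral of \<open>v * \<bar>u x0 v\<bar>\<close> over \<open>{b..t}\<close>
    is at most \<open>t * I t\<close>. Instead of substituting, monotonicity of \<open>?Q\<close> is
    shown: its derivative is \<open>I v\<close>, because the two terms with |F| cancel.\<close>
  have PI: "P (t\<^sup>2 / 2 + g x0) \<le> t * I t" if t: "t \<ge> b" for t
  proof -
    let ?Q = "\<lambda>v. v * I v - P (v\<^sup>2 / 2 + g x0)"
    have "?Q b \<le> ?Q t"
    proof (rule DERIV_nonneg_imp_increasing_open[OF t])
      fix v assume v: "b < v" "v < t"
      have vs: "v\<^sup>2 / 2 + g x0 > s1"
        using v b by (simp add: s1_def power2_eq_square mult_strict_mono)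
      have "(I has_real_derivative \<bar>u x0 v\<bar>) (at v within {b..t})"
        unfolding I_def by (rule integral_has_real_derivative[OF ucont]) (use v in auto)
      then have I': "(I has_real_derivative \<bar>u x0 v\<bar>) (at v)" using at_within_Icc_at[OF v] by simp
      have "at (v\<^sup>2 / 2 + g x0) within {s1..} = at (v\<^sup>2 / 2 + g x0)"
        by (rule at_within_open_subset[of _ "{s1<..}"]) (use vs in auto)
      then have P': "(P has_real_derivative \<bar>F (v\<^sup>2 / 2 + g x0)\<bar>) (at (v\<^sup>2 / 2 + g x0))"
        using Pd[of "v\<^sup>2 / 2 + g x0"] vs by simp
      have "((\<lambda>v. v\<^sup>2 / 2 + g x0) has_real_derivative v) (at v)" by (auto intro!: derivative_eq_intros)
      from DERIV_chain2[OF P' this]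
      have "(?Q has_real_derivative (1 * I v + \<bar>u x0 v\<bar> * v) - \<bar>F (v\<^sup>2 / 2 + g x0)\<bar> * v) (at v)"
        by (intro DERIV_diff DERIV_mult DERIV_ident I')
      moreover have "(1 * I v + \<bar>u x0 v\<bar> * v) - \<bar>F (v\<^sup>2 / 2 + g x0)\<bar> * v = I v"
        using u_F[of v x0] v b by simp
      ultimately show "\<exists>y. (?Q has_real_derivative y) (at v) \<and> 0 \<le> y" using IC(1) by auto
    next
      have "continuous_on {b..t} I" unfolding I_def by (rule indefinite_integral_continuous_1[OF integrable_continuous_interval[OF ucont]])
      moreover have "continuous_on {s1..} P"
        using Pd by (intro DERIV_continuous_on) auto
      then have "continuous_on {b..t} (\<lambda>v. P (v\<^sup>2 / 2 + g x0))"
        by (rule continuous_on_compose2) (use b in \<open>auto intro!: continuous_intros mult_mono simp: s1_def power2_eq_square\<close>)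
      ultimately show "continuous_on {b..t} ?Q" by (intro continuous_intros)
    qed
    moreover have "?Q b = 0" by (simp add: I_def P_def s1_def)
    ultimately show ?thesis by simp
  qed
  have main: "real n * c \<le> sqrt (b\<^sup>2 + 2 * (real n * T)) * C" for n
  proof -
    define t where "t = sqrt (b\<^sup>2 + 2 * (real n * T))"
    have t2: "t\<^sup>2 = b\<^sup>2 + 2 * (real n * T)" using T by (simp add: t_def)
    have "t \<ge> b" unfolding t_def by (rule real_le_rsqrt) (use T in simp)
    have "real n * c = P (s1 + real n * T)" by (simp add: Pn)
    also have "s1 + real n * T = t\<^sup>2 / 2 + g x0" by (simp add: t2 s1_def)
    also have "P (t\<^sup>2 / 2 + g x0) \<le> t * I t" by (rule PI) fact
    also have "\<dots> \<le> t * C" using IC \<open>t \<ge> b\<close> b by (intro mult_left_mono) auto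
    finally show ?thesis by (simp add: t_def)
  qed
  have "c \<le> 0"
  proof (rule ccontr)
    assume "\<not> c \<le> 0"
    then have c: "c > 0" by simp
    have "((\<lambda>n. sqrt (b\<^sup>2 + 2 * (real n * T)) * C / real n) \<longlongrightarrow> 0) at_top"
    proof -
      have "((\<lambda>n. sqrt (b\<^sup>2 * (inverse (real n) * inverse (real n)) + 2 * T * inverse (real n)) * C) \<longlongrightarrow>
          sqrt (b\<^sup>2 * (0 * 0) + 2 * T * 0) * C) at_top"
        by (intro tendsto_intros lim_inverse_n)
      moreover have "eventually (\<lambda>n. sqrt (b\<^sup>2 * (inverse (real n) * inverse (real n)) + 2 * T * inverse (real n)) * C =
          sqrt (b\<^sup>2 + 2 * (real n * T)) * C / real n) at_top"
        using eventually_gt_at_top[of 0]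
      proof eventually_elim
        case (elim n)
        have "b\<^sup>2 * (inverse (real n) * inverse (real n)) + 2 * T * inverse (real n) = (b\<^sup>2 + 2 * (real n * T)) / (real n)\<^sup>2"
          using elim by (simp add: field_simps power2_eq_square)
        then show ?case using elim by (simp add: real_sqrt_divide)
      qed
      ultimately show ?thesis using Lim_transform_eventually by fastforce
    qed
    then have "eventually (\<lambda>n. sqrt (b\<^sup>2 + 2 * (real n * T)) * C / real n < c) at_top"
      using c by (rule order_tendstoD(2))
    then have "eventually (\<lambda>n::nat. False) at_top"
      using eventually_gt_at_top[of 0]
    proof eventually_elim
      case (elim n)
      then show ?case using main[of n] by (simp add: field_simps)
    qed
    then show False by simp
  qed
  moreover have "c \<ge> 0" unfolding c_def P_def by (rule integral_nonneg[OF integrable_continuous_interval[OF Fc]]) auto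
  ultimately have "integral {s1..s1 + T} (\<lambda>s. \<bar>F s\<bar>) = 0" by (simp add: c_def P_def)
  then have z: "\<bar>F s\<bar> = 0" if "s \<in> {s1..s1 + T}" for s
    using integral_eq_0_iff[OF Fc, of "s1 + T"] T that by auto
  have "g x0 < s1 + T / 2" using T bs(2) unfolding s1_def by linarith
  then have "s1 + T / 2 \<in> energies" by blast
  then show False
    by (rule F_not_locally_zero[of "{s1<..<s1 + T}" "s1 + T / 2", rotated 2]) (use T z in auto)
qed

text \<open>Two shifts of \<open>F\<close> that agree at all large energies coincide; consequently
  the slice \<open>u x\<close> determines the number \<open>g x\<close>.\<close>

lemma F_aperiodic:
  assumes "\<And>e. e > e0 \<Longrightarrow> F (e + g1) = F (e + g2)" shows "g1 = g2"
proof (rule ccontr)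
  assume ne: "g1 \<noteq> g2"
  have per: "F (s + (g2 - g1)) = F s" if "s > e0 + g1" for s
    using assms[of "s - g1"] that by (simp add: algebra_simps)
  have per': "F (s + (g1 - g2)) = F s" if "s > e0 + g2" for s
    using assms[of "s - g2"] that by (simp add: algebra_simps)
  show False
    using F_aperiodic_aux[of "g2 - g1" "e0 + g1"] F_aperiodic_aux[of "g1 - g2" "e0 + g2"] per per' ne
    by (cases "g1 < g2") auto
qed

lemma F_deriv_nonzero: obtains v where "v > 0" "deriv F (v\<^sup>2 / 2 + \<gamma>) \<noteq> 0"
proof (rule ccontr)
  assume a: "\<not> thesis"
  fix x :: real
  let ?a = "max \<gamma> (g x)"
  have "\<not> (v > 0 \<and> deriv F (v\<^sup>2 / 2 + \<gamma>) \<noteq> 0)" for v using a that by blast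
  then have d0: "deriv F e = 0" if "e > \<gamma>" for e
    using that by (metis real_sqrt_gt_0_iff real_sqrt_pow2 diff_gt_0_iff_gt mult_pos_pos zero_less_numeral
        less_imp_le nonzero_mult_div_cancel_left zero_neq_numeral diff_add_cancel)
  have "\<exists>c. \<forall>e\<in>{?a<..}. F e = c"
  proof (rule has_field_derivative_zero_constant)
    fix e assume e: "e \<in> {?a<..}"
    have "(F has_real_derivative deriv F e) (at e)"
      by (rule real_analytic_on_has_deriv[OF F_analytic]) (use e in auto)
    then show "(F has_field_derivative 0) (at e within {?a<..})"
      using d0 e by (auto intro: has_field_derivative_at_within)
  qed simp
  then show False using F_not_constant by (metis greaterThan_iff)
qed

text \<open>Along a sequence tending to \<open>x0\<close> with \<open>g\<close> bounded, a
  subsequence of the values of \<open>g\<close> converges, and continuity of \<open>u\<close> in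
  \<open>x\<close> with aperiodicity forces the limit \<open>g x0\<close>. Solving
  \<open>u x v0 = F (v0\<^sup>2 / 2 + G x)\<close> by the local inverse gives an analytic
  \<open>G\<close> that equals \<open>g\<close> on the tail of the sequence. The identity theorem in
  \<open>x\<close> makes \<open>G\<close> a valid potential at all points near \<open>x0\<close>,
  and aperiodicity identifies it with \<open>g\<close>.\<close>

lemma analytic_at_bounded_limit_point:
  assumes lim: "x0 islimpt {x. \<bar>g x\<bar> \<le> B}"
  obtains \<delta> where "\<delta> > 0" "g real_analytic_on ball x0 \<delta>"
proof -
  obtain X where X: "\<And>n. X n \<in> {x. \<bar>g x\<bar> \<le> B} - {x0}" "X \<longlonglongrightarrow> x0"
    using lim unfolding islimpt_sequential by blast
  have "bounded (range (g \<circ> X))" unfolding bounded_iff using X(1) by auto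
  then obtain \<gamma> r where r: "strict_mono r" "((g \<circ> X) \<circ> r) \<longlonglongrightarrow> \<gamma>"
    using bounded_imp_convergent_subsequence by blast
  define Y where "Y = X \<circ> r"
  have Y: "\<And>n. Y n \<noteq> x0" "Y \<longlonglongrightarrow> x0" "(\<lambda>n. g (Y n)) \<longlonglongrightarrow> \<gamma>"
    using X r LIMSEQ_subseq_LIMSEQ[OF X(2) r(1)] by (auto simp: Y_def o_def)
  have \<gamma>U: "\<gamma> + e \<in> energies" if "e > 0" for e
  proof -
    have "eventually (\<lambda>n. g (Y n) < \<gamma> + e) sequentially"
      using order_tendstoD(2)[OF Y(3), of "\<gamma> + e"] that by simp
    then obtain n where "g (Y n) < \<gamma> + e" using eventually_happens'[OF sequentially_bot] by blast
    then show ?thesis by blast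
  qed
  have "\<gamma> = g x0"
  proof (rule F_aperiodic[of 0])
    fix e :: real assume e: "e > 0"
    define v where "v = sqrt (2 * e)"
    have v: "v > 0" "v\<^sup>2 / 2 = e" using e by (auto simp: v_def)
    have "isCont (\<lambda>x. u x v) x0" using real_analytic_on_isCont[OF u_slice[OF v(1)]] by simp
    then have "(\<lambda>n. u (Y n) v) \<longlonglongrightarrow> u x0 v" using Y(2) by (rule isCont_tendsto_compose)
    moreover have "(\<lambda>n. F (e + g (Y n))) \<longlonglongrightarrow> F (e + \<gamma>)"
      by (rule isCont_tendsto_compose[OF F_cont])
         (use \<gamma>U[OF e] in \<open>simp add: add.commute\<close>, intro tendsto_add tendsto_const Y(3))
    ultimately show "F (e + \<gamma>) = F (e + g x0)"
      using u_F[OF v(1)] v(2) LIMSEQ_unique by simp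
  qed
  then have Yg: "(\<lambda>n. g (Y n)) \<longlonglongrightarrow> g x0" using Y(3) by simp
  obtain v0 where v0: "v0 > 0" "deriv F (v0\<^sup>2 / 2 + g x0) \<noteq> 0" using F_deriv_nonzero by blast
  let ?s = "v0\<^sup>2 / 2 + g x0"
  have sU: "?s \<in> energies" using v0 by (intro energies_up[of x0]) simp
  have Fs: "F real_analytic_on {?s}" using F_analytic by (rule real_analytic_on_subset) (use sU in blast)
  obtain \<psi> d e where \<psi>: "d > 0" "e > 0" "\<And>x. \<bar>x - ?s\<bar> < d \<Longrightarrow> \<psi> (F x) = x" "\<psi> real_analytic_on ball (F ?s) e"
    by (rule real_analytic_local_inverse[OF Fs v0(2)]) (rule that)
  define G where "G x = \<psi> (u x v0) - v0\<^sup>2 / 2" for x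
  have ua: "(\<lambda>x. u x v0) real_analytic_on UNIV" by (rule u_slice[OF v0(1)])
  have ux0: "u x0 v0 = F ?s" by (rule u_F[OF v0(1)])
  have "isCont (\<lambda>x. u x v0) x0" using real_analytic_on_isCont[OF ua] by simp
  then obtain \<eta>1 where \<eta>1: "\<eta>1 > 0" "\<And>x. dist x x0 < \<eta>1 \<Longrightarrow> dist (u x v0) (F ?s) < e"
    using \<psi>(2) ux0 unfolding continuous_at_eps_delta by metis
  have "G real_analytic_on ball x0 \<eta>1"
    unfolding G_def
    by (intro real_analytic_on_diff real_analytic_on_const real_analytic_on_compose[OF \<psi>(4)] real_analytic_on_subset[OF ua])
       (use \<eta>1(2) in \<open>auto simp: dist_commute\<close>)
  note Ga1 = this
  have Gx0: "G x0 = g x0" unfolding G_def ux0 using \<psi>(1) \<psi>(3)[of ?s] by simp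
  have "isCont G x0" using real_analytic_on_isCont[OF Ga1] \<eta>1(1) by simp
  then obtain \<eta>2 where \<eta>2: "\<eta>2 > 0" "\<And>x. dist x x0 < \<eta>2 \<Longrightarrow> dist (G x) (g x0) < 1"
    using Gx0 unfolding continuous_at_eps_delta by (metis zero_less_one)
  define \<eta> where "\<eta> = min \<eta>1 \<eta>2"
  have \<eta>: "\<eta> > 0" using \<eta>1 \<eta>2 by (simp add: \<eta>_def)
  have Ga: "G real_analytic_on ball x0 \<eta>" by (rule real_analytic_on_subset[OF Ga1]) (auto simp: \<eta>_def)
  have Gn: "\<bar>G x - g x0\<bar> < 1" if "x \<in> ball x0 \<eta>" for x
    using \<eta>2(2)[of x] that by (simp add: \<eta>_def dist_commute dist_real_def)
  have GY: "eventually (\<lambda>n. G (Y n) = g (Y n)) sequentially"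
  proof -
    have "eventually (\<lambda>n. dist (g (Y n)) (g x0) < d) sequentially" using Yg \<psi>(1) by (rule tendstoD)
    then show ?thesis
    proof eventually_elim
      case (elim n)
      have "\<psi> (F (v0\<^sup>2 / 2 + g (Y n))) = v0\<^sup>2 / 2 + g (Y n)"
        by (rule \<psi>(3)) (use elim in \<open>simp add: dist_real_def\<close>)
      then show ?case by (simp add: G_def u_F[OF v0(1)])
    qed
  qed
  \<comment> \<open>For \<open>v \<ge> 2\<close> the kinetic energy is at least 2, while
    \<open>G\<close> differs from \<open>g x0\<close> by less than 1 on the ball. The argument of
    \<open>F\<close> thus stays above \<open>g x0\<close>, where \<open>F\<close> is
    analytic.\<close>
  have eqv: "u x v - F (v\<^sup>2 / 2 + G x) = 0" if x: "x \<in> ball x0 \<eta>" and v: "v \<ge> 2" for x v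
  proof (rule real_analytic_identity[of "\<lambda>x. u x v - F (v\<^sup>2 / 2 + G x)" "ball x0 \<eta>" x0])
    have v2: "v\<^sup>2 / 2 \<ge> 2" using v mult_mono[of 2 v 2 v] by (simp add: power2_eq_square)
    have "(\<lambda>x. F (v\<^sup>2 / 2 + G x)) real_analytic_on ball x0 \<eta>"
    proof (rule real_analytic_on_compose[OF F_analytic real_analytic_on_add[OF real_analytic_on_const Ga]])
      show "(\<lambda>x. v\<^sup>2 / 2 + G x) ` ball x0 \<eta> \<subseteq> energies"
      proof safe
        fix x assume "x \<in> ball x0 \<eta>"
        then show "\<exists>y. g y < v\<^sup>2 / 2 + G x" using Gn[of x] v2 by (intro exI[of _ x0]) (auto simp: abs_less_iff)
      qed
    qed
    then show "(\<lambda>x. u x v - F (v\<^sup>2 / 2 + G x)) real_analytic_on ball x0 \<eta>"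
      by (intro real_analytic_on_diff real_analytic_on_subset[OF u_slice]) (use v in auto)
    show "x0 islimpt {x. u x v - F (v\<^sup>2 / 2 + G x) = 0}"
    proof -
      obtain N where N: "\<And>n. n \<ge> N \<Longrightarrow> G (Y n) = g (Y n)" using GY unfolding eventually_sequentially by blast
      have "(\<lambda>n. Y (n + N)) \<longlonglongrightarrow> x0" using Y(2) by (rule LIMSEQ_ignore_initial_segment)
      moreover have "Y (n + N) \<in> {x. u x v - F (v\<^sup>2 / 2 + G x) = 0} - {x0}" for n
        using N[of "n + N"] Y(1) u_F[of v] v by simp
      ultimately show ?thesis
        unfolding islimpt_sequential by (intro exI[of _ "\<lambda>n. Y (n + N)"]) simp
    qed
  qed (use x \<eta> in auto)
  have gG: "g x = G x" if x: "x \<in> ball x0 \<eta>" for x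
  proof (rule F_aperiodic[of 2])
    fix e :: real assume e: "e > 2"
    define v where "v = sqrt (2 * e)"
    have v: "v \<ge> 2" "v\<^sup>2 / 2 = e" using e by (auto simp: v_def intro!: real_le_rsqrt)
    show "F (e + g x) = F (e + G x)" using eqv[OF x v(1)] u_F[of v x] v by simp
  qed
  have "g real_analytic_on ball x0 \<eta>"
  proof (rule real_analytic_on_singletonI)
    fix a assume a: "a \<in> ball x0 \<eta>"
    show "g real_analytic_on {a}"
    proof (rule real_analytic_on_cong_nhds)
      show "G real_analytic_on {a}" by (rule real_analytic_on_subset[OF Ga]) (use a in simp)
      show "eventually (\<lambda>x. G x = g x) (nhds a)"
        unfolding eventually_nhds by (rule exI[of _ "ball x0 \<eta>"]) (use a gG in auto)
    qed
  qed
  then show ?thesis using that \<eta> by blast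
qed

theorem potential_analytic: "g real_analytic_on UNIV"
proof -
  \<comment> \<open>The points approached by a sequence along which \<open>g\<close> stays bounded.
    \<open>g\<close> is analytic near each of them and every point of continuity belongs to
    \<open>A\<close>, so \<open>A\<close> is open.\<close>
  define A where "A = {x. \<exists>B. x islimpt {y. \<bar>g y\<bar> \<le> B}}"
  have an: "\<exists>\<delta>>0. g real_analytic_on ball x \<delta>" if "x \<in> A" for x
    using that analytic_at_bounded_limit_point unfolding A_def by blast
  have gA: "isCont g x" if "x \<in> A" for x
    using an[OF that] real_analytic_on_isCont centre_in_ball by blast
  have inA: "x \<in> A" if cont: "isCont g x" for x
  proof -
    obtain d where d: "d > 0" "\<And>y. dist y x < d \<Longrightarrow> dist (g y) (g x) < 1"
      using cont unfolding continuous_at_eps_delta by (metis zero_less_one)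
    have "x islimpt ball x d" using d(1) by (simp add: interior_limit_point)
    moreover have "ball x d \<subseteq> {y. \<bar>g y\<bar> \<le> \<bar>g x\<bar> + 1}"
    proof
      fix y assume "y \<in> ball x d"
      then have "\<bar>g y - g x\<bar> < 1" using d(2)[of y] by (simp add: dist_commute dist_real_def)
      then show "y \<in> {y. \<bar>g y\<bar> \<le> \<bar>g x\<bar> + 1}" by auto
    qed
    ultimately have "x islimpt {y. \<bar>g y\<bar> \<le> \<bar>g x\<bar> + 1}" by (rule islimpt_subset)
    then show ?thesis unfolding A_def by blast
  qed
  have Aopen: "open A"
  proof (rule Topological_Spaces.openI)
    fix x assume "x \<in> A"
    then obtain \<delta> where \<delta>: "\<delta> > 0" "g real_analytic_on ball x \<delta>" using an by blast
    then show "\<exists>T. open T \<and> x \<in> T \<and> T \<subseteq> A"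
      using inA real_analytic_on_isCont by (intro exI[of _ "ball x \<delta>"]) auto
  qed
  \<comment> \<open>If \<open>A\<close> were empty, each set {|g| \<le> n} would meet [0, 1] in a
    finite set, and [0, 1] would be countable.\<close>
  have Ane: "A \<noteq> {}"
  proof
    assume "A = {}"
    have "finite ({y. \<bar>g y\<bar> \<le> real n} \<inter> {0..1})" for n
    proof (rule ccontr)
      assume inf: "infinite ({y. \<bar>g y\<bar> \<le> real n} \<inter> {0..1})"
      then obtain x where "x islimpt ({y. \<bar>g y\<bar> \<le> real n} \<inter> {0..1})"
        using Heine_Borel_imp_Bolzano_Weierstrass[of "{0..1::real}"] by auto
      then have "x islimpt {y. \<bar>g y\<bar> \<le> real n}" by (rule islimpt_subset) simp
      then have "x \<in> A" unfolding A_def by blast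
      then show False using \<open>A = {}\<close> by simp
    qed
    then have "countable (\<Union>n. {y. \<bar>g y\<bar> \<le> real n} \<inter> {0..1})"
      by (intro countable_UN) (auto intro: countable_finite)
    moreover have "{0..1::real} \<subseteq> (\<Union>n. {y. \<bar>g y\<bar> \<le> real n} \<inter> {0..1})"
      using real_arch_simple by auto
    ultimately have "countable {0..1::real}" by (meson countable_subset)
    then show False using uncountable_closed_interval[of 0 1] by simp
  qed
  have "A = UNIV"
  proof (rule ccontr)
    assume "A \<noteq> UNIV"
    obtain a where a: "a \<in> A" using Ane by blast
    define C where "C = connected_component_set A a"
    have C: "connected C" "C \<subseteq> A" "a \<in> C" "open C"
      using a Aopen by (auto simp: C_def connected_component_subset open_connected_component)
    have "frontier C \<noteq> {}"
      using C a \<open>A \<noteq> UNIV\<close> by (metis empty_iff frontier_eq_empty top.extremum_unique)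
    then obtain b where b: "b \<in> frontier C" by blast
    then have "b \<in> frontier A" using frontier_of_connected_component_subset unfolding C_def by blast
    then have bA: "b \<notin> A" using Aopen by (simp add: frontier_def interior_open)
    have bC: "b islimpt C" using b C(4) by (auto simp: frontier_def interior_open closure_def)
    have near: "\<exists>y\<in>C. dist y b < d \<and> \<bar>g y\<bar> > B" if "d > 0" for d B
    proof -
      have "\<not> b islimpt {y. \<bar>g y\<bar> \<le> B}" using bA by (auto simp: A_def)
      then obtain d' where d': "d' > 0" "\<And>y. y \<noteq> b \<Longrightarrow> dist y b < d' \<Longrightarrow> \<not> \<bar>g y\<bar> \<le> B"
        unfolding islimpt_approachable by auto
      have "0 < min d d'" using d' that by simp
      then obtain y where "y \<in> C" "y \<noteq> b" "dist y b < min d d'" using bC unfolding islimpt_approachable by blast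
      then show ?thesis using d'(2)[of y] by (intro bexI[of _ y]) auto
    qed
    \<comment> \<open>Near \<open>b\<close> the values of \<open>g\<close> on \<open>C\<close> form
      an unbounded interval, so two of them differ by exactly the difference of the kinetic energies
      of \<open>v1\<close> and \<open>v2\<close>. At such points \<open>y\<close> and
      \<open>z\<close>, arbitrarily close to \<open>b\<close>, the total energies agree and
      \<open>u z v1 = u y v2\<close>; by continuity the two values at \<open>b\<close>
      coincide.\<close>
    have eq: "u b v1 = u b v2" if v: "v1 > 0" "v2 > 0" for v1 v2
    proof (rule ccontr)
      assume ne: "u b v1 \<noteq> u b v2"
      define \<epsilon> where "\<epsilon> = \<bar>u b v1 - u b v2\<bar> / 2"
      have \<epsilon>: "\<epsilon> > 0" using ne by (simp add: \<epsilon>_def)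
      have "isCont (\<lambda>x. u x v1) b" "isCont (\<lambda>x. u x v2) b"
        using real_analytic_on_isCont[OF u_slice] v by auto
      then obtain d1 d2 where d: "d1 > 0" "\<And>y. dist y b < d1 \<Longrightarrow> dist (u y v1) (u b v1) < \<epsilon>"
        "d2 > 0" "\<And>y. dist y b < d2 \<Longrightarrow> dist (u y v2) (u b v2) < \<epsilon>"
        using \<epsilon> unfolding continuous_at_eps_delta by metis
      define d where "d = min d1 d2"
      have "connected (g ` (C \<inter> ball b d))"
      proof (rule connected_continuous_image)
        show "continuous_on (C \<inter> ball b d) g"
          by (intro continuous_at_imp_continuous_on ballI gA) (use C in auto)
        have "convex C" using C(1) by (simp add: is_interval_connected_1[symmetric] is_interval_convex_1)
        then show "connected (C \<inter> ball b d)" by (intro convex_connected convex_Int convex_ball)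
      qed
      moreover have "\<exists>s\<in>g ` (C \<inter> ball b d). \<bar>s\<bar> > B" for B
        using near[of d B] d by (fastforce simp: d_def dist_commute)
      ultimately obtain t where "t \<in> g ` (C \<inter> ball b d)" "t + (v2\<^sup>2 / 2 - v1\<^sup>2 / 2) \<in> g ` (C \<inter> ball b d)"
        using connected_unbounded_translate by blast
      then obtain y z where yz: "y \<in> ball b d" "z \<in> ball b d" "g z = g y + (v2\<^sup>2 / 2 - v1\<^sup>2 / 2)" by auto
      have "u z v1 = u y v2" using u_F[OF v(1), of z] u_F[OF v(2), of y] yz(3) by (simp add: algebra_simps)
      moreover have "dist (u z v1) (u b v1) < \<epsilon>" "dist (u y v2) (u b v2) < \<epsilon>"
        by (rule d; use yz in \<open>simp add: d_def dist_commute\<close>)+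
      moreover have "dist (u b v1) (u b v2) = 2 * \<epsilon>" by (simp add: \<epsilon>_def dist_real_def)
      moreover have "dist (u b v1) (u b v2) \<le> dist (u z v1) (u b v1) + dist (u z v1) (u b v2)"
        by (metis dist_commute dist_triangle)
      ultimately show False by (metis add_strict_mono leD mult_2)
    qed
    have "F e = u b 1" if e: "e > g b" for e
    proof -
      define v where "v = sqrt (2 * (e - g b))"
      have v: "v > 0" "v\<^sup>2 = 2 * (e - g b)" using e by (simp_all add: v_def)
      have "u b v = F (v\<^sup>2 / 2 + g b)" by (rule u_F[OF v(1)])
      also have "v\<^sup>2 / 2 + g b = e" using v(2) by (simp add: field_simps)
      finally show ?thesis using eq[OF v(1), of 1] by simp
    qed
    then show False using F_not_constant by blast
  qed
  then show ?thesis
    using an by (rule_tac real_analytic_on_singletonI) (metis UNIV_I centre_in_ball empty_subsetI insert_subset real_analytic_on_subset)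
qed

end

section \<open>Integrability near a minimum of the potential\<close>

text \<open>For \<open>v \<ge> r\<close> the map
  \<open>v \<mapsto> sqrt (v\<^sup>2 + r\<^sup>2)\<close> has derivative at least 1/2, which is the
  factor 2, and its value at 1 is at most 1 + r. The limit \<open>2 * R + 2\<close> is common to
  this estimate and the one below the diagonal. For \<open>r \<ge> 1\<close> the range of
  \<open>v\<close> is a null set.\<close>

lemma nn_integral_above_diagonal:
  fixes P :: "real \<Rightarrow> ennreal"
  assumes P: "P \<in> borel_measurable borel" and r: "0 < r" "r \<le> R"
  shows "(\<integral>\<^sup>+v. P (sqrt (v\<^sup>2 + r\<^sup>2)) * indicator {r..1} v \<partial>lborel)
     \<le> 2 * (\<integral>\<^sup>+y. P y * indicator {0..2 * R + 2} y \<partial>lborel)"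
proof (cases "r < 1")
  case True
  define s where "s v = sqrt (v\<^sup>2 + r\<^sup>2)" for v
  define s' where "s' v = v / sqrt (v\<^sup>2 + r\<^sup>2)" for v
  have pos: "v\<^sup>2 + r\<^sup>2 > 0" for v using r by (simp add: add_nonneg_pos)
  have pos': "sqrt (v\<^sup>2 + r\<^sup>2) \<noteq> 0" "v\<^sup>2 + r\<^sup>2 \<noteq> 0" for v using pos[of v] by auto
  have sd: "(s has_real_derivative s' v) (at v)" for v
    unfolding s_def s'_def using pos[of v] by (auto intro!: derivative_eq_intros simp: field_simps)
  have s'c: "continuous_on {r..1} s'" unfolding s'_def by (intro continuous_intros ballI) (use pos' in auto)
  have s'1: "1 \<le> 2 * s' v" if "v \<in> {r..1}" for v
  proof -
    have "r\<^sup>2 \<le> v\<^sup>2" using that r by (intro power_mono) auto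
    moreover have "(2 * v)\<^sup>2 = v\<^sup>2 + v\<^sup>2 + 2 * v\<^sup>2" by (simp add: power_mult_distrib)
    ultimately have "v\<^sup>2 + r\<^sup>2 \<le> (2 * v)\<^sup>2" using zero_le_power2[of v] by linarith
    then have "sqrt (v\<^sup>2 + r\<^sup>2) \<le> 2 * v" using that r by (intro real_le_lsqrt) auto
    then show ?thesis using pos[of v] by (simp add: s'_def field_simps)
  qed
  have sR: "s 1 \<le> 2 * R + 2" "0 \<le> s r"
  proof -
    have "1 + r\<^sup>2 \<le> (1 + r)\<^sup>2" using r by (simp add: power2_eq_square algebra_simps)
    then have "s 1 \<le> 1 + r" unfolding s_def using r by (intro real_le_lsqrt) auto
    then show "s 1 \<le> 2 * R + 2" using r by simp
    show "0 \<le> s r" by (simp add: s_def)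
  qed
  have "(\<integral>\<^sup>+v. P (s v) * indicator {r..1} v \<partial>lborel)
      \<le> (\<integral>\<^sup>+v. 2 * (P (s v) * ennreal (s' v) * indicator {r..1} v) \<partial>lborel)"
  proof (rule nn_integral_mono)
    fix v
    show "P (s v) * indicator {r..1} v \<le> 2 * (P (s v) * ennreal (s' v) * indicator {r..1} v)"
    proof (cases "v \<in> {r..1}")
      case True
      have "s' v \<ge> 0" using s'1[OF True] by simp
      then have "1 \<le> 2 * ennreal (s' v)"
        using s'1[OF True] ennreal_leI[of 1 "2 * s' v"] by (simp add: ennreal_mult)
      then have "P (s v) * 1 \<le> P (s v) * (2 * ennreal (s' v))" by (rule mult_left_mono) simp
      then show ?thesis using True by (simp add: mult_ac)
    qed simp
  qed
  also have "\<dots> = 2 * (\<integral>\<^sup>+v. P (s v) * ennreal (s' v) * indicator {r..1} v \<partial>lborel)"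
  proof (rule nn_integral_cmult)
    have "s \<in> borel_measurable borel" "s' \<in> borel_measurable borel" unfolding s_def s'_def by measurable
    then show "(\<lambda>v. P (s v) * ennreal (s' v) * indicator {r..1} v) \<in> borel_measurable lborel"
      using P by measurable
  qed
  also have "(\<integral>\<^sup>+v. P (s v) * ennreal (s' v) * indicator {r..1} v \<partial>lborel) = (\<integral>\<^sup>+y. P y * indicator {s r..s 1} y \<partial>lborel)"
    by (rule nn_integral_substitution_aux[symmetric]) (use P sd s'c s'1 True in force)+
  also have "\<dots> \<le> (\<integral>\<^sup>+y. P y * indicator {0..2 * R + 2} y \<partial>lborel)"
    using sR by (intro nn_integral_mono mult_left_mono) (auto simp: indicator_def)
  finally show ?thesis unfolding s_def by (simp add: mult_left_mono)
next
  case False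
  have "(\<integral>\<^sup>+v. P (sqrt (v\<^sup>2 + r\<^sup>2)) * indicator {r..1} v \<partial>lborel) = 0"
  proof -
    have "AE v in lborel. v \<noteq> (1::real)" by (rule AE_lborel_singleton)
    then have "AE v in lborel. P (sqrt (v\<^sup>2 + r\<^sup>2)) * indicator {r..1} v = 0"
      by eventually_elim (use False in \<open>auto simp: indicator_def\<close>)
    then show ?thesis by (rule nn_integral_0_iff_AE[THEN iffD2, rotated]) (use P in measurable)
  qed
  then show ?thesis by simp
qed

text \<open>In the substitution \<open>y = c * r t\<close> the hypothesis
  \<open>r t \<le> C * r' t\<close> trades the weight \<open>r t\<close> for the derivative.
  \<open>c \<ge> 1\<close> preserves this inequality and \<open>c \<le> 2\<close> keeps
  \<open>y\<close> below \<open>2 * R\<close>.\<close>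

lemma nn_integral_along_curve:
  fixes P :: "real \<Rightarrow> ennreal"
  assumes P: "P \<in> borel_measurable borel" and eps: "0 < \<epsilon>" "\<epsilon> < \<delta>" and c: "1 \<le> c" "c \<le> 2"
    and r: "\<And>t. t \<in> {\<epsilon>..\<delta>} \<Longrightarrow> 0 < r t" "\<And>t. t \<in> {\<epsilon>..\<delta>} \<Longrightarrow> r t \<le> R"
      "\<And>t. t \<in> {\<epsilon>..\<delta>} \<Longrightarrow> (r has_real_derivative r' t) (at t)" "continuous_on {\<epsilon>..\<delta>} r'"
      "\<And>t. t \<in> {\<epsilon>..\<delta>} \<Longrightarrow> r t \<le> C * r' t"
    and rm: "r \<in> borel_measurable borel" and C: "C > 0"
  shows "(\<integral>\<^sup>+t. ennreal (r t) * P (c * r t) * indicator {\<epsilon>..\<delta>} t \<partial>lborel)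
     \<le> ennreal C * (\<integral>\<^sup>+y. P y * indicator {0..2 * R + 2} y \<partial>lborel)"
proof -
  \<comment> \<open>Cut off to the interval so that it is Borel measurable on the whole line;
    \<open>r'\<close> is controlled only on \<open>{\<epsilon>..\<delta>}\<close>.\<close>
  define r2 where "r2 t = c * r' t * indicator {\<epsilon>..\<delta>} t" for t
  have r'0: "r' t \<ge> 0" if "t \<in> {\<epsilon>..\<delta>}" for t
  proof -
    have "C * r' t > 0" using r(1,5)[OF that] by simp
    then show ?thesis using C by (simp add: zero_less_mult_iff)
  qed
  have m: "r2 \<in> borel_measurable borel"
  proof -
    have "(\<lambda>t. indicator {\<epsilon>..\<delta>} t *\<^sub>R r' t) \<in> borel_measurable borel"
      by (rule borel_measurable_continuous_on_indicator[OF _ r(4)]) simp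
    then have "(\<lambda>t. c * (indicator {\<epsilon>..\<delta>} t *\<^sub>R r' t)) \<in> borel_measurable borel" by measurable
    then show ?thesis unfolding r2_def[abs_def] by (simp add: mult_ac)
  qed
  have "(\<integral>\<^sup>+t. ennreal (r t) * P (c * r t) * indicator {\<epsilon>..\<delta>} t \<partial>lborel)
     \<le> (\<integral>\<^sup>+t. ennreal C * (P (c * r t) * ennreal (r2 t) * indicator {\<epsilon>..\<delta>} t) \<partial>lborel)"
  proof (rule nn_integral_mono)
    fix t
    show "ennreal (r t) * P (c * r t) * indicator {\<epsilon>..\<delta>} t \<le> ennreal C * (P (c * r t) * ennreal (r2 t) * indicator {\<epsilon>..\<delta>} t)"
    proof (cases "t \<in> {\<epsilon>..\<delta>}")
      case True
      have "C * r' t * 1 \<le> C * r' t * c" using C c r'0[OF True] by (intro mult_left_mono) auto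
      then have "r t \<le> C * r2 t" using r(5)[OF True] True by (simp add: r2_def mult_ac)
      then have "ennreal (r t) \<le> ennreal C * ennreal (r2 t)"
        using C c r'0[OF True] by (simp add: ennreal_mult[symmetric] r2_def ennreal_leI)
      then have "ennreal (r t) * P (c * r t) \<le> (ennreal C * ennreal (r2 t)) * P (c * r t)" by (rule mult_right_mono) simp
      then show ?thesis using True by (simp add: mult_ac)
    qed simp
  qed
  also have "\<dots> = ennreal C * (\<integral>\<^sup>+t. P (c * r t) * ennreal (r2 t) * indicator {\<epsilon>..\<delta>} t \<partial>lborel)"
    by (rule nn_integral_cmult) (use P m rm in measurable)
  also have "(\<integral>\<^sup>+t. P (c * r t) * ennreal (r2 t) * indicator {\<epsilon>..\<delta>} t \<partial>lborel)
      = (\<integral>\<^sup>+t. P (c * r t) * ennreal (c * r' t) * indicator {\<epsilon>..\<delta>} t \<partial>lborel)"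
    by (intro nn_integral_cong) (auto simp: r2_def indicator_def)
  also have "\<dots> = (\<integral>\<^sup>+y. P y * indicator {c * r \<epsilon>..c * r \<delta>} y \<partial>lborel)"
  proof (rule nn_integral_substitution_aux[symmetric, where g = "\<lambda>t. c * r t"])
    show "((\<lambda>t. c * r t) has_real_derivative c * r' t) (at t)" if "t \<in> {\<epsilon>..\<delta>}" for t
      using r(3)[OF that] by (rule DERIV_cmult)
    show "continuous_on {\<epsilon>..\<delta>} (\<lambda>t. c * r' t)" by (intro continuous_intros r(4))
    show "0 \<le> c * r' t" if "t \<in> {\<epsilon>..\<delta>}" for t using r'0[OF that] c by simp
  qed (use P eps in auto)
  also have "\<dots> \<le> (\<integral>\<^sup>+y. P y * indicator {0..2 * R + 2} y \<partial>lborel)"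
  proof (intro nn_integral_mono mult_left_mono)
    fix y
    have "0 < c * r \<epsilon>" using r(1)[of \<epsilon>] eps c by simp
    moreover have "c * r \<delta> \<le> 2 * R" using r(1,2)[of \<delta>] eps c by (intro mult_mono) auto
    ultimately show "indicator {c * r \<epsilon>..c * r \<delta>} y \<le> (indicator {0..2 * R + 2} y :: ennreal)" by (auto simp: indicator_def)
  qed simp
  finally show ?thesis by (simp add: mult_left_mono)
qed

text \<open>The Jacobian \<open>r t\<close> of \<open>v = \<tau> * r t\<close> supplies exactly the
  weight of the preceding estimate. After exchanging the integrals it is applied for each
  \<open>\<tau>\<close> with \<open>c = sqrt (1 + \<tau>\<^sup>2)\<close>, and \<open>\<tau>\<close>
  runs through an interval of length 1.\<close>

lemma nn_integral_below_diagonal: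
  fixes P :: "real \<Rightarrow> ennreal"
  assumes P: "P \<in> borel_measurable borel" and eps: "0 < \<epsilon>" "\<epsilon> < \<delta>"
    and r: "\<And>t. t \<in> {\<epsilon>..\<delta>} \<Longrightarrow> 0 < r t" "\<And>t. t \<in> {\<epsilon>..\<delta>} \<Longrightarrow> r t \<le> R"
      "\<And>t. t \<in> {\<epsilon>..\<delta>} \<Longrightarrow> (r has_real_derivative r' t) (at t)" "continuous_on {\<epsilon>..\<delta>} r'"
      "\<And>t. t \<in> {\<epsilon>..\<delta>} \<Longrightarrow> r t \<le> C * r' t"
    and rm [measurable]: "r \<in> borel_measurable borel" and C: "C > 0"
  shows "(\<integral>\<^sup>+t. (\<integral>\<^sup>+v. P (sqrt (v\<^sup>2 + (r t)\<^sup>2)) * indicator {0..r t} v \<partial>lborel) * indicator {\<epsilon>..\<delta>} t \<partial>lborel)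
     \<le> ennreal C * (\<integral>\<^sup>+y. P y * indicator {0..2 * R + 2} y \<partial>lborel)" (is "?L \<le> ?B")
proof -
  note [measurable] = P
  have inner: "(\<integral>\<^sup>+v. P (sqrt (v\<^sup>2 + (r t)\<^sup>2)) * indicator {0..r t} v \<partial>lborel)
      = (\<integral>\<^sup>+\<tau>. ennreal (r t) * P (sqrt (1 + \<tau>\<^sup>2) * r t) * indicator {0..1} \<tau> \<partial>lborel)" if t: "t \<in> {\<epsilon>..\<delta>}" for t
  proof -
    have rp: "r t > 0" by (rule r(1)[OF t])
    have "(\<integral>\<^sup>+v. P (sqrt (v\<^sup>2 + (r t)\<^sup>2)) * indicator {0..r t} v \<partial>lborel)
      = ennreal \<bar>r t\<bar> * (\<integral>\<^sup>+\<tau>. P (sqrt ((0 + r t * \<tau>)\<^sup>2 + (r t)\<^sup>2)) * indicator {0..r t} (0 + r t * \<tau>) \<partial>lborel)"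
      by (rule nn_integral_real_affine) (use rp in simp_all)
    also have "\<dots> = ennreal (r t) * (\<integral>\<^sup>+\<tau>. P (sqrt (1 + \<tau>\<^sup>2) * r t) * indicator {0..1} \<tau> \<partial>lborel)"
    proof -
      have "sqrt ((0 + r t * \<tau>)\<^sup>2 + (r t)\<^sup>2) = sqrt (1 + \<tau>\<^sup>2) * r t" for \<tau>
      proof -
        have "(0 + r t * \<tau>)\<^sup>2 + (r t)\<^sup>2 = (1 + \<tau>\<^sup>2) * (r t)\<^sup>2" by (simp add: algebra_simps power2_eq_square)
        then show ?thesis using rp by (simp add: real_sqrt_mult)
      qed
      moreover have "indicator {0..r t} (0 + r t * \<tau>) = (indicator {0..1} \<tau> :: ennreal)" for \<tau>
        using rp by (auto simp: indicator_def zero_le_mult_iff mult_le_cancel_left1)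
      ultimately show ?thesis using rp by simp
    qed
    also have "\<dots> = (\<integral>\<^sup>+\<tau>. ennreal (r t) * (P (sqrt (1 + \<tau>\<^sup>2) * r t) * indicator {0..1} \<tau>) \<partial>lborel)"
      by (rule nn_integral_cmult[symmetric]) measurable
    finally show ?thesis by (simp add: mult.assoc)
  qed
  have "?L = (\<integral>\<^sup>+t. (\<integral>\<^sup>+\<tau>. ennreal (r t) * P (sqrt (1 + \<tau>\<^sup>2) * r t) * indicator {\<epsilon>..\<delta>} t * indicator {0..1} \<tau> \<partial>lborel) \<partial>lborel)"
  proof (rule nn_integral_cong)
    fix t
    show "(\<integral>\<^sup>+v. P (sqrt (v\<^sup>2 + (r t)\<^sup>2)) * indicator {0..r t} v \<partial>lborel) * indicator {\<epsilon>..\<delta>} t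
      = (\<integral>\<^sup>+\<tau>. ennreal (r t) * P (sqrt (1 + \<tau>\<^sup>2) * r t) * indicator {\<epsilon>..\<delta>} t * indicator {0..1} \<tau> \<partial>lborel)"
      using inner[of t] by (cases "t \<in> {\<epsilon>..\<delta>}") simp_all
  qed
  also have "\<dots> = (\<integral>\<^sup>+\<tau>. (\<integral>\<^sup>+t. ennreal (r t) * P (sqrt (1 + \<tau>\<^sup>2) * r t) * indicator {\<epsilon>..\<delta>} t * indicator {0..1} \<tau> \<partial>lborel) \<partial>lborel)"
    by (rule lborel_pair.Fubini'[symmetric]) measurable
  also have "\<dots> \<le> (\<integral>\<^sup>+\<tau>. ?B * indicator {0..1::real} \<tau> \<partial>lborel)"
  proof (rule nn_integral_mono)
    fix \<tau> :: real
    show "(\<integral>\<^sup>+t. ennreal (r t) * P (sqrt (1 + \<tau>\<^sup>2) * r t) * indicator {\<epsilon>..\<delta>} t * indicator {0..1} \<tau> \<partial>lborel) \<le> ?B * indicator {0..1} \<tau>"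
    proof (cases "\<tau> \<in> {0..1}")
      case True
      have "\<tau>\<^sup>2 \<le> 1" using True by (simp add: power_le_one)
      then have c: "1 \<le> sqrt (1 + \<tau>\<^sup>2)" "sqrt (1 + \<tau>\<^sup>2) \<le> 2" by (auto intro!: real_le_lsqrt)
      show ?thesis using nn_integral_along_curve[OF P eps c r rm C] True by simp
    qed simp
  qed
  also have "\<dots> = ?B" by (subst nn_integral_cmult_indicator) simp_all
  finally show ?thesis .
qed

text \<open>Near a minimum the integrand is split along \<open>v = r t\<close>: above the diagonal substitute
  \<open>y = sqrt (v\<^sup>2 + r\<^sup>2)\<close> for \<open>v\<close>, below it put \<open>v = \<tau> * r t\<close> and substitute \<open>y = sqrt (1 + \<tau>\<^sup>2) * r t\<close> for \<open>t\<close>.\<close>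

lemma nn_integral_quadrant:
  fixes P :: "real \<Rightarrow> ennreal" and a a' :: "real \<Rightarrow> real"
  assumes P [measurable]: "P \<in> borel_measurable borel" and \<delta>: "0 < \<delta>"
    and a: "continuous_on UNIV a" "\<And>t. 0 < t \<Longrightarrow> t \<le> \<delta> \<Longrightarrow> 0 < a t" "\<And>t. t \<in> {0..\<delta>} \<Longrightarrow> a t \<le> A"
      "\<And>t. 0 < t \<Longrightarrow> t \<le> \<delta> \<Longrightarrow> (a has_real_derivative a' t) (at t)" "continuous_on {0<..\<delta>} a'"
      "\<And>t. 0 < t \<Longrightarrow> t \<le> \<delta> \<Longrightarrow> a t \<le> C * a' t"
    and C: "C > 0" and fin: "\<And>Y. (\<integral>\<^sup>+y. P y * indicator {0..Y} y \<partial>lborel) < \<infinity>"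
  shows "(\<integral>\<^sup>+t. (\<integral>\<^sup>+v. P (sqrt (v\<^sup>2 + 2 * a t)) * indicator {0..1} v \<partial>lborel) * indicator {0..\<delta>} t \<partial>lborel) < \<infinity>"
proof -
  define r where "r t = sqrt (2 * a t)" for t
  define R where "R = sqrt (2 * A)"
  have rc: "continuous_on UNIV r" unfolding r_def by (intro continuous_intros a(1))
  have rm [measurable]: "r \<in> borel_measurable borel" by (rule borel_measurable_continuous_onI[OF rc])
  have r2: "(r t)\<^sup>2 = 2 * a t" if "0 < t" "t \<le> \<delta>" for t using a(2)[OF that] by (simp add: r_def)
  have rpos: "r t > 0" if "0 < t" "t \<le> \<delta>" for t using a(2)[OF that] by (simp add: r_def)
  have rR: "r t \<le> R" if "0 < t" "t \<le> \<delta>" for t using a(3)[of t] that by (simp add: r_def R_def)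
  define J where "J = (\<integral>\<^sup>+y. P y * indicator {0..2 * R + 2} y \<partial>lborel)"
  have J: "J < \<infinity>" unfolding J_def by (rule fin)
  define N where "N t = (\<integral>\<^sup>+v. P (sqrt (v\<^sup>2 + (r t)\<^sup>2)) * indicator {0..1} v \<partial>lborel)" for t
  have Nm [measurable]: "N \<in> borel_measurable borel" unfolding N_def[abs_def] by measurable
  define D where "D = ennreal \<delta> * (2 * J) + ennreal (2 * C) * J"
  have bound: "(\<integral>\<^sup>+t. N t * indicator {\<epsilon>..\<delta>} t \<partial>lborel) \<le> D" if eps: "0 < \<epsilon>" "\<epsilon> < \<delta>" for \<epsilon>
  proof -
    define N1 where "N1 t = (\<integral>\<^sup>+v. P (sqrt (v\<^sup>2 + (r t)\<^sup>2)) * indicator {r t..1} v \<partial>lborel)" for t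
    define N2 where "N2 t = (\<integral>\<^sup>+v. P (sqrt (v\<^sup>2 + (r t)\<^sup>2)) * indicator {0..r t} v \<partial>lborel)" for t
    have N1m [measurable]: "N1 \<in> borel_measurable borel" unfolding N1_def[abs_def] indicator_def[abs_def] atLeastAtMost_iff by measurable
    have N2m [measurable]: "N2 \<in> borel_measurable borel" unfolding N2_def[abs_def] indicator_def[abs_def] atLeastAtMost_iff by measurable
    have N12: "N t \<le> N1 t + N2 t" for t
    proof -
      have "N t \<le> (\<integral>\<^sup>+v. P (sqrt (v\<^sup>2 + (r t)\<^sup>2)) * indicator {r t..1} v + P (sqrt (v\<^sup>2 + (r t)\<^sup>2)) * indicator {0..r t} v \<partial>lborel)"
        unfolding N_def by (rule nn_integral_mono) (auto simp: indicator_def)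
      also have "\<dots> = N1 t + N2 t" unfolding N1_def N2_def by (rule nn_integral_add) measurable
      finally show ?thesis .
    qed
    have "(\<integral>\<^sup>+t. N t * indicator {\<epsilon>..\<delta>} t \<partial>lborel) \<le> (\<integral>\<^sup>+t. N1 t * indicator {\<epsilon>..\<delta>} t + N2 t * indicator {\<epsilon>..\<delta>} t \<partial>lborel)"
      by (rule nn_integral_mono) (use N12 in \<open>auto simp: indicator_def\<close>)
    also have "\<dots> = (\<integral>\<^sup>+t. N1 t * indicator {\<epsilon>..\<delta>} t \<partial>lborel) + (\<integral>\<^sup>+t. N2 t * indicator {\<epsilon>..\<delta>} t \<partial>lborel)"
      by (rule nn_integral_add) measurable
    also have "\<dots> \<le> ennreal \<delta> * (2 * J) + ennreal (2 * C) * J"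
    proof (rule add_mono)
      have "(\<integral>\<^sup>+t. N1 t * indicator {\<epsilon>..\<delta>} t \<partial>lborel) \<le> (\<integral>\<^sup>+t. 2 * J * indicator {0..\<delta>} t \<partial>lborel)"
      proof (rule nn_integral_mono)
        fix t
        show "N1 t * indicator {\<epsilon>..\<delta>} t \<le> 2 * J * indicator {0..\<delta>} t"
        proof (cases "t \<in> {\<epsilon>..\<delta>}")
          case True
          then have "0 < t" "t \<le> \<delta>" using eps by auto
          then have "N1 t \<le> 2 * J" unfolding N1_def J_def
            by (intro nn_integral_above_diagonal P rpos rR)
          then show ?thesis using True eps by simp
        qed simp
      qed
      also have "\<dots> = 2 * J * ennreal \<delta>" using \<delta> by (simp add: nn_integral_cmult_indicator)
      finally show "(\<integral>\<^sup>+t. N1 t * indicator {\<epsilon>..\<delta>} t \<partial>lborel) \<le> ennreal \<delta> * (2 * J)" by (simp add: mult.commute)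
      show "(\<integral>\<^sup>+t. N2 t * indicator {\<epsilon>..\<delta>} t \<partial>lborel) \<le> ennreal (2 * C) * J"
        unfolding N2_def J_def
      proof (rule nn_integral_below_diagonal[OF P eps, where r' = "\<lambda>t. a' t / r t"])
        fix t assume "t \<in> {\<epsilon>..\<delta>}"
        then have t: "0 < t" "t \<le> \<delta>" using eps by auto
        show "0 < r t" "r t \<le> R" using rpos[OF t] rR[OF t] by auto
        show "(r has_real_derivative a' t / r t) (at t)"
          unfolding r_def[abs_def] using a(2)[OF t] a(4)[OF t]
          by (auto intro!: derivative_eq_intros simp: field_simps)
        \<comment> \<open>Since \<open>(r t)\<^sup>2 = 2 * a t\<close> and
          \<open>r' = a' / r\<close>, the bound \<open>a \<le> C * a'\<close> becomes
          \<open>r \<le> 2 * C * r'\<close>: passing to the square root doubles the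
          constant.\<close>
        have "r t * r t \<le> 2 * C * a' t" using r2[OF t] a(6)[OF t] by (simp add: power2_eq_square)
        then show "r t \<le> 2 * C * (a' t / r t)" using rpos[OF t] by (simp add: field_simps)
      next
        show "continuous_on {\<epsilon>..\<delta>} (\<lambda>t. a' t / r t)"
        proof (intro continuous_intros ballI)
          show "continuous_on {\<epsilon>..\<delta>} a'" by (rule continuous_on_subset[OF a(5)]) (use eps in auto)
          show "continuous_on {\<epsilon>..\<delta>} r" using rc continuous_on_subset by blast
          show "r t \<noteq> 0" if "t \<in> {\<epsilon>..\<delta>}" for t using rpos[of t] that eps by auto
        qed
      qed (use C rm in auto)
    qed
    finally show ?thesis unfolding D_def .
  qed
  \<comment> \<open>The end point t = 0, where \<open>r\<close> may vanish, is approached from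
    inside; \<open>n + 2\<close> keeps \<open>e n\<close> strictly below \<open>\<delta>\<close>
    from the start. The bound \<open>D\<close> does not depend on \<open>n\<close>, so monotone
    convergence applies.\<close>
  define e where "e n = \<delta> / real (n + 2)" for n
  have e: "0 < e n" "e n < \<delta>" for n using \<delta> by (auto simp: e_def field_simps add_pos_nonneg)
  have "(\<integral>\<^sup>+t. N t * indicator {0<..\<delta>} t \<partial>lborel) = (\<integral>\<^sup>+t. (SUP n. N t * indicator {e n..\<delta>} t) \<partial>lborel)"
  proof (rule nn_integral_cong)
    fix t
    show "N t * indicator {0<..\<delta>} t = (SUP n. N t * indicator {e n..\<delta>} t)"
    proof (rule antisym)
      show "(SUP n. N t * indicator {e n..\<delta>} t) \<le> N t * indicator {0<..\<delta>} t"
        by (rule SUP_least, rule mult_left_mono) (use e(1) in \<open>auto simp: indicator_def dest: less_le_trans\<close>)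
      show "N t * indicator {0<..\<delta>} t \<le> (SUP n. N t * indicator {e n..\<delta>} t)"
      proof (cases "t \<in> {0<..\<delta>}")
        case True
        obtain n :: nat where "\<delta> / t < real n" using reals_Archimedean2 by blast
        then have "\<delta> < real n * t" using True by (simp add: field_simps)
        also have "\<dots> \<le> real (n + 2) * t" using True by (intro mult_right_mono) auto
        finally have "e n \<le> t" by (simp add: e_def field_simps)
        then show ?thesis using True by (intro SUP_upper2[of n]) auto
      qed simp
    qed
  qed
  also have "\<dots> = (SUP n. \<integral>\<^sup>+t. N t * indicator {e n..\<delta>} t \<partial>lborel)"
  proof (rule nn_integral_monotone_convergence_SUP)
    show "incseq (\<lambda>n t. N t * indicator {e n..\<delta>} t)"
    proof (intro incseq_SucI le_funI mult_left_mono)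
      fix n t
      have "e (Suc n) \<le> e n" using \<delta> by (simp add: e_def field_simps)
      then show "indicator {e n..\<delta>} t \<le> (indicator {e (Suc n)..\<delta>} t :: ennreal)" by (auto simp: indicator_def)
    qed simp
  qed measurable
  also have "\<dots> \<le> D" by (rule SUP_least) (rule bound[OF e])
  also have "D < \<infinity>" using J by (simp add: D_def ennreal_mult_less_top)
  finally have "(\<integral>\<^sup>+t. N t * indicator {0<..\<delta>} t \<partial>lborel) < \<infinity>" .
  moreover have "(\<integral>\<^sup>+t. (\<integral>\<^sup>+v. P (sqrt (v\<^sup>2 + 2 * a t)) * indicator {0..1} v \<partial>lborel) * indicator {0..\<delta>} t \<partial>lborel)
     = (\<integral>\<^sup>+t. N t * indicator {0<..\<delta>} t \<partial>lborel)"
  proof (rule nn_integral_cong_AE)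
    have "AE t in lborel. t \<noteq> (0::real)" by (rule AE_lborel_singleton)
    then show "AE t in lborel. (\<integral>\<^sup>+v. P (sqrt (v\<^sup>2 + 2 * a t)) * indicator {0..1} v \<partial>lborel) * indicator {0..\<delta>} t = N t * indicator {0<..\<delta>} t"
      by eventually_elim (use r2 in \<open>auto simp: N_def indicator_def\<close>)
  qed
  ultimately show ?thesis by simp
qed

section \<open>Weak stationarity of differentiable data\<close>

lemma nn_integral_compact_finite:
  fixes k :: "'a::euclidean_space \<Rightarrow> ennreal"
  assumes [measurable]: "k \<in> borel_measurable borel"
    and loc: "\<And>p. \<exists>T. open T \<and> p \<in> T \<and> (\<integral>\<^sup>+q. k q * indicator T q \<partial>lborel) < \<infinity>"
    and K: "compact K"
  shows "(\<integral>\<^sup>+q. k q * indicator K q \<partial>lborel) < \<infinity>"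
proof -
  obtain T where T: "\<And>p. open (T p)" "\<And>p. p \<in> T p" "\<And>p. (\<integral>\<^sup>+q. k q * indicator (T p) q \<partial>lborel) < \<infinity>"
    using loc by metis
  obtain C where C: "C \<subseteq> K" "finite C" "K \<subseteq> (\<Union>p\<in>C. T p)"
    by (rule compactE_image[OF K, of K T]) (use T in auto)
  have Tm: "T p \<in> sets borel" for p using T(1) by (rule borel_open)
  have em: "emeasure (density lborel k) S = (\<integral>\<^sup>+q. k q * indicator S q \<partial>lborel)" if "S \<in> sets borel" for S
    by (rule emeasure_density) (use that in auto)
  have "emeasure (density lborel k) K \<le> emeasure (density lborel k) (\<Union>p\<in>C. T p)"
    by (rule emeasure_mono[OF C(3)]) (use Tm C(2) in auto)
  also have "\<dots> \<le> (\<Sum>p\<in>C. emeasure (density lborel k) (T p))"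
    by (rule emeasure_subadditive_finite) (use C(2) Tm in auto)
  also have "\<dots> < \<infinity>" using C(2) T(3) em[OF Tm] by (simp add: sum_Pinfty)
  finally show ?thesis using em[OF borel_compact[OF K]] by simp
qed

lemma integrable_continuous_box:
  fixes k :: "real \<times> real \<Rightarrow> real"
  assumes k: "continuous_on UNIV k" and out: "\<And>p. p \<notin> {-M..M} \<times> {-M..M} \<Longrightarrow> k p = 0"
  shows "integrable lborel k"
proof -
  have "integrable lborel (\<lambda>p. indicator ({-M..M} \<times> {-M..M}) p *\<^sub>R k p)"
    by (rule borel_integrable_compact) (use k in \<open>auto intro: compact_Times continuous_on_subset\<close>)
  then show ?thesis
    by (rule Bochner_Integration.integrable_cong[THEN iffD1, rotated -1]) (use out in \<open>auto simp: indicator_def\<close>)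
qed

lemma integral_deriv_compact_support:
  fixes k k' :: "real \<Rightarrow> real"
  assumes d: "\<And>v. (k has_real_derivative k' v) (at v)" and c: "continuous_on UNIV k'"
    and out: "\<And>v. v \<notin> {-M..M} \<Longrightarrow> k v = 0" "\<And>v. v \<notin> {-M..M} \<Longrightarrow> k' v = 0"
  shows "(LINT v|lborel. k' v) = 0"
proof -
  define B where "B = \<bar>M\<bar> + 1"
  have sub: "v \<notin> {-B..B} \<Longrightarrow> v \<notin> {-M..M}" for v by (auto simp: B_def)
  have "(LINT v|lborel. k' v) = (LINT v|lborel. indicator {-B..B} v *\<^sub>R k' v)"
    by (intro Bochner_Integration.integral_cong) (use out sub in \<open>auto simp: indicator_def\<close>)
  also have "\<dots> = k B - k (- B)"
  proof (rule integral_FTC_atLeastAtMost)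
    show "(k has_vector_derivative k' v) (at v within {-B..B})" for v
      using d by (simp add: has_real_derivative_iff_has_vector_derivative has_vector_derivative_at_within)
    show "continuous_on {-B..B} k'" using c continuous_on_subset by blast
  qed (simp add: B_def)
  also have "k B - k (- B) = 0"
  proof -
    have "B \<notin> {-M..M}" "- B \<notin> {-M..M}" by (auto simp: B_def)
    then show ?thesis using out(1) by simp
  qed
  finally show ?thesis .
qed

lemma continuous_on_slices:
  fixes k :: "real \<times> real \<Rightarrow> real"
  assumes "continuous_on UNIV k"
  shows "continuous_on UNIV (\<lambda>v. k (x, v))" "continuous_on UNIV (\<lambda>y. k (y, v))"
  by (rule continuous_on_compose2[OF assms], auto intro!: continuous_intros)+

lemma integral_partial_snd_zero:
  fixes k kv :: "real \<times> real \<Rightarrow> real"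
  assumes d: "\<And>x v. ((\<lambda>v. k (x, v)) has_real_derivative kv (x, v)) (at v)" and c: "continuous_on UNIV kv"
    and out: "\<And>p. p \<notin> {-M..M} \<times> {-M..M} \<Longrightarrow> k p = 0" "\<And>p. p \<notin> {-M..M} \<times> {-M..M} \<Longrightarrow> kv p = 0"
  shows "(LINT p|lborel. kv p) = 0"
proof -
  have i: "integrable lborel kv" by (rule integrable_continuous_box[OF c out(2)])
  have "(LINT v|lborel. kv (x, v)) = 0" for x
    by (rule integral_deriv_compact_support[OF d, of _ M]) (use out continuous_on_slices[OF c] in auto)
  then show ?thesis
    using lborel_pair.integral_fst'[of kv] i by (simp add: lborel_prod)
qed

lemma integral_partial_fst_zero:
  fixes k kx :: "real \<times> real \<Rightarrow> real"
  assumes d: "\<And>x v. ((\<lambda>x. k (x, v)) has_real_derivative kx (x, v)) (at x)" and c: "continuous_on UNIV kx"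
    and out: "\<And>p. p \<notin> {-M..M} \<times> {-M..M} \<Longrightarrow> k p = 0" "\<And>p. p \<notin> {-M..M} \<times> {-M..M} \<Longrightarrow> kx p = 0"
  shows "(LINT p|lborel. kx p) = 0"
proof -
  have i: "integrable lborel kx" by (rule integrable_continuous_box[OF c out(2)])
  have "(LINT x|lborel. kx (x, v)) = 0" for v
    by (rule integral_deriv_compact_support[of "\<lambda>x. k (x, v)", OF d, of M]) (use out continuous_on_slices[OF c] in auto)
  then show ?thesis
    using lborel_pair.integral_snd[of "\<lambda>x v. kx (x, v)"] i by (simp add: lborel_prod)
qed

abbreviation dx_test :: "(real \<times> real \<Rightarrow> real) \<Rightarrow> real \<times> real \<Rightarrow> real" where
  "dx_test \<psi> p \<equiv> frechet_derivative \<psi> (at p) (1, 0)"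

abbreviation dv_test :: "(real \<times> real \<Rightarrow> real) \<Rightarrow> real \<times> real \<Rightarrow> real" where
  "dv_test \<psi> p \<equiv> frechet_derivative \<psi> (at p) (0, 1)"

lemma test_fun2_props:
  fixes \<psi> :: "real \<times> real \<Rightarrow> real"
  assumes "test_fun \<psi>"
  shows "continuous_on UNIV \<psi>" "continuous_on UNIV (dx_test \<psi>)" "continuous_on UNIV (dv_test \<psi>)"
    "((\<lambda>x. \<psi> (x, v)) has_real_derivative dx_test \<psi> (x, v)) (at x)"
    "((\<lambda>v. \<psi> (x, v)) has_real_derivative dv_test \<psi> (x, v)) (at v)"
    "\<exists>M>0. \<forall>p. p \<notin> {-M..M} \<times> {-M..M} \<longrightarrow> \<psi> p = 0 \<and> dx_test \<psi> p = 0 \<and> dv_test \<psi> p = 0"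
proof -
  have C: "C_order k \<psi>" for k using assms by (simp add: test_fun_def)
  have D: "(\<psi> has_derivative frechet_derivative \<psi> (at p)) (at p)" for p by (rule C_order_SucD(1)[OF C])
  have lin: "linear (frechet_derivative \<psi> (at p))" for p using D has_derivative_linear by blast
  show "continuous_on UNIV \<psi>" by (rule C_order_continuous[OF C])
  show "continuous_on UNIV (dx_test \<psi>)" "continuous_on UNIV (dv_test \<psi>)"
    by (rule C_order_continuous[OF C_order_SucD(2)[OF C[of "Suc 0"]]]; simp add: Basis_prod_def)+
  have "((\<lambda>x. (x, v)) has_derivative (\<lambda>h. (h, 0))) (at x)" by (auto intro!: derivative_eq_intros)
  from has_derivative_compose[OF this D]
  show "((\<lambda>x. \<psi> (x, v)) has_real_derivative dx_test \<psi> (x, v)) (at x)"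
  proof (unfold has_field_derivative_def, elim has_derivative_eq_rhs, intro ext)
    fix h
    show "frechet_derivative \<psi> (at (x, v)) (h, 0) = dx_test \<psi> (x, v) * h"
      using linear_cmul[OF lin, of "(x, v)" h "(1, 0)"] by (simp add: mult.commute)
  qed
  have "((\<lambda>v. (x, v)) has_derivative (\<lambda>h. (0, h))) (at v)" by (auto intro!: derivative_eq_intros)
  from has_derivative_compose[OF this D]
  show "((\<lambda>v. \<psi> (x, v)) has_real_derivative dv_test \<psi> (x, v)) (at v)"
  proof (unfold has_field_derivative_def, elim has_derivative_eq_rhs, intro ext)
    fix h
    show "frechet_derivative \<psi> (at (x, v)) (0, h) = dv_test \<psi> (x, v) * h"
      using linear_cmul[OF lin, of "(x, v)" h "(0, 1)"] by (simp add: mult.commute)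
  qed
  obtain M where M: "M > 0" "\<And>p. \<psi> p \<noteq> 0 \<Longrightarrow> norm p \<le> M" using test_fun_support[OF assms] by metis
  have out: "\<psi> p = 0" if "p \<notin> {-M..M} \<times> {-M..M}" for p
  proof (rule ccontr)
    assume "\<psi> p \<noteq> 0"
    then have "norm p \<le> M" by (rule M(2))
    then have "\<bar>fst p\<bar> \<le> M" "\<bar>snd p\<bar> \<le> M"
      using norm_fst_le[of "fst p" "snd p"] norm_snd_le[of "snd p" "fst p"] by auto
    then show False using that by (cases p) (auto simp: abs_le_iff)
  qed
  have "frechet_derivative \<psi> (at p) = (\<lambda>_. 0)" if "p \<notin> {-M..M} \<times> {-M..M}" for p
  proof -
    have "((\<lambda>_. 0) has_derivative (\<lambda>_. 0)) (at p)" by simp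
    then have "(\<psi> has_derivative (\<lambda>_. 0)) (at p)"
      by (rule has_derivative_transform_within_open[where s = "- ({-M..M} \<times> {-M..M})"])
         (use out that in \<open>auto intro!: closed_Times\<close>)
    then show ?thesis using frechet_derivative_at by metis
  qed
  then show "\<exists>M>0. \<forall>p. p \<notin> {-M..M} \<times> {-M..M} \<longrightarrow> \<psi> p = 0 \<and> dx_test \<psi> p = 0 \<and> dv_test \<psi> p = 0"
    using out M(1) by (intro exI[of _ M]) auto
qed

lemma bounded_on_box:
  fixes k :: "real \<times> real \<Rightarrow> real"
  assumes "continuous_on UNIV k"
  obtains D where "D \<ge> 0" "\<And>p. p \<in> {-M..M} \<times> {-M..M} \<Longrightarrow> \<bar>k p\<bar> \<le> D"
proof -
  have "bounded (k ` ({-M..M} \<times> {-M..M}))"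
    by (intro compact_imp_bounded compact_continuous_image continuous_on_subset[OF assms] compact_Times) auto
  then obtain D where D: "\<forall>p\<in>{-M..M} \<times> {-M..M}. \<bar>k p\<bar> \<le> D" unfolding bounded_iff by auto
  show ?thesis by (rule that[of "max 0 D"]) (use D in force)+
qed

context analytic_density
begin

lemma L1_locI:
  assumes "\<And>p. \<exists>T. open T \<and> p \<in> T \<and> (\<integral>\<^sup>+q. ennreal \<bar>f0 q\<bar> * indicator T q \<partial>lborel) < \<infinity>"
  shows "L1_loc f"
  unfolding L1_loc_def set_integrable_def
proof (intro allI impI)
  fix K :: "(real \<times> real) set" assume K: "compact K"
  have Km [measurable]: "K \<in> sets borel" by (rule borel_compact[OF K])
  have "(\<integral>\<^sup>+q. ennreal \<bar>f0 q\<bar> * indicator K q \<partial>lborel) < \<infinity>"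
    by (rule nn_integral_compact_finite[OF _ assms K]) measurable
  also have "(\<integral>\<^sup>+q. ennreal \<bar>f0 q\<bar> * indicator K q \<partial>lborel) = (\<integral>\<^sup>+q. ennreal (norm (indicator K q * f0 q)) \<partial>lborel)"
    by (intro nn_integral_cong) (auto simp: indicator_def)
  finally have "integrable lborel (\<lambda>q. indicator K q * f0 q)"
    by (intro integrableI_bounded) measurable
  then have "integrable lebesgue (\<lambda>q. indicator K q * f0 q)" by (subst integrable_completion) measurable
  moreover have "AE q in lebesgue. indicator K q * f0 q = indicator K q *\<^sub>R f q"
    using AE_completion[OF AE_f0_2d] by eventually_elim simp
  moreover have "(\<lambda>q. indicator K q *\<^sub>R f q) \<in> borel_measurable lebesgue"
  proof (rule borel_measurable_AE[OF _ \<open>AE q in lebesgue. indicator K q * f0 q = indicator K q *\<^sub>R f q\<close>])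
    show "(\<lambda>q. indicator K q * f0 q) \<in> borel_measurable lebesgue" by (rule measurable_completion) measurable
  qed
  ultimately show "integrable lebesgue (\<lambda>q. indicator K q *\<^sub>R f q)"
    using integrable_cong_AE_imp by blast
qed

lemma f0_mult_integrable:
  assumes L1: "L1_loc f" and T: "continuous_on UNIV T" "\<And>p. p \<notin> {-M..M} \<times> {-M..M} \<Longrightarrow> T p = 0"
  shows "integrable lborel (\<lambda>p. f0 p * T p)"
proof -
  obtain D where D: "D \<ge> 0" "\<And>p. p \<in> {-M..M} \<times> {-M..M} \<Longrightarrow> \<bar>T p\<bar> \<le> D" using bounded_on_box[OF T(1)] by blast
  note [measurable] = borel_measurable_continuous_onI[OF T(1)]
  show ?thesis
  proof (rule Bochner_Integration.integrable_bound[OF integrable_mult_right[OF f0_box_integrable[OF L1, of M], of D]])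
    show "AE p in lborel. norm (f0 p * T p) \<le> norm (D * (indicator ({-M..M} \<times> {-M..M}) p * f0 p))"
    proof (intro AE_I2)
      fix p
      show "norm (f0 p * T p) \<le> norm (D * (indicator ({-M..M} \<times> {-M..M}) p * f0 p))"
      proof (cases "p \<in> {-M..M} \<times> {-M..M}")
        case True
        have "\<bar>T p\<bar> * \<bar>f0 p\<bar> \<le> D * \<bar>f0 p\<bar>" by (rule mult_right_mono[OF D(2)[OF True]]) simp
        then show ?thesis using True D(1) by (simp add: abs_mult mult.commute)
      qed (simp add: T(2))
    qed
  qed measurable
qed

text \<open>A continuously differentiable potential has its classical derivative as weak derivative,
  and the equation may be tested with the Borel version \<open>f0\<close> and Borel
  integrals.\<close>

lemma weak_stationaryI:
  assumes L1: "L1_loc f" and gd: "\<And>x. (potential \<Phi> f has_real_derivative g' x) (at x)"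
    and g'c: "continuous_on UNIV g'"
    and weak: "\<And>\<psi>. test_fun \<psi> \<Longrightarrow> (LINT p|lborel. f0 p * (g' (fst p) * dv_test \<psi> p - snd p * dx_test \<psi> p)) = 0"
  shows "weak_stationary_state \<Phi> f"
  unfolding weak_stationary_state_def
proof (intro conjI exI[of _ g'] allI impI)
  let ?g = "potential \<Phi> f"
  have gc: "continuous_on UNIV ?g" using DERIV_isCont[OF gd] by (simp add: continuous_on_eq_continuous_at)
  show "L1_loc f" by fact
  show "AE x in lebesgue. integrable lebesgue (\<lambda>v. f (x, v))" using f_integrable by simp
  have Linf: "Linf_loc k" if k: "continuous_on UNIV k" for k :: "real \<Rightarrow> real"
    unfolding Linf_loc_def
  proof (intro conjI allI impI)
    show "k \<in> borel_measurable lebesgue"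
      by (rule measurable_completion) (use borel_measurable_continuous_onI[OF k] in simp)
    fix K :: "real set" assume "compact K"
    then have "bounded (k ` K)" by (intro compact_imp_bounded compact_continuous_image continuous_on_subset[OF k]) auto
    then obtain B where "\<forall>p\<in>K. \<bar>k p\<bar> \<le> B" unfolding bounded_iff by auto
    then show "\<exists>B. AE p in lebesgue. p \<in> K \<longrightarrow> \<bar>k p\<bar> \<le> B" by (intro exI[of _ B] AE_I2) auto
  qed
  show "W1inf_loc ?g g'"
    unfolding W1inf_loc_def weak_derivative_def
  proof (intro conjI Linf gc g'c allI impI)
    fix \<psi> :: "real \<Rightarrow> real" assume \<psi>: "test_fun \<psi>"
    note [measurable] = test_fun_measurable[OF \<psi>] borel_measurable_continuous_onI[OF gc] borel_measurable_continuous_onI[OF g'c]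
    have C: "C_order k \<psi>" for k using \<psi> by (simp add: test_fun_def)
    have cc: "continuous_on UNIV \<psi>" "continuous_on UNIV (deriv \<psi>)"
      by (rule C_order_continuous[OF C], rule C_order_continuous[OF C_order_real_deriv(2)[OF C, of 0]])
    obtain M B where M: "M > 0" "\<And>v. v \<notin> {-M..M} \<Longrightarrow> \<psi> v = 0" "\<And>v. v \<notin> {-M..M} \<Longrightarrow> deriv \<psi> v = 0"
      using test_fun_bounds[OF \<psi>] by metis
    have int: "integrable lborel k" if "continuous_on UNIV k" "\<And>v. v \<notin> {-M..M} \<Longrightarrow> k v = 0" for k :: "real \<Rightarrow> real"
    proof -
      have "set_integrable lborel {-M..M} k" using borel_integrable_atLeastAtMost' that(1) continuous_on_subset by blast
      then show ?thesis unfolding set_integrable_def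
        by (rule Bochner_Integration.integrable_cong[THEN iffD1, rotated -1]) (use that(2) in \<open>auto simp: indicator_def\<close>)
    qed
    have i: "integrable lborel (\<lambda>x. ?g x * deriv \<psi> x)" "integrable lborel (\<lambda>x. g' x * \<psi> x)"
      by (rule int; use M in \<open>auto intro!: continuous_intros gc g'c cc\<close>)+
    have "(LINT x|lborel. ?g x * deriv \<psi> x + g' x * \<psi> x) = 0"
    proof (rule integral_deriv_compact_support[where M = M and k = "\<lambda>x. ?g x * \<psi> x"])
      show "((\<lambda>x. ?g x * \<psi> x) has_real_derivative ?g v * deriv \<psi> v + g' v * \<psi> v) (at v)" for v
        using gd C_order_real_deriv(1)[OF C] by (auto intro!: derivative_eq_intros)
    qed (use M in \<open>auto intro!: continuous_intros gc g'c cc\<close>)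
    then have "(LINT x|lborel. ?g x * deriv \<psi> x) = - (LINT x|lborel. g' x * \<psi> x)"
      using i by (simp add: Bochner_Integration.integral_add)
    then show "(LINT x|lebesgue. ?g x * deriv \<psi> x) = - (LINT x|lebesgue. g' x * \<psi> x)"
      by (simp add: integral_completion)
  qed
  fix \<psi> :: "real \<times> real \<Rightarrow> real" assume \<psi>: "test_fun \<psi>"
  note c = test_fun2_props(1-3)[OF \<psi>]
  have Tc: "continuous_on UNIV (\<lambda>p. g' (fst p) * dv_test \<psi> p - snd p * dx_test \<psi> p)"
    by (intro continuous_intros c continuous_on_compose2[OF g'c]) auto
  note [measurable] = borel_measurable_continuous_onI[OF Tc]
  let ?T = "\<lambda>p. g' (fst p) * dv_test \<psi> p - snd p * dx_test \<psi> p"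
  have m: "(\<lambda>p. f0 p * ?T p) \<in> borel_measurable lebesgue" by (rule measurable_completion) measurable
  have ae: "AE p in lebesgue. f0 p * ?T p = f p * ?T p"
    using AE_completion[OF AE_f0_2d] by eventually_elim simp
  have "(LINT p|lebesgue. f p * ?T p) = (LINT p|lebesgue. f0 p * ?T p)"
    by (rule integral_cong_AE[OF borel_measurable_AE[OF m ae] m AE_symmetric[OF ae]])
  also have "\<dots> = (LINT p|lborel. f0 p * ?T p)" by (rule integral_completion) measurable
  also have "\<dots> = 0" by (rule weak[OF \<psi>])
  finally show "(LINT p|lebesgue. f p * ?T p) = 0" .
qed

text \<open>The force vanishes, and for fixed \<open>v\<close> the state does not depend on
  \<open>x\<close>, so the remaining term is the x-integral of an x-derivative with compact support.
  Local integrability is that of a single slice over a bounded range of \<open>x\<close>.\<close>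

lemma constant_potential_stationary:
  assumes g: "\<And>x. potential \<Phi> f x = m" and k: "\<And>x v. v \<noteq> 0 \<Longrightarrow> f (x, v) = k v"
  shows "weak_stationary_state \<Phi> f"
proof -
  have f0k: "f0 (x, v) = f0 (0, v)" for x v using k[of v x] k[of v 0] by (cases "v = 0") (simp_all add: f0_def)
  have slice: "(\<lambda>v. f0 (0, v)) \<in> borel_measurable borel" by measurable
  have fin: "(\<integral>\<^sup>+v. ennreal \<bar>f0 (0, v)\<bar> \<partial>lborel) < \<infinity>"
  proof -
    have "integrable lborel (\<lambda>v. f0 (0, v))"
      by (rule integrable_cong_AE_imp[OF slice_integrable[of 0]])
         (use slice AE_f0_1d[of 0] in \<open>auto intro: AE_symmetric elim: eventually_mono\<close>)
    then show ?thesis by (simp add: integrable_iff_bounded)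
  qed
  have L1: "L1_loc f"
  proof (rule L1_locI)
    fix p :: "real \<times> real"
    let ?T = "{fst p - 1<..<fst p + 1} \<times> (UNIV :: real set)"
    have oT: "open ?T" by (intro open_Times) auto
    have [measurable]: "?T \<in> sets borel" using oT by (rule borel_open)
    have m: "(\<lambda>q. ennreal \<bar>f0 q\<bar> * indicator ?T q) \<in> borel_measurable (lborel \<Otimes>\<^sub>M lborel)"
      unfolding lborel_prod by measurable
    have "(\<integral>\<^sup>+q. ennreal \<bar>f0 q\<bar> * indicator ?T q \<partial>lborel) =
       (\<integral>\<^sup>+x. (\<integral>\<^sup>+v. ennreal \<bar>f0 (x, v)\<bar> * indicator ?T (x, v) \<partial>lborel) \<partial>lborel)"
      using lborel.nn_integral_fst[OF m] unfolding lborel_prod by simp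
    also have "\<dots> = (\<integral>\<^sup>+x. (\<integral>\<^sup>+v. ennreal \<bar>f0 (0, v)\<bar> \<partial>lborel) * indicator {fst p - 1<..<fst p + 1} x \<partial>lborel)"
    proof (rule nn_integral_cong)
      fix x
      have "(\<integral>\<^sup>+v. ennreal \<bar>f0 (x, v)\<bar> * indicator ?T (x, v) \<partial>lborel)
          = (\<integral>\<^sup>+v. ennreal \<bar>f0 (0, v)\<bar> * indicator {fst p - 1<..<fst p + 1} x \<partial>lborel)"
        unfolding f0k[of x] by (intro nn_integral_cong) (simp add: indicator_def)
      then show "(\<integral>\<^sup>+v. ennreal \<bar>f0 (x, v)\<bar> * indicator ?T (x, v) \<partial>lborel)
          = (\<integral>\<^sup>+v. ennreal \<bar>f0 (0, v)\<bar> \<partial>lborel) * indicator {fst p - 1<..<fst p + 1} x"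
        using slice by (simp add: nn_integral_multc)
    qed
    also have "\<dots> = (\<integral>\<^sup>+v. ennreal \<bar>f0 (0, v)\<bar> \<partial>lborel) * 2"
      by (subst nn_integral_cmult_indicator) simp_all
    also have "\<dots> < \<infinity>" using fin by (simp add: ennreal_mult_less_top)
    finally show "\<exists>T. open T \<and> p \<in> T \<and> (\<integral>\<^sup>+q. ennreal \<bar>f0 q\<bar> * indicator T q \<partial>lborel) < \<infinity>"
      using oT by (intro exI[of _ ?T]) (cases p, auto)
  qed
  show ?thesis
  proof (rule weak_stationaryI[OF L1])
    have "potential \<Phi> f = (\<lambda>x. m)" using g by auto
    then show "(potential \<Phi> f has_real_derivative 0) (at x)" for x by simp
    fix \<psi> :: "real \<times> real \<Rightarrow> real" assume \<psi>: "test_fun \<psi>"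
    note P = test_fun2_props[OF \<psi>]
    obtain M where M: "\<And>p. p \<notin> {-M..M} \<times> {-M..M} \<Longrightarrow> \<psi> p = 0 \<and> dx_test \<psi> p = 0" using P(6) by metis
    have i: "integrable lborel (\<lambda>p. f0 p * (- snd p * dx_test \<psi> p))"
      by (rule f0_mult_integrable[OF L1, of _ M]) (use M in \<open>auto intro!: continuous_intros P(2)\<close>)
    have "(LINT x|lborel. f0 (x, v) * (- v * dx_test \<psi> (x, v))) = 0" for v
    proof -
      have "(LINT x|lborel. dx_test \<psi> (x, v)) = 0"
        by (rule integral_deriv_compact_support[of "\<lambda>x. \<psi> (x, v)", OF P(4), of M]) (use M continuous_on_slices[OF P(2)] in auto)
      then have "(LINT x|lborel. (f0 (0, v) * - v) * dx_test \<psi> (x, v)) = 0" by simp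
      then show ?thesis by (subst f0k) (simp add: mult.assoc)
    qed
    then show "(LINT p|lborel. f0 p * (0 * dv_test \<psi> p - snd p * dx_test \<psi> p)) = 0"
      using lborel_pair.integral_snd[of "\<lambda>x v. f0 (x, v) * (- v * dx_test \<psi> (x, v))"] i
      by (simp add: lborel_prod case_prod_unfold)
  qed simp
qed

end

section \<open>From the energy profile to the weak equation\<close>

text \<open>An explicit cut-off that is only continuously differentiable, which suffices for a
  single integration by parts. It is 0 for y \<le> 0 and tends to 1 at infinity without reaching
  it.\<close>

definition soft_cut :: "real \<Rightarrow> real" where
  "soft_cut y = (max 0 y)\<^sup>2 / (1 + y\<^sup>2)"

definition soft_cut' :: "real \<Rightarrow> real" where
  "soft_cut' y = 2 * max 0 y / (1 + y\<^sup>2)\<^sup>2"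

lemma one_plus_square_pos: "1 + y\<^sup>2 > (0::real)"
  by (simp add: add_pos_nonneg)

lemma max_zero_square_deriv: "((\<lambda>y. (max 0 y)\<^sup>2) has_real_derivative 2 * max 0 y) (at y)"
proof -
  consider "y > 0" | "y < 0" | "y = 0" by linarith
  then show ?thesis
  proof cases
    case 1
    have "((\<lambda>y. y\<^sup>2) has_real_derivative 2 * max 0 y) (at y)"
      using 1 by (auto intro!: derivative_eq_intros)
    then show ?thesis
      by (rule has_field_derivative_transform_within_open[where S = "{0<..}"]) (use 1 in auto)
  next
    case 2
    have "((\<lambda>y. 0) has_real_derivative 2 * max 0 y) (at y)" using 2 by simp
    then show ?thesis
      by (rule has_field_derivative_transform_within_open[where S = "{..<0}"]) (use 2 in auto)
  next
    case 3
    have "((\<lambda>y. (max 0 y)\<^sup>2) has_real_derivative 0) (at (0::real))"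
    proof (rule DERIV_zeroI)
      fix e :: real assume e: "e > 0"
      have "\<bar>(max 0 y)\<^sup>2\<bar> \<le> e * \<bar>y\<bar>" if "\<bar>y\<bar> < e" for y :: real
        using that e by (cases "0 \<le> y") (auto simp: max_def power2_eq_square intro!: mult_right_mono mult_nonneg_nonpos)
      then show "\<exists>d>0. \<forall>y. \<bar>y - 0\<bar> < d \<longrightarrow> \<bar>(max 0 y)\<^sup>2 - (max 0 0)\<^sup>2\<bar> \<le> e * \<bar>y - (0::real)\<bar>"
        using e by (intro exI[of _ e]) auto
    qed
    then show ?thesis using 3 by simp
  qed
qed

lemma soft_cut_deriv: "(soft_cut has_real_derivative soft_cut' y) (at y)"
proof -
  have ne: "1 + y\<^sup>2 \<noteq> 0" using one_plus_square_pos[of y] by simp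
  have "((\<lambda>y. 1 + y\<^sup>2) has_real_derivative 2 * y) (at y)" by (auto intro!: derivative_eq_intros)
  from DERIV_quotient[OF max_zero_square_deriv this ne]
  have "(soft_cut has_real_derivative (2 * max 0 y * (1 + y\<^sup>2) - 2 * y * (max 0 y)\<^sup>2) / (1 + y\<^sup>2) ^ Suc (Suc 0)) (at y)"
    unfolding soft_cut_def[abs_def] by (simp add: mult_ac)
  moreover have "2 * max 0 y * (1 + y\<^sup>2) - 2 * y * (max 0 y)\<^sup>2 = 2 * max 0 y"
    by (auto simp: max_def power2_eq_square algebra_simps)
  ultimately show ?thesis by (simp add: soft_cut'_def power2_eq_square)
qed

lemma soft_cut_bounds: "0 \<le> soft_cut y" "soft_cut y \<le> 1"
  using one_plus_square_pos[of y] by (auto simp: soft_cut_def max_def divide_le_eq_1)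

lemma soft_cut_nonpos: "y \<le> 0 \<Longrightarrow> soft_cut y = 0" "y \<le> 0 \<Longrightarrow> soft_cut' y = 0"
  by (auto simp: soft_cut_def soft_cut'_def max_def)

lemma soft_cut'_continuous: "isCont soft_cut' y"
proof -
  have "(1 + y\<^sup>2)\<^sup>2 \<noteq> 0" using one_plus_square_pos[of y] by simp
  then show ?thesis unfolding soft_cut'_def[abs_def] by (intro continuous_intros) auto
qed

lemma soft_cut_tendsto:
  assumes "filterlim y at_top sequentially" shows "(\<lambda>n. soft_cut (y n)) \<longlonglongrightarrow> 1"
proof -
  have "filterlim (\<lambda>n. 1 + (y n)\<^sup>2) at_top sequentially"
    by (intro filterlim_tendsto_add_at_top[OF tendsto_const] filterlim_pow_at_top assms) simp
  then have "(\<lambda>n. inverse (1 + (y n)\<^sup>2)) \<longlonglongrightarrow> 0" by (rule tendsto_inverse_0_at_top)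
  then have "(\<lambda>n. 1 - inverse (1 + (y n)\<^sup>2)) \<longlonglongrightarrow> 1 - 0" by (intro tendsto_intros)
  moreover have "eventually (\<lambda>n. 1 - inverse (1 + (y n)\<^sup>2) = soft_cut (y n)) sequentially"
    using filterlim_at_top_dense[THEN iffD1, OF assms, rule_format, of 0]
  proof eventually_elim
    case (elim n)
    have "1 + (y n)\<^sup>2 \<noteq> 0" using one_plus_square_pos[of "y n"] by simp
    then show ?case using elim by (simp add: soft_cut_def field_simps)
  qed
  ultimately show ?thesis using Lim_transform_eventually by fastforce
qed

text \<open>The situation after the two profiles have been identified. Non-constancy of
  \<open>g\<close> ensures that \<open>g\<close> minus its minimum vanishes only to finite order at
  a minimum point.\<close>

locale even_density = analytic_density +
  fixes F g :: "real \<Rightarrow> real"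
  assumes f_F: "\<And>x v. v \<noteq> 0 \<Longrightarrow> f (x, v) = F (v\<^sup>2 / 2 + g x)"
    and F_analytic: "F real_analytic_on {z. \<exists>x. g x < z}"
    and g_analytic: "g real_analytic_on UNIV"
    and g_nonconstant: "\<not> g constant_on UNIV"
begin

lemma g_continuous: "continuous_on UNIV g"
  by (rule real_analytic_on_continuous_on[OF g_analytic])

lemma g_deriv: "(g has_real_derivative deriv g x) (at x)"
  by (rule real_analytic_on_has_deriv[OF g_analytic]) simp

lemma g'_continuous: "continuous_on UNIV (deriv g)"
  by (rule real_analytic_on_continuous_on[OF real_analytic_on_deriv[OF g_analytic]])

lemma F_isCont: "g x < z \<Longrightarrow> isCont F z"
  by (rule real_analytic_on_isCont[OF F_analytic]) auto

text \<open>The energy at the point exceeds some value of \<open>g\<close>, so \<open>F\<close> is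
  continuous there and \<open>f0\<close> is bounded nearby.\<close>

lemma locally_integrable_regular:
  assumes E: "g y < v0\<^sup>2 / 2 + g x0"
  shows "\<exists>T. open T \<and> (x0, v0) \<in> T \<and> (\<integral>\<^sup>+q. ennreal \<bar>f0 q\<bar> * indicator T q \<partial>lborel) < \<infinity>"
proof -
  let ?H = "\<lambda>q. (snd q)\<^sup>2 / 2 + g (fst q)"
  have "isCont ?H (x0, v0)"
    using g_continuous by (intro continuous_intros isCont_o2[of _ fst g]) (auto simp: continuous_on_eq_continuous_at)
  then have "isCont (\<lambda>q. F (?H q)) (x0, v0)"
    by (rule isCont_o2) (use F_isCont[OF E] in simp)
  then obtain d where d: "d > 0" "\<And>q. dist q (x0, v0) < d \<Longrightarrow> dist (F (?H q)) (F (?H (x0, v0))) < 1"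
    unfolding continuous_at_eps_delta by (metis zero_less_one)
  define B where "B = \<bar>F (?H (x0, v0))\<bar> + 1"
  let ?T = "ball (x0, v0) d"
  have b: "\<bar>f0 q\<bar> \<le> B" if "q \<in> ?T" for q
  proof -
    have "\<bar>F (?H q) - F (?H (x0, v0))\<bar> < 1" using d(2)[of q] that by (simp add: dist_commute dist_real_def)
    then have "\<bar>F (?H q)\<bar> \<le> B" unfolding B_def by linarith
    moreover have "\<bar>f0 q\<bar> \<le> \<bar>F (?H q)\<bar>" using f_F[of "snd q" "fst q"] by (auto simp: f0_def indicator_def)
    ultimately show ?thesis by linarith
  qed
  have "(\<integral>\<^sup>+q. ennreal \<bar>f0 q\<bar> * indicator ?T q \<partial>lborel) \<le> (\<integral>\<^sup>+q. ennreal B * indicator ?T q \<partial>lborel)"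
    using b by (intro nn_integral_mono) (auto simp: indicator_def ennreal_leI)
  also have "\<dots> = ennreal B * emeasure lborel ?T" by (subst nn_integral_cmult_indicator) auto
  also have "\<dots> < \<infinity>" using emeasure_bounded_finite[of ?T] by (simp add: ennreal_mult_less_top)
  finally show ?thesis using d(1) by (intro exI[of _ ?T]) auto
qed

text \<open>All energies near the point are seen on the single line over \<open>x0\<close>, where
  \<open>f\<close> is integrable. The task is to bound a planar integral by an integral over that
  line, although lines over neighbouring \<open>x\<close> carry potential energy and meet the
  singular energies differently.\<close>

lemma locally_integrable_minimum:
  assumes min: "\<And>y. g x0 \<le> g y"
  shows "\<exists>T. open T \<and> (x0, 0) \<in> T \<and> (\<integral>\<^sup>+q. ennreal \<bar>f0 q\<bar> * indicator T q \<partial>lborel) < \<infinity>"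
proof -
  define m where "m = g x0"
  \<comment> \<open>|F| as a function of the speed \<open>y\<close> that the energy
    \<open>m + y\<^sup>2 / 2\<close> has over \<open>x0\<close>. Its integral over
    \<open>{0..Y}\<close> is a piece of the L1 norm of the slice, and |f| at (x, v) is
    \<open>P\<close> at \<open>sqrt (v\<^sup>2 + 2 * (g x - m))\<close>.\<close>
  define P where "P y = ennreal (indicator {0<..} y *\<^sub>R \<bar>F (m + y\<^sup>2 / 2)\<bar>)" for y
  have Pm [measurable]: "P \<in> borel_measurable borel"
  proof -
    have "continuous_on {0<..} (\<lambda>y. \<bar>F (m + y\<^sup>2 / 2)\<bar>)"
    proof (intro continuous_on_rabs continuous_at_imp_continuous_on ballI)
      fix y :: real assume "y \<in> {0<..}"
      then have "isCont F (m + y\<^sup>2 / 2)" by (intro F_isCont[of x0]) (simp add: m_def)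
      then show "isCont (\<lambda>y. F (m + y\<^sup>2 / 2)) y" by (rule isCont_o2[rotated]) (intro continuous_intros, simp)
    qed
    then have "(\<lambda>y. indicator {0<..} y *\<^sub>R \<bar>F (m + y\<^sup>2 / 2)\<bar>) \<in> borel_measurable borel"
      by (intro borel_measurable_continuous_on_indicator) auto
    then show ?thesis unfolding P_def[abs_def] by measurable
  qed
  have fin: "(\<integral>\<^sup>+y. P y * indicator {0..Y} y \<partial>lborel) < \<infinity>" for Y
  proof -
    have "(\<integral>\<^sup>+y. P y * indicator {0..Y} y \<partial>lborel) \<le> (\<integral>\<^sup>+v. ennreal \<bar>f (x0, v)\<bar> \<partial>lborel)"
      by (rule nn_integral_mono) (auto simp: P_def indicator_def f_F m_def add.commute)
    also have "\<dots> < \<infinity>" using slice_integrable[of x0] by (simp add: integrable_iff_bounded)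
    finally show ?thesis .
  qed
  let ?G = "\<lambda>x. g x - m"
  have Ga: "?G real_analytic_on UNIV" by (intro real_analytic_on_diff g_analytic real_analytic_on_const)
  have Ga0: "?G real_analytic_on {x0}" using Ga by (rule real_analytic_on_subset) simp
  \<comment> \<open>If \<open>g - m\<close> vanished near \<open>x0\<close>, it would vanish on the
    line, contrary to non-constancy; so \<open>x0\<close> is a zero of finite order.\<close>
  have nz: "\<not> eventually (\<lambda>x. ?G x = 0) (nhds x0)"
  proof
    assume "eventually (\<lambda>x. ?G x = 0) (nhds x0)"
    then obtain T where T: "open T" "x0 \<in> T" "\<And>x. x \<in> T \<Longrightarrow> ?G x = 0" unfolding eventually_nhds by blast
    have "?G x = 0" for x
      by (rule real_analytic_identity_on_open[OF Ga open_UNIV connected_UNIV T(1,2) _ T(3)]) simp_all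
    then have "g x = m" for x by simp
    then show False using g_nonconstant unfolding constant_on_def by blast
  qed
  have dG: "deriv ?G x = deriv g x" for x
    by (rule DERIV_imp_deriv) (use g_deriv[of x] in \<open>auto intro!: derivative_eq_intros\<close>)
  obtain \<delta>0 where \<delta>0: "\<delta>0 > 0" "\<And>x. 0 < \<bar>x - x0\<bar> \<Longrightarrow> \<bar>x - x0\<bar> < \<delta>0 \<Longrightarrow> ?G x \<noteq> 0"
    "\<And>x. 0 < \<bar>x - x0\<bar> \<Longrightarrow> \<bar>x - x0\<bar> < \<delta>0 \<Longrightarrow> (x - x0) * deriv ?G x / ?G x \<ge> 1 / 2"
    by (rule real_analytic_zero_log_deriv[OF Ga0 _ nz]) (simp add: m_def, rule that)
  define \<delta> where "\<delta> = \<delta>0 / 2"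
  have \<delta>: "0 < \<delta>" "\<delta> < \<delta>0" using \<delta>0(1) by (auto simp: \<delta>_def)
  define N1 where "N1 x = (\<integral>\<^sup>+v. P (sqrt (v\<^sup>2 + 2 * ?G x)) * indicator {0..1} v \<partial>lborel)" for x
  note [measurable] = borel_measurable_continuous_onI[OF g_continuous]
  have N1m [measurable]: "N1 \<in> borel_measurable borel" unfolding N1_def[abs_def] by measurable
  have quad: "(\<integral>\<^sup>+t. N1 (x0 + s * t) * indicator {0..\<delta>} t \<partial>lborel) < \<infinity>" if s: "s = 1 \<or> s = - 1" for s
    unfolding N1_def
  proof -
    let ?a = "\<lambda>t. ?G (x0 + s * t)" and ?a' = "\<lambda>t. s * deriv g (x0 + s * t)"
    have ac: "continuous_on UNIV ?a" by (intro continuous_intros continuous_on_compose2[OF g_continuous]) auto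
    have "bounded (?a ` {0..\<delta>})"
      by (intro compact_imp_bounded compact_continuous_image continuous_on_subset[OF ac]) auto
    then obtain A where A: "\<forall>t\<in>{0..\<delta>}. \<bar>?a t\<bar> \<le> A" unfolding bounded_iff by auto
    have near: "0 < \<bar>(x0 + s * t) - x0\<bar>" "\<bar>(x0 + s * t) - x0\<bar> < \<delta>0" if "0 < t" "t \<le> \<delta>" for t
      using that s \<delta> by auto
    have apos: "0 < ?a t" if "0 < t" "t \<le> \<delta>" for t
      using \<delta>0(2)[OF near[OF that]] min[of "x0 + s * t"] by (simp add: m_def)
    show "(\<integral>\<^sup>+t. (\<integral>\<^sup>+v. P (sqrt (v\<^sup>2 + 2 * ?a t)) * indicator {0..1} v \<partial>lborel) * indicator {0..\<delta>} t \<partial>lborel) < \<infinity>"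
    proof (rule nn_integral_quadrant[OF Pm \<delta>(1) ac apos _ _ _ _ _ fin, where a' = ?a' and C = "2 * \<delta>"])
      show "?a t \<le> A" if "t \<in> {0..\<delta>}" for t using A that by force
      show "(?a has_real_derivative ?a' t) (at t)" for t
      proof -
        have "((\<lambda>t. x0 + s * t) has_real_derivative s) (at t)" by (auto intro!: derivative_eq_intros)
        from DERIV_chain2[OF g_deriv this] show ?thesis by (auto intro!: derivative_eq_intros)
      qed
      show "continuous_on {0<..\<delta>} ?a'"
        by (intro continuous_intros continuous_on_compose2[OF g'_continuous]) auto
      show "?a t \<le> 2 * \<delta> * ?a' t" if t: "0 < t" "t \<le> \<delta>" for t
      proof -
        \<comment> \<open>The logarithmic derivative estimate with \<open>x - x0 = s * t\<close>. It
          gives \<open>?a t \<le> 2 * t * ?a' t\<close>, and \<open>t \<le> \<delta>\<close> yields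
          the constant \<open>2 * \<delta>\<close>.\<close>
        have "1 / 2 \<le> s * t * deriv g (x0 + s * t) / ?a t"
          using \<delta>0(3)[OF near[OF t]] by (simp add: dG)
        then have le: "?a t \<le> 2 * t * ?a' t" using apos[OF t] by (simp add: field_simps)
        then have "0 < 2 * t * ?a' t" using apos[OF t] by linarith
        then have "0 < ?a' t" using t by (simp add: zero_less_mult_iff)
        then have "2 * t * ?a' t \<le> 2 * \<delta> * ?a' t" using t by (intro mult_right_mono) auto
        then show ?thesis using le by linarith
      qed
    qed (use \<delta> in auto)
  qed
  have half: "(\<integral>\<^sup>+x. N1 x * indicator {x0..x0 + \<delta>} x \<partial>lborel) < \<infinity>" "(\<integral>\<^sup>+x. N1 x * indicator {x0 - \<delta>..x0} x \<partial>lborel) < \<infinity>"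
  proof -
    have "(\<integral>\<^sup>+x. N1 x * indicator {x0..x0 + \<delta>} x \<partial>lborel) = ennreal \<bar>1\<bar> * (\<integral>\<^sup>+t. N1 (x0 + 1 * t) * indicator {x0..x0 + \<delta>} (x0 + 1 * t) \<partial>lborel)"
      by (rule nn_integral_real_affine[where f = "\<lambda>x. N1 x * indicator {x0..x0 + \<delta>} x"]) (intro borel_measurable_times_ennreal N1m borel_measurable_indicator, simp_all)
    also have "\<dots> = (\<integral>\<^sup>+t. N1 (x0 + 1 * t) * indicator {0..\<delta>} t \<partial>lborel)"
      unfolding abs_minus_cancel abs_one ennreal_1 mult_1_left[where 'a = ennreal]
      by (intro nn_integral_cong) (auto simp: indicator_def)
    finally show "(\<integral>\<^sup>+x. N1 x * indicator {x0..x0 + \<delta>} x \<partial>lborel) < \<infinity>" using quad[of 1] by simp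
    have "(\<integral>\<^sup>+x. N1 x * indicator {x0 - \<delta>..x0} x \<partial>lborel) = ennreal \<bar>- 1\<bar> * (\<integral>\<^sup>+t. N1 (x0 + (- 1) * t) * indicator {x0 - \<delta>..x0} (x0 + (- 1) * t) \<partial>lborel)"
      by (rule nn_integral_real_affine[where f = "\<lambda>x. N1 x * indicator {x0 - \<delta>..x0} x"]) (intro borel_measurable_times_ennreal N1m borel_measurable_indicator, simp_all)
    also have "\<dots> = (\<integral>\<^sup>+t. N1 (x0 + (- 1) * t) * indicator {0..\<delta>} t \<partial>lborel)"
      unfolding abs_minus_cancel abs_one ennreal_1 mult_1_left[where 'a = ennreal]
      by (intro nn_integral_cong) (auto simp: indicator_def)
    finally show "(\<integral>\<^sup>+x. N1 x * indicator {x0 - \<delta>..x0} x \<partial>lborel) < \<infinity>" using quad[of "- 1"] by simp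
  qed
  let ?k = "\<lambda>q. P (sqrt ((snd q)\<^sup>2 + 2 * ?G (fst q)))"
  have f0k: "ennreal \<bar>f0 q\<bar> \<le> ?k q" for q
  proof (cases "snd q = 0")
    case False
    let ?w = "(snd q)\<^sup>2 + 2 * ?G (fst q)"
    have w: "?w > 0" using False min[of "fst q"] by (simp add: m_def add_pos_nonneg)
    have "m + (sqrt ?w)\<^sup>2 / 2 = (snd q)\<^sup>2 / 2 + g (fst q)" using w by (simp add: field_simps)
    then have "?k q = ennreal \<bar>F ((snd q)\<^sup>2 / 2 + g (fst q))\<bar>" using w by (simp add: P_def)
    then show ?thesis using f_F[OF False, of "fst q"] False by (simp add: f0_def)
  qed (simp add: f0_def)
  let ?T = "{x0 - \<delta><..<x0 + \<delta>} \<times> {-1<..<1::real}"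
  have oT: "open ?T" by (intro open_Times) auto
  have [measurable]: "?T \<in> sets borel" using oT by (rule borel_open)
  have km: "(\<lambda>q. ?k q * indicator ?T q) \<in> borel_measurable (lborel \<Otimes>\<^sub>M lborel)"
  proof -
    have "?k \<in> borel_measurable (lborel \<Otimes>\<^sub>M lborel)" by measurable
    moreover have "(indicator ?T :: _ \<Rightarrow> ennreal) \<in> borel_measurable (lborel \<Otimes>\<^sub>M lborel)" unfolding lborel_prod by measurable
    ultimately show ?thesis by (rule borel_measurable_times_ennreal)
  qed
  have inner: "(\<integral>\<^sup>+v. ?k (x, v) * indicator {-1..1} v \<partial>lborel) \<le> 2 * N1 x" for x
  proof -
    have km1: "(\<lambda>v. P (sqrt (v\<^sup>2 + 2 * ?G x))) \<in> borel_measurable borel" by measurable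
    have "(\<integral>\<^sup>+v. ?k (x, v) * indicator {-1..1} v \<partial>lborel)
        \<le> (\<integral>\<^sup>+v. ?k (x, v) * indicator {0..1} v + ?k (x, v) * indicator {-1..0} v \<partial>lborel)"
      by (rule nn_integral_mono) (auto simp: indicator_def)
    also have "\<dots> = (\<integral>\<^sup>+v. ?k (x, v) * indicator {0..1} v \<partial>lborel) + (\<integral>\<^sup>+v. ?k (x, v) * indicator {-1..0} v \<partial>lborel)"
      unfolding fst_conv snd_conv by (rule nn_integral_add) measurable
    also have "(\<integral>\<^sup>+v. ?k (x, v) * indicator {-1..0} v \<partial>lborel) = ennreal \<bar>- 1\<bar> * (\<integral>\<^sup>+v. ?k (x, 0 + (- 1) * v) * indicator {-1..0} (0 + (- 1) * v) \<partial>lborel)"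
      unfolding fst_conv snd_conv
      by (rule nn_integral_real_affine[where f = "\<lambda>v. P (sqrt (v\<^sup>2 + 2 * ?G x)) * indicator {-1..0} v"]) (intro borel_measurable_times_ennreal borel_measurable_indicator km1, simp_all)
    also have "\<dots> = (\<integral>\<^sup>+v. ?k (x, 0 + (- 1) * v) * indicator {-1..0} (0 + (- 1) * v) \<partial>lborel)"
      unfolding abs_minus_cancel abs_one ennreal_1 mult_1_left[where 'a = ennreal] ..
    also have "\<dots> = (\<integral>\<^sup>+v. ?k (x, v) * indicator {0..1} v \<partial>lborel)"
    proof (rule nn_integral_cong)
      fix v :: real
      have "indicator {-1..0} (0 + (- 1) * v) = (indicator {0..1} v :: ennreal)" by (auto simp: indicator_def)
      then show "?k (x, 0 + (- 1) * v) * indicator {-1..0} (0 + (- 1) * v) = ?k (x, v) * indicator {0..1} v"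
        by (simp only: snd_conv fst_conv add_0_left mult_minus_left mult_1_left power2_minus)
    qed
    finally show ?thesis unfolding N1_def fst_conv snd_conv by (simp only: mult_2)
  qed
  have "(\<integral>\<^sup>+q. ennreal \<bar>f0 q\<bar> * indicator ?T q \<partial>lborel) \<le> (\<integral>\<^sup>+q. ?k q * indicator ?T q \<partial>lborel)"
    by (intro nn_integral_mono mult_right_mono f0k) simp
  also have "\<dots> = (\<integral>\<^sup>+x. (\<integral>\<^sup>+v. ?k (x, v) * indicator ?T (x, v) \<partial>lborel) \<partial>lborel)"
    using lborel.nn_integral_fst[OF km] unfolding lborel_prod by simp
  also have "\<dots> \<le> (\<integral>\<^sup>+x. 2 * (N1 x * indicator {x0..x0 + \<delta>} x + N1 x * indicator {x0 - \<delta>..x0} x) \<partial>lborel)"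
  proof (rule nn_integral_mono)
    fix x
    show "(\<integral>\<^sup>+v. ?k (x, v) * indicator ?T (x, v) \<partial>lborel) \<le> 2 * (N1 x * indicator {x0..x0 + \<delta>} x + N1 x * indicator {x0 - \<delta>..x0} x)"
    proof (cases "x \<in> {x0 - \<delta><..<x0 + \<delta>}")
      case True
      have "(\<integral>\<^sup>+v. ?k (x, v) * indicator ?T (x, v) \<partial>lborel) \<le> (\<integral>\<^sup>+v. ?k (x, v) * indicator {-1..1} v \<partial>lborel)"
        by (intro nn_integral_mono) (auto simp: indicator_def)
      also have "\<dots> \<le> 2 * N1 x" by (rule inner)
      also have "\<dots> \<le> 2 * (N1 x * indicator {x0..x0 + \<delta>} x + N1 x * indicator {x0 - \<delta>..x0} x)"
        using True by (intro mult_left_mono) (auto simp: indicator_def)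
      finally show ?thesis .
    next
      case False
      then have "indicator ?T (x, v) = (0 :: ennreal)" for v by auto
      then show ?thesis by simp
    qed
  qed
  also have "\<dots> = 2 * ((\<integral>\<^sup>+x. N1 x * indicator {x0..x0 + \<delta>} x \<partial>lborel) + (\<integral>\<^sup>+x. N1 x * indicator {x0 - \<delta>..x0} x \<partial>lborel))"
    by (simp add: nn_integral_cmult nn_integral_add)
  also have "\<dots> < \<infinity>" using half by (simp add: ennreal_mult_less_top)
  finally show ?thesis using oT \<delta> by (intro exI[of _ ?T]) auto
qed

lemma f_L1_loc: "L1_loc f"
proof (rule L1_locI)
  fix p :: "real \<times> real"
  obtain x0 v0 where p: "p = (x0, v0)" by (cases p)
  show "\<exists>T. open T \<and> p \<in> T \<and> (\<integral>\<^sup>+q. ennreal \<bar>f0 q\<bar> * indicator T q \<partial>lborel) < \<infinity>"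
  proof (cases "\<exists>y. g y < v0\<^sup>2 / 2 + g x0")
    case True
    then show ?thesis using locally_integrable_regular p by blast
  next
    case False
    \<comment> \<open>Taking \<open>y = x0\<close> shows \<open>v0 = 0\<close>, and then
      \<open>x0\<close> is a global minimum of \<open>g\<close>: the only points where
      \<open>F\<close> need not be continuous.\<close>
    then have le: "v0\<^sup>2 / 2 + g x0 \<le> g y" for y by (meson not_le)
    have "v0 = 0" using le[of x0] by simp
    moreover have "g x0 \<le> g y" for y using le[of y] \<open>v0 = 0\<close> by simp
    ultimately show ?thesis using locally_integrable_minimum[of x0] p by simp
  qed
qed

text \<open>\<open>F\<close> is cut off smoothly near the least energy \<open>\<mu>\<close> on the support of the test function, so that
  the truncated state is continuously differentiable across \<open>v = 0\<close>.\<close>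

lemma f_weak_equation:
  assumes \<psi>: "test_fun \<psi>"
  shows "(LINT p|lborel. f0 p * (deriv g (fst p) * dv_test \<psi> p - snd p * dx_test \<psi> p)) = 0"
proof -
  note T = test_fun2_props[OF \<psi>]
  obtain M where M: "M > 0" "\<And>p. p \<notin> {-M..M} \<times> {-M..M} \<Longrightarrow> \<psi> p = 0 \<and> dx_test \<psi> p = 0 \<and> dv_test \<psi> p = 0"
    using T(6) by blast
  have "{-M..M} \<noteq> {}" using M(1) by auto
  then obtain x1 where x1: "\<forall>x\<in>{-M..M}. g x1 \<le> g x"
    using continuous_attains_inf[of "{-M..M}" g] continuous_on_subset[OF g_continuous] by auto
  \<comment> \<open>The minimum over the x-range of the support; the infimum of \<open>g\<close>
    over the whole line need not be attained.\<close>
  define \<mu> where "\<mu> = g x1"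
  \<comment> \<open>The shift by 1 makes the cut-off vanish for
    \<open>E \<le> \<mu> + 1 / (n + 1)\<close>. Hence \<open>Fn n\<close> is zero on a whole
    neighbourhood of \<open>\<mu>\<close> and is continuously differentiable however
    \<open>F\<close> behaves there; for fixed \<open>E > \<mu>\<close> the argument tends to
    infinity and the cut-off to 1.\<close>
  define y where "y n E = real (Suc n) * (E - \<mu>) - 1" for n E
  define w where "w n E = soft_cut (y n E)" for n E
  define w' where "w' n E = soft_cut' (y n E) * real (Suc n)" for n E
  define Fn where "Fn n E = (if E > \<mu> then F E * w n E else 0)" for n E
  define Fn' where "Fn' n E = (if E > \<mu> then deriv F E * w n E + F E * w' n E else 0)" for n E
  have y_deriv: "(y n has_real_derivative real (Suc n)) (at E)" for n E
    unfolding y_def[abs_def] by (auto intro!: derivative_eq_intros)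
  have w_deriv: "(w n has_real_derivative w' n E) (at E)" for n E
    unfolding w_def[abs_def] w'_def by (rule DERIV_chain2[OF soft_cut_deriv y_deriv])
  have y_cont: "isCont (y n) E" for n E using y_deriv DERIV_isCont by blast
  have w_cont: "isCont (w n) E" for n E using w_deriv DERIV_isCont by blast
  have w'_cont: "isCont (w' n) E" for n E
    unfolding w'_def[abs_def] by (intro continuous_intros isCont_o2[OF y_cont soft_cut'_continuous])
  have low: "Fn n E = 0 \<and> Fn' n E = 0" if "E < \<mu> + 1 / real (Suc n)" for n E
  proof -
    have "y n E \<le> 0" using that unfolding y_def by (simp add: field_simps)
    then show ?thesis by (simp add: Fn_def Fn'_def w_def w'_def soft_cut_nonpos)
  qed
  have FE: "(F has_real_derivative deriv F E) (at E)" "isCont F E" "isCont (deriv F) E" if "E > \<mu>" for E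
  proof -
    have m: "E \<in> {z. \<exists>x. g x < z}" using that unfolding \<mu>_def by blast
    show "(F has_real_derivative deriv F E) (at E)" by (rule real_analytic_on_has_deriv[OF F_analytic m])
    show "isCont F E" by (rule real_analytic_on_isCont[OF F_analytic m])
    show "isCont (deriv F) E" by (rule real_analytic_on_isCont[OF real_analytic_on_deriv[OF F_analytic] m])
  qed
  have lowE: "E < \<mu> + 1 / real (Suc n)" if "\<not> E > \<mu>" for n E
  proof -
    have "0 < 1 / real (Suc n)" by simp
    then show ?thesis using that by linarith
  qed
  have Fn_deriv: "(Fn n has_real_derivative Fn' n E) (at E)" for n E
  proof (cases "E > \<mu>")
    case True
    have "((\<lambda>E. F E * w n E) has_real_derivative Fn' n E) (at E)"
      using FE(1)[OF True] w_deriv True by (auto intro!: derivative_eq_intros simp: Fn'_def)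
    then show ?thesis
      by (rule has_field_derivative_transform_within_open[where S = "{\<mu><..}"]) (use True in \<open>auto simp: Fn_def\<close>)
  next
    case False
    have "((\<lambda>E. 0) has_real_derivative Fn' n E) (at E)" using False by (simp add: Fn'_def)
    then show ?thesis
      by (rule has_field_derivative_transform_within_open[where S = "{..<\<mu> + 1 / real (Suc n)}"])
         (use lowE[OF False] low in auto)
  qed
  have Fn'_isCont: "isCont (Fn' n) E" for n E
  proof (cases "E > \<mu>")
    case True
    have c: "isCont (\<lambda>E. deriv F E * w n E + F E * w' n E) E"
      by (intro continuous_intros FE(2,3)[OF True] w_cont w'_cont)
    have ev: "eventually (\<lambda>E. deriv F E * w n E + F E * w' n E = Fn' n E) (nhds E)"
      unfolding eventually_nhds by (rule exI[of _ "{\<mu><..}"]) (use True in \<open>auto simp: Fn'_def\<close>)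
    show ?thesis by (rule iffD1[OF isCont_cong[OF ev] c])
  next
    case False
    have c: "isCont (\<lambda>E. 0::real) E" by simp
    have ev: "eventually (\<lambda>E. 0 = Fn' n E) (nhds E)"
      unfolding eventually_nhds by (rule exI[of _ "{..<\<mu> + 1 / real (Suc n)}"]) (use lowE[OF False] low in auto)
    show ?thesis by (rule iffD1[OF isCont_cong[OF ev] c])
  qed
  have Fnc: "continuous_on UNIV (Fn n)" "continuous_on UNIV (Fn' n)" for n
    using DERIV_isCont[OF Fn_deriv] Fn'_isCont by (simp_all add: continuous_on_eq_continuous_at)
  define H where "H p = (snd p)\<^sup>2 / 2 + g (fst p)" for p
  have Hc: "continuous_on UNIV H" unfolding H_def by (intro continuous_intros continuous_on_compose2[OF g_continuous]) auto
  have gc: "continuous_on UNIV (\<lambda>p::real \<times> real. deriv g (fst p))" by (intro continuous_on_compose2[OF g'_continuous] continuous_intros) auto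
  have FH: "continuous_on UNIV (\<lambda>p. Fn n (H p))" "continuous_on UNIV (\<lambda>p. Fn' n (H p))" for n
    by (rule continuous_on_compose2[OF Fnc(1) Hc], simp, rule continuous_on_compose2[OF Fnc(2) Hc], simp)
  have FHx: "((\<lambda>x. Fn n (H (x, v))) has_real_derivative Fn' n (H (x, v)) * deriv g x) (at x)" for n x v
  proof (rule DERIV_chain2[OF Fn_deriv])
    show "((\<lambda>x. H (x, v)) has_real_derivative deriv g x) (at x)"
      unfolding H_def using g_deriv[of x] by (auto intro!: derivative_eq_intros)
  qed
  have FHv: "((\<lambda>v. Fn n (H (x, v))) has_real_derivative Fn' n (H (x, v)) * v) (at v)" for n x v
  proof (rule DERIV_chain2[OF Fn_deriv])
    show "((\<lambda>v. H (x, v)) has_real_derivative v) (at v)"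
      unfolding H_def by (auto intro!: derivative_eq_intros)
  qed
  define Q where "Q p = deriv g (fst p) * dv_test \<psi> p - snd p * dx_test \<psi> p" for p
  have Qc: "continuous_on UNIV Q" unfolding Q_def by (intro continuous_intros gc T(2,3))
  have zero: "(LINT p|lborel. Fn n (H p) * Q p) = 0" for n
  proof -
    \<comment> \<open>These are the v-derivative of \<open>g' * Fn (H) * \<psi>\<close> and the
      x-derivative of \<open>v * Fn (H) * \<psi>\<close>. In their difference the terms with
      \<open>Fn'\<close> cancel because the energy is constant along the flow, leaving
      \<open>Fn (H) * Q\<close>.\<close>
    let ?kv = "\<lambda>p. deriv g (fst p) * (Fn' n (H p) * snd p * \<psi> p + Fn n (H p) * dv_test \<psi> p)"
    let ?kx = "\<lambda>p. snd p * (Fn' n (H p) * deriv g (fst p) * \<psi> p + Fn n (H p) * dx_test \<psi> p)"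
    have cv: "continuous_on UNIV ?kv" by (intro continuous_intros gc FH T(1-3))
    have cx: "continuous_on UNIV ?kx" by (intro continuous_intros gc FH T(1-3))
    have iv: "integrable lborel ?kv" by (rule integrable_continuous_box[OF cv, of M]) (use M(2) in simp)
    have ix: "integrable lborel ?kx" by (rule integrable_continuous_box[OF cx, of M]) (use M(2) in simp)
    have "(LINT p|lborel. ?kv p) = 0"
    proof (rule integral_partial_snd_zero[OF _ cv, of "\<lambda>p. deriv g (fst p) * (Fn n (H p) * \<psi> p)" M])
      fix x v
      show "((\<lambda>v. deriv g (fst (x, v)) * (Fn n (H (x, v)) * \<psi> (x, v))) has_real_derivative ?kv (x, v)) (at v)"
        using DERIV_mult[OF FHv[of n x v] T(5)[of x v], THEN DERIV_cmult, of "deriv g x"] by (simp add: mult_ac add.commute)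
    qed (use M(2) in auto)
    moreover have "(LINT p|lborel. ?kx p) = 0"
    proof (rule integral_partial_fst_zero[OF _ cx, of "\<lambda>p. snd p * (Fn n (H p) * \<psi> p)" M])
      fix x v
      show "((\<lambda>x. snd (x, v) * (Fn n (H (x, v)) * \<psi> (x, v))) has_real_derivative ?kx (x, v)) (at x)"
        using DERIV_mult[OF FHx[of n v x] T(4)[of v x], THEN DERIV_cmult, of v] by (simp add: mult_ac add.commute)
    qed (use M(2) in auto)
    ultimately have "(LINT p|lborel. ?kv p - ?kx p) = 0"
      using iv ix by (subst Bochner_Integration.integral_diff) auto
    moreover have "?kv p - ?kx p = Fn n (H p) * Q p" for p by (simp add: Q_def algebra_simps)
    ultimately show ?thesis by simp
  qed
  \<comment> \<open>The cut-off takes values in [0, 1], so the absolute value of the limit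
    dominates; it is integrable by local integrability of \<open>f\<close>.\<close>
  have "(\<lambda>n. LINT p|lborel. Fn n (H p) * Q p) \<longlonglongrightarrow> (LINT p|lborel. f0 p * Q p)"
  proof (rule integral_dominated_convergence[where w = "\<lambda>p. \<bar>f0 p * Q p\<bar>"])
    have i: "integrable lborel (\<lambda>p. f0 p * Q p)"
      by (rule f0_mult_integrable[OF f_L1_loc Qc, of M]) (use M(2) in \<open>simp add: Q_def\<close>)
    then show "integrable lborel (\<lambda>p. \<bar>f0 p * Q p\<bar>)" by (rule integrable_abs)
    show "(\<lambda>p. f0 p * Q p) \<in> borel_measurable lborel" using i by (rule borel_measurable_integrable)
    show "(\<lambda>p. Fn n (H p) * Q p) \<in> borel_measurable lborel" for n
      using borel_measurable_continuous_onI[OF continuous_on_mult[OF FH(1)[of n] Qc]] by simp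
    have key: "H p > \<mu> \<and> f0 p = F (H p)" if "snd p \<noteq> 0" "p \<in> {-M..M} \<times> {-M..M}" for p
    proof -
      have "\<mu> \<le> g (fst p)" using x1 that(2) by (auto simp: \<mu>_def)
      moreover have "(snd p)\<^sup>2 > 0" using that(1) by simp
      ultimately have "H p > \<mu>" unfolding H_def by linarith
      moreover have "f0 p = F (H p)" using f_F[OF that(1), of "fst p"] that(1) by (simp add: f0_def H_def)
      ultimately show ?thesis by simp
    qed
    have Q0: "Q p = 0" if "p \<notin> {-M..M} \<times> {-M..M}" for p using M(2)[OF that] by (simp add: Q_def)
    show "AE p in lborel. (\<lambda>n. Fn n (H p) * Q p) \<longlonglongrightarrow> f0 p * Q p"
      using AE_lborel_snd_nonzero
    proof eventually_elim
      case (elim p)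
      show ?case
      proof (cases "p \<in> {-M..M} \<times> {-M..M}")
        case True
        note k = key[OF elim True]
        have "filterlim (\<lambda>n. real (Suc n) * (H p - \<mu>)) at_top sequentially"
        proof (rule filterlim_at_top_mult_tendsto_pos[OF tendsto_const])
          show "filterlim (\<lambda>n. real (Suc n)) at_top sequentially"
            by (rule filterlim_compose[OF filterlim_real_sequentially filterlim_Suc])
        qed (use k in simp)
        then have "filterlim (\<lambda>n. - 1 + real (Suc n) * (H p - \<mu>)) at_top sequentially"
          by (rule filterlim_tendsto_add_at_top[OF tendsto_const])
        then have "filterlim (\<lambda>n. y n (H p)) at_top sequentially" by (simp add: y_def)
        then have "(\<lambda>n. w n (H p)) \<longlonglongrightarrow> 1" unfolding w_def by (rule soft_cut_tendsto)
        then have "(\<lambda>n. F (H p) * w n (H p) * Q p) \<longlonglongrightarrow> F (H p) * 1 * Q p" by (intro tendsto_intros)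
        then show ?thesis using k by (simp add: Fn_def)
      qed (simp add: Q0)
    qed
    show "AE p in lborel. norm (Fn n (H p) * Q p) \<le> \<bar>f0 p * Q p\<bar>" for n
      using AE_lborel_snd_nonzero
    proof eventually_elim
      case (elim p)
      show ?case
      proof (cases "p \<in> {-M..M} \<times> {-M..M}")
        case True
        note k = key[OF elim True]
        have "\<bar>w n (H p)\<bar> \<le> 1" using soft_cut_bounds[of "y n (H p)"] by (simp add: w_def)
        then have "\<bar>F (H p)\<bar> * \<bar>w n (H p)\<bar> \<le> \<bar>F (H p)\<bar>" using mult_left_mono[of _ 1 "\<bar>F (H p)\<bar>"] by simp
        then have "\<bar>F (H p)\<bar> * \<bar>w n (H p)\<bar> * \<bar>Q p\<bar> \<le> \<bar>F (H p)\<bar> * \<bar>Q p\<bar>" by (rule mult_right_mono) simp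
        then show ?thesis using k by (simp add: Fn_def abs_mult)
      qed (simp add: Q0)
    qed
  qed
  then have "(LINT p|lborel. f0 p * Q p) = 0" unfolding zero by (simp add: LIMSEQ_const_iff)
  then show ?thesis unfolding Q_def .
qed

theorem even_density_stationary:
  assumes "g = potential \<Phi> f" shows "weak_stationary_state \<Phi> f"
  by (rule weak_stationaryI[OF f_L1_loc _ g'_continuous f_weak_equation]) (use g_deriv assms in auto)

end

section \<open>The jump across vanishing velocity\<close>

context analytic_density
begin

lemma slice_integral_measurable:
  assumes [measurable]: "k \<in> borel_measurable borel"
  shows "(\<lambda>x. LINT v|lborel. k v * f (x, v)) \<in> borel_measurable borel"
proof -
  have f0m: "f0 \<in> borel_measurable (lborel \<Otimes>\<^sub>M lborel)" unfolding lborel_prod by simp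
  have "(LINT v|lborel. k v * f (x, v)) = (LINT v|lborel. k v * f0 (x, v))" for x
  proof (rule integral_cong_AE)
    show "AE v in lborel. k v * f (x, v) = k v * f0 (x, v)"
      using AE_f0_1d[of x] by eventually_elim simp
  qed measurable
  moreover have "(\<lambda>x. LINT v|lborel. k v * f0 (x, v)) \<in> borel_measurable lborel"
    by (rule lborel.borel_measurable_lebesgue_integral) (use f0m in measurable)
  ultimately show ?thesis by simp
qed

text \<open>Testing with \<open>\<theta> (k v)\<close>, \<open>k \<rightarrow> \<infinity>\<close>, isolates the jump of \<open>f\<close> across \<open>v = 0\<close>.\<close>

lemma weak_profile_jump:
  assumes hm: "h \<in> borel_measurable borel"
    and hb: "\<And>a b. \<exists>B. AE x in lborel. x \<in> {a..b} \<longrightarrow> \<bar>h x\<bar> \<le> B"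
    and weak: "\<And>\<phi> \<theta>. test_fun \<phi> \<Longrightarrow> test_fun \<theta> \<Longrightarrow>
       (LINT x|lborel. h x * \<phi> x * (LINT v|lborel. deriv \<theta> v * f (x, v))
          - deriv \<phi> x * (LINT v|lborel. v * \<theta> v * f (x, v))) = 0"
    and gc: "continuous_on UNIV g"
    and F1c: "\<And>z. e1 \<le> z \<Longrightarrow> isCont F1 z" and F2c: "\<And>z. e1 \<le> z \<Longrightarrow> isCont F2 z"
    and f1: "\<And>x v. v > 0 \<Longrightarrow> f (x, v) = F1 (v\<^sup>2 / 2 + g x)"
    and f2: "\<And>x v. v < 0 \<Longrightarrow> f (x, v) = F2 (v\<^sup>2 / 2 + g x)"
    and low: "\<And>x. x \<in> {p..q} \<Longrightarrow> e1 \<le> g x"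
    and \<phi>: "test_fun \<phi>" and supp: "\<And>x. \<phi> x \<noteq> 0 \<Longrightarrow> x \<in> {p..q}"
  shows "(LINT x|lborel. h x * \<phi> x * (F2 (g x) - F1 (g x))) = 0"
proof -
  \<comment> \<open>This bump rises from 0 to 1 on [-1, 0] and falls back to 0 on [0, 1]. Its
    derivative thus has integral 1 over negative and -1 over positive velocities, which produces
    \<open>F2 - F1\<close> in the limit.\<close>
  define \<theta> where "\<theta> = bump (- 1) 0 0"
  have \<theta>: "test_fun \<theta>" unfolding \<theta>_def by (rule test_fun_bump) simp
  have C: "C_order k \<theta>" for k using \<theta> by (simp add: test_fun_def)
  have \<theta>d: "(\<theta> has_real_derivative deriv \<theta> v) (at v)" for v by (rule C_order_real_deriv(1)[OF C])
  have \<theta>supp: "\<theta> v \<noteq> 0 \<Longrightarrow> v \<in> {-1..1}" for v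
    using bump_support'[of "- 1" 0 0 v] by (simp add: \<theta>_def)
  have \<theta>'supp: "deriv \<theta> v \<noteq> 0 \<Longrightarrow> v \<in> {-1..1}" for v by (rule test_fun_deriv_support[OF \<theta> \<theta>supp])
  have \<theta>vals: "\<theta> 0 = 1" "\<theta> 1 = 0" "\<theta> (- 1) = 0" by (simp_all add: \<theta>_def bump_def smooth_step_simps)
  obtain C1 where C1: "C1 \<ge> 0" "\<And>v. \<bar>\<theta> v\<bar> \<le> C1" "\<And>v. \<bar>deriv \<theta> v\<bar> \<le> C1"
    using test_fun_bounds[OF \<theta>] by metis
  obtain C2 where C2: "C2 \<ge> 0" "\<And>v. \<bar>\<phi> v\<bar> \<le> C2" "\<And>v. \<bar>deriv \<phi> v\<bar> \<le> C2"
    using test_fun_bounds[OF \<phi>] by metis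
  have \<phi>'supp: "deriv \<phi> x \<noteq> 0 \<Longrightarrow> x \<in> {p..q}" for x by (rule test_fun_deriv_support[OF \<phi> supp])
  note [measurable] = test_fun_measurable[OF \<theta>] test_fun_measurable[OF \<phi>] hm
  have "bounded (g ` {p..q})"
    by (intro compact_imp_bounded compact_continuous_image continuous_on_subset[OF gc]) auto
  then obtain G where G: "\<And>x. x \<in> {p..q} \<Longrightarrow> \<bar>g x\<bar> \<le> G" unfolding bounded_iff by (metis image_eqI real_norm_def)
  have bF: "\<exists>B. \<forall>z\<in>{e1..G + 1}. \<bar>F z\<bar> \<le> B" if "\<And>z. e1 \<le> z \<Longrightarrow> isCont F z" for F :: "real \<Rightarrow> real"
  proof -
    have "continuous_on {e1..G + 1} F" by (intro continuous_at_imp_continuous_on ballI that) simp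
    then have "bounded (F ` {e1..G + 1})" by (intro compact_imp_bounded compact_continuous_image) auto
    then show ?thesis unfolding bounded_iff by auto
  qed
  obtain B1 where B1: "\<forall>z\<in>{e1..G + 1}. \<bar>F1 z\<bar> \<le> B1" using bF[OF F1c] by blast
  obtain B2 where B2: "\<forall>z\<in>{e1..G + 1}. \<bar>F2 z\<bar> \<le> B2" using bF[OF F2c] by blast
  define B where "B = max 0 (max B1 B2)"
  have fB: "\<bar>f (x, v)\<bar> \<le> B" if "x \<in> {p..q}" "v \<noteq> 0" "\<bar>v\<bar> \<le> 1" for x v
  proof -
    have "v\<^sup>2 \<le> 1" using that(3) by (simp add: abs_square_le_1)
    moreover have "0 \<le> v\<^sup>2" by (rule zero_le_power2)
    ultimately have "v\<^sup>2 / 2 + g x \<in> {e1..G + 1}"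
      using low[OF that(1)] G[OF that(1)] unfolding atLeastAtMost_iff abs_le_iff by linarith
    then have "\<bar>F1 (v\<^sup>2 / 2 + g x)\<bar> \<le> B" "\<bar>F2 (v\<^sup>2 / 2 + g x)\<bar> \<le> B"
      using B1 B2 by (force simp: B_def)+
    then show ?thesis using f1[of v x] f2[of v x] that(2) by (cases "v > 0") auto
  qed
  have B0: "B \<ge> 0" by (simp add: B_def)
  define t where "t k = real (Suc k)" for k
  have t: "t k \<ge> 1" "t k > 0" "t k \<noteq> 0" for k by (simp_all add: t_def)
  define \<theta>t where "\<theta>t k v = \<theta> (0 + t k * v)" for k v
  have \<theta>t: "test_fun (\<theta>t k)" for k unfolding \<theta>t_def[abs_def] by (rule test_fun_affine[OF \<theta> t(3)])
  have d\<theta>t: "deriv (\<theta>t k) v = t k * deriv \<theta> (t k * v)" for k v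
  proof (rule DERIV_imp_deriv)
    have "((\<lambda>v. 0 + t k * v) has_real_derivative t k) (at v)" by (auto intro!: derivative_eq_intros)
    from DERIV_chain2[OF C_order_real_deriv(1)[OF C] this]
    show "(\<theta>t k has_real_derivative t k * deriv \<theta> (t k * v)) (at v)" unfolding \<theta>t_def[abs_def] by (simp add: mult.commute)
  qed
  define L where "L k x = (LINT v|lborel. deriv (\<theta>t k) v * f (x, v))" for k x
  define K where "K k x = (LINT v|lborel. v * \<theta>t k v * f (x, v))" for k x
  note [measurable] = test_fun_measurable[OF \<theta>t]
  have Lm [measurable]: "L k \<in> borel_measurable borel" for k
    unfolding L_def[abs_def] by (rule slice_integral_measurable) measurable
  have Km [measurable]: "K k \<in> borel_measurable borel" for k
    unfolding K_def[abs_def] by (rule slice_integral_measurable) measurable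
  have aff: "(LINT v|lborel. H v) = inverse (t k) * (LINT y|lborel. H (inverse (t k) * y))" for H :: "real \<Rightarrow> real" and k
    using lborel_integral_real_affine[of "inverse (t k)" H 0] t[of k] by simp
  have L_eq: "L k x = (LINT y|lborel. deriv \<theta> y * f (x, inverse (t k) * y))" for k x
  proof -
    have "L k x = inverse (t k) * (LINT y|lborel. t k * (deriv \<theta> y * f (x, inverse (t k) * y)))"
      unfolding L_def d\<theta>t by (subst aff[of _ k]) (simp add: t mult.assoc[symmetric])
    then show ?thesis using t[of k] by simp
  qed
  \<comment> \<open>Both the factor \<open>v\<close> and the differential contribute
    \<open>1 / t k\<close>, so this term disappears in the limit. In \<open>L\<close> the factor
    \<open>t k\<close> from differentiating the rescaled test function offsets the differential, and
    the limit is nontrivial.\<close>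
  have K_eq: "K k x = inverse (t k) * inverse (t k) * (LINT y|lborel. y * \<theta> y * f (x, inverse (t k) * y))" for k x
  proof -
    have "K k x = inverse (t k) * (LINT y|lborel. inverse (t k) * (y * \<theta> y * f (x, inverse (t k) * y)))"
      unfolding K_def \<theta>t_def by (subst aff[of _ k]) (simp add: t mult.assoc[symmetric])
    then show ?thesis by simp
  qed
  have fm [measurable]: "(\<lambda>y. f (x, c * y)) \<in> borel_measurable borel" for x c
    by (rule measurable_compose[OF _ slice_measurable]) measurable
  have scaled: "\<bar>f (x, inverse (t k) * y)\<bar> \<le> B" if "x \<in> {p..q}" "y \<noteq> 0" "y \<in> {-1..1}" for x y k
  proof (rule fB[OF that(1)])
    show "inverse (t k) * y \<noteq> 0" using that(2) t by simp
    have "inverse (t k) \<le> 1" using t(1)[of k] by (simp add: field_simps)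
    then have "inverse (t k) * \<bar>y\<bar> \<le> 1 * 1" using that(3) t(2)[of k] by (intro mult_mono) auto
    then show "\<bar>inverse (t k) * y\<bar> \<le> 1" using t(2)[of k] by (simp add: abs_mult)
  qed
  have bint: "\<bar>LINT y|lborel. c y * f (x, inverse (t k) * y)\<bar> \<le> C1 * B * 2"
    if x: "x \<in> {p..q}" and c: "c \<in> borel_measurable borel" "\<And>y. y \<notin> {-1..1} \<Longrightarrow> c y = 0" "\<And>y. y \<in> {-1..1} \<Longrightarrow> \<bar>c y\<bar> \<le> C1" for c x k
  proof -
    have "(LINT y|lborel. c y * f (x, inverse (t k) * y)) = (LINT y:{-1..1}|lborel. c y * f (x, inverse (t k) * y))"
      unfolding set_lebesgue_integral_def
      by (intro Bochner_Integration.integral_cong) (use c(2) in \<open>auto simp: indicator_def\<close>)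
    also have "\<bar>\<dots>\<bar> \<le> C1 * B * (1 - (- 1))"
    proof (rule AE_bounded_set_integral(2))
      show "(\<lambda>y. c y * f (x, inverse (t k) * y)) \<in> borel_measurable borel" using c(1) by measurable
      show "AE y in lborel. y \<in> {-1..1} \<longrightarrow> \<bar>c y * f (x, inverse (t k) * y)\<bar> \<le> C1 * B"
        using AE_lborel_singleton[of 0]
        by eventually_elim (use scaled[OF x] c(3) C1(1) in \<open>auto simp: abs_mult intro!: mult_mono\<close>)
    qed simp
    finally show ?thesis by simp
  qed
  have Lb: "\<bar>L k x\<bar> \<le> C1 * B * 2" if "x \<in> {p..q}" for k x
    unfolding L_eq by (rule bint[OF that]) (use \<theta>'supp C1 in auto)
  have Kb: "\<bar>K k x\<bar> \<le> inverse (t k) * (C1 * B * 2)" if "x \<in> {p..q}" for k x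
  proof -
    have "\<bar>LINT y|lborel. (y * \<theta> y) * f (x, inverse (t k) * y)\<bar> \<le> C1 * B * 2"
    proof (rule bint[OF that])
      show "\<bar>y * \<theta> y\<bar> \<le> C1" if "y \<in> {-1..1}" for y
        using mult_mono[of "\<bar>y\<bar>" 1 "\<bar>\<theta> y\<bar>" C1] that C1(2) by (auto simp: abs_mult)
    qed (use \<theta>supp in auto)
    moreover have "inverse (t k) * inverse (t k) \<le> inverse (t k)" using t[of k] by (simp add: field_simps)
    ultimately have "inverse (t k) * inverse (t k) * \<bar>LINT y|lborel. (y * \<theta> y) * f (x, inverse (t k) * y)\<bar> \<le> inverse (t k) * (C1 * B * 2)"
      using t(2)[of k] by (intro mult_mono) auto
    then show ?thesis unfolding K_eq using t(2)[of k] by (simp add: abs_mult)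
  qed
  have Kb': "\<bar>K k x\<bar> \<le> C1 * B * 2" if "x \<in> {p..q}" for k x
  proof -
    have "inverse (t k) \<le> 1" using t(1)[of k] by (simp add: field_simps)
    then have "inverse (t k) * (C1 * B * 2) \<le> 1 * (C1 * B * 2)" using C1(1) B0 by (intro mult_right_mono) auto
    then show ?thesis using Kb[OF that, of k] by linarith
  qed
  have tlim: "(\<lambda>k. inverse (t k)) \<longlonglongrightarrow> 0" unfolding t_def by (rule LIMSEQ_inverse_real_of_nat)
  have Klim: "(\<lambda>k. K k x) \<longlonglongrightarrow> 0" if "x \<in> {p..q}" for x
  proof (rule Lim_null_comparison)
    show "eventually (\<lambda>k. norm (K k x) \<le> inverse (t k) * (C1 * B * 2)) sequentially" using Kb[OF that] by simp
    show "(\<lambda>k. inverse (t k) * (C1 * B * 2)) \<longlonglongrightarrow> 0" using tendsto_mult_right[OF tlim, of "C1 * B * 2"] by simp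
  qed
  have Llim: "(\<lambda>k. L k x) \<longlonglongrightarrow> F2 (g x) - F1 (g x)" if x: "x \<in> {p..q}" for x
  proof -
    let ?lim = "\<lambda>y. deriv \<theta> y * (if y > 0 then F1 (g x) else F2 (g x))"
    have "(\<lambda>k. LINT y|lborel. deriv \<theta> y * f (x, inverse (t k) * y)) \<longlonglongrightarrow> (LINT y|lborel. ?lim y)"
    proof (rule integral_dominated_convergence[where w = "\<lambda>y. C1 * B * indicator {-1..1} y"])
      show "integrable lborel (\<lambda>y. C1 * B * indicator {-1..1::real} y)"
        by (intro integrable_mult_right integrable_real_indicator) (auto simp: emeasure_lborel_Icc_eq)
      show "AE y in lborel. (\<lambda>k. deriv \<theta> y * f (x, inverse (t k) * y)) \<longlonglongrightarrow> ?lim y"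
        using AE_lborel_singleton[of 0]
      proof eventually_elim
        case (elim y)
        have "(\<lambda>k. inverse (t k) * y) \<longlonglongrightarrow> 0" using tendsto_mult_right[OF tlim, of y] by simp
        then have E: "(\<lambda>k. (inverse (t k) * y)\<^sup>2 / 2 + g x) \<longlonglongrightarrow> 0\<^sup>2 / 2 + g x" by (intro tendsto_intros) auto
        have "(\<lambda>k. F1 ((inverse (t k) * y)\<^sup>2 / 2 + g x)) \<longlonglongrightarrow> F1 (g x)"
          "(\<lambda>k. F2 ((inverse (t k) * y)\<^sup>2 / 2 + g x)) \<longlonglongrightarrow> F2 (g x)"
          using isCont_tendsto_compose[OF F1c E] isCont_tendsto_compose[OF F2c E] low[OF x] by simp_all
        moreover have "f (x, inverse (t k) * y) = (if y > 0 then F1 ((inverse (t k) * y)\<^sup>2 / 2 + g x) else F2 ((inverse (t k) * y)\<^sup>2 / 2 + g x))" for k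
          using elim t(2)[of k] by (auto intro!: f1 f2 simp: mult_less_0_iff zero_less_mult_iff)
        ultimately show ?case by (cases "y > 0") (auto intro!: tendsto_mult)
      qed
      show "AE y in lborel. norm (deriv \<theta> y * f (x, inverse (t k) * y)) \<le> C1 * B * indicator {-1..1} y" for k
        using AE_lborel_singleton[of 0]
      proof eventually_elim
        case (elim y)
        show ?case
        proof (cases "y \<in> {-1..1}")
          case True
          have "\<bar>deriv \<theta> y\<bar> * \<bar>f (x, inverse (t k) * y)\<bar> \<le> C1 * B"
            by (rule mult_mono[OF C1(3) scaled[OF x elim True] C1(1)]) simp
          then show ?thesis using True by (simp add: abs_mult)
        qed (use \<theta>'supp in auto)
      qed
    qed measurable
    also have "(LINT y|lborel. ?lim y) = F2 (g x) - F1 (g x)"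
    proof -
      have c: "continuous_on S (deriv \<theta>)" for S
        using C_order_continuous[OF C_order_real_deriv(2)[OF C, of 0]] continuous_on_subset by blast
      define J where "J a b y = indicator {a..b} y *\<^sub>R deriv \<theta> y" for a b y
      have FTC: "(LINT y|lborel. J a b y) = \<theta> b - \<theta> a" if "a \<le> b" for a b
        unfolding J_def
        by (rule integral_FTC_atLeastAtMost[OF that _ c])
           (use \<theta>d in \<open>simp add: has_real_derivative_iff_has_vector_derivative has_vector_derivative_at_within\<close>)
      have i: "integrable lborel (J a b)" for a b
        using borel_integrable_atLeastAtMost'[OF c] unfolding set_integrable_def J_def[abs_def] .
      have "(LINT y|lborel. ?lim y) = (LINT y|lborel. F1 (g x) * J 0 1 y + F2 (g x) * J (- 1) 0 y)"
      proof (rule integral_cong_AE)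
        show "AE y in lborel. ?lim y = F1 (g x) * J 0 1 y + F2 (g x) * J (- 1) 0 y"
          using AE_lborel_singleton[of 0]
          by eventually_elim (use \<theta>'supp in \<open>auto simp: J_def indicator_def\<close>)
      qed (use i in measurable)
      also have "\<dots> = F1 (g x) * (\<theta> 1 - \<theta> 0) + F2 (g x) * (\<theta> 0 - \<theta> (- 1))"
        using i by (simp add: Bochner_Integration.integral_add FTC)
      finally show ?thesis by (simp add: \<theta>vals)
    qed
    finally show ?thesis unfolding L_eq .
  qed
  obtain Bh0 where Bh0: "AE x in lborel. x \<in> {p..q} \<longrightarrow> \<bar>h x\<bar> \<le> Bh0" using hb by blast
  define Bh where "Bh = \<bar>Bh0\<bar>"
  have Bh: "Bh \<ge> 0" "AE x in lborel. x \<in> {p..q} \<longrightarrow> \<bar>h x\<bar> \<le> Bh"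
    using Bh0 by (auto simp: Bh_def elim!: eventually_mono)
  define W where "W x = h x * \<phi> x * (indicator {p..q} x *\<^sub>R (F2 (g x) - F1 (g x)))" for x
  have Fgm: "(\<lambda>x. indicator {p..q} x *\<^sub>R (F2 (g x) - F1 (g x))) \<in> borel_measurable borel"
  proof (rule borel_measurable_continuous_on_indicator)
    show "continuous_on {p..q} (\<lambda>x. F2 (g x) - F1 (g x))"
    proof (intro continuous_on_diff continuous_at_imp_continuous_on ballI)
      fix x assume x: "x \<in> {p..q}"
      have gx: "isCont g x" using gc by (simp add: continuous_on_eq_continuous_at)
      show "isCont (\<lambda>x. F2 (g x)) x" "isCont (\<lambda>x. F1 (g x)) x"
        by (rule isCont_o2[OF gx F2c[OF low[OF x]]], rule isCont_o2[OF gx F1c[OF low[OF x]]])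
    qed
  qed simp
  define D where "D = Bh * C2 * (C1 * B * 2) + C2 * (C1 * B * 2)"
  have "(\<lambda>k. LINT x|lborel. h x * \<phi> x * L k x - deriv \<phi> x * K k x) \<longlonglongrightarrow> (LINT x|lborel. W x)"
  proof (rule integral_dominated_convergence[where w = "\<lambda>x. D * indicator {p..q} x"])
    show "integrable lborel (\<lambda>x. D * indicator {p..q} x)"
      by (intro integrable_mult_right integrable_real_indicator) (auto simp: emeasure_lborel_Icc_eq)
    show "W \<in> borel_measurable lborel" unfolding W_def[abs_def] using Fgm by measurable
    show "(\<lambda>x. h x * \<phi> x * L k x - deriv \<phi> x * K k x) \<in> borel_measurable lborel" for k by measurable
    show "AE x in lborel. (\<lambda>k. h x * \<phi> x * L k x - deriv \<phi> x * K k x) \<longlonglongrightarrow> W x"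
    proof (rule AE_I2)
      fix x
      show "(\<lambda>k. h x * \<phi> x * L k x - deriv \<phi> x * K k x) \<longlonglongrightarrow> W x"
      proof (cases "x \<in> {p..q}")
        case True
        have "(\<lambda>k. h x * \<phi> x * L k x - deriv \<phi> x * K k x) \<longlonglongrightarrow> h x * \<phi> x * (F2 (g x) - F1 (g x)) - deriv \<phi> x * 0"
          by (intro tendsto_intros Llim Klim True)
        then show ?thesis using True by (simp add: W_def)
      next
        case False
        then show ?thesis using supp \<phi>'supp by (force simp: W_def)
      qed
    qed
    show "AE x in lborel. norm (h x * \<phi> x * L k x - deriv \<phi> x * K k x) \<le> D * indicator {p..q} x" for k
      using Bh(2)
    proof eventually_elim
      case (elim x)
      show ?case
      proof (cases "x \<in> {p..q}")
        case True
        have "\<bar>h x * \<phi> x * L k x\<bar> \<le> Bh * C2 * (C1 * B * 2)"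
          unfolding abs_mult using elim True C2 Lb[OF True] Bh(1) by (intro mult_mono mult_nonneg_nonneg) auto
        moreover have "\<bar>deriv \<phi> x * K k x\<bar> \<le> C2 * (C1 * B * 2)"
          unfolding abs_mult using C2 Kb'[OF True] by (intro mult_mono) auto
        ultimately have "\<bar>h x * \<phi> x * L k x - deriv \<phi> x * K k x\<bar> \<le> D" unfolding D_def by linarith
        then show ?thesis using True by simp
      next
        case False
        then have "\<phi> x = 0" "deriv \<phi> x = 0" using supp \<phi>'supp by auto
        then show ?thesis using False by simp
      qed
    qed
  qed
  moreover have "(LINT x|lborel. h x * \<phi> x * L k x - deriv \<phi> x * K k x) = 0" for k
    using weak[OF \<phi> \<theta>t] unfolding L_def K_def .
  ultimately have "(LINT x|lborel. W x) = 0" by (simp add: LIMSEQ_const_iff)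
  moreover have "W x = h x * \<phi> x * (F2 (g x) - F1 (g x))" for x
    using supp[of x] by (auto simp: W_def indicator_def)
  ultimately show ?thesis by simp
qed

text \<open>The weak equation gives only that the integral of \<open>h\<close> times the jump is
  zero over small intervals. Freezing the jump \<open>D\<close> at \<open>x0\<close> shows that
  \<open>D x0 * g\<close> has increments the integral of \<open>h * (D x0 - D)\<close>, hence
  derivative zero at \<open>x0\<close>, which can be compared with \<open>D x0 * d\<close>.\<close>

lemma profile_jump_deriv_zero:
  assumes W: "weak_stationary_state \<Phi> f" and g: "g = potential \<Phi> f"
    and gc: "continuous_on UNIV g"
    and F1: "F1 real_analytic_on {z. \<exists>x. g x < z}" and F2: "F2 real_analytic_on {z. \<exists>x. g x < z}"
    and f1: "\<And>x v. v > 0 \<Longrightarrow> f (x, v) = F1 (v\<^sup>2 / 2 + g x)"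
    and f2: "\<And>x v. v < 0 \<Longrightarrow> f (x, v) = F2 (v\<^sup>2 / 2 + g x)"
    and E: "g y < g x0" and gd: "(g has_real_derivative d) (at x0)"
  shows "(F2 (g x0) - F1 (g x0)) * d = 0"
proof -
  obtain h where h: "h \<in> borel_measurable borel"
    "\<And>a b. \<exists>B. AE x in lborel. x \<in> {a..b} \<longrightarrow> \<bar>h x\<bar> \<le> B"
    "\<And>a b. a < b \<Longrightarrow> potential \<Phi> f b - potential \<Phi> f a = (LINT x:{a..b}|lborel. h x)"
    and weak: "\<And>\<phi> \<theta>. test_fun \<phi> \<Longrightarrow> test_fun \<theta> \<Longrightarrow>
       (LINT x|lborel. h x * \<phi> x * (LINT v|lborel. deriv \<theta> v * f (x, v))
          - deriv \<phi> x * (LINT v|lborel. v * \<theta> v * f (x, v))) = 0"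
    by (rule stationary_weak_form[OF W]) (rule that)
  \<comment> \<open>A level strictly between a lower value of \<open>g\<close> and
    \<open>g x0\<close>: both profiles are continuous from \<open>e1\<close> upwards, and
    \<open>g\<close> stays above \<open>e1\<close> near \<open>x0\<close>.\<close>
  define e1 where "e1 = (g y + g x0) / 2"
  have e1: "g y < e1" "e1 < g x0" using E by (simp_all add: e1_def)
  have F1c: "isCont F1 z" and F2c: "isCont F2 z" if "e1 \<le> z" for z
    using that e1(1) by (auto intro!: real_analytic_on_isCont[OF F1] real_analytic_on_isCont[OF F2] exI[of _ y])
  have gx: "isCont g x" for x using gc by (simp add: continuous_on_eq_continuous_at)
  obtain \<delta> where \<delta>: "\<delta> > 0" "\<And>x. dist x x0 < \<delta> \<Longrightarrow> dist (g x) (g x0) < g x0 - e1"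
    using gx[of x0] e1(2) unfolding continuous_at_eps_delta by (metis diff_gt_0_iff_gt)
  let ?I = "{x0 - \<delta> / 2..x0 + \<delta> / 2}"
  have low: "e1 \<le> g x" if "x \<in> ?I" for x
  proof -
    have "\<bar>x - x0\<bar> \<le> \<delta> / 2" using that unfolding atLeastAtMost_iff abs_le_iff by linarith
    then have "dist x x0 < \<delta>" using \<delta>(1) by (simp add: dist_real_def)
    then have "\<bar>g x - g x0\<bar> < g x0 - e1" using \<delta>(2) unfolding dist_real_def by blast
    then show ?thesis by (simp add: abs_less_iff)
  qed
  define D where "D x = indicator ?I x *\<^sub>R (F2 (g x) - F1 (g x))" for x
  have Dc: "isCont (\<lambda>x. F2 (g x) - F1 (g x)) x" if "x \<in> ?I" for x
    by (intro continuous_intros isCont_o2[OF gx F2c[OF low[OF that]]] isCont_o2[OF gx F1c[OF low[OF that]]])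
  have Dm: "D \<in> borel_measurable borel"
    unfolding D_def[abs_def]
    by (rule borel_measurable_continuous_on_indicator) (use Dc in \<open>auto intro: continuous_at_imp_continuous_on\<close>)
  have D_isCont: "isCont D x0"
  proof -
    have "eventually (\<lambda>x. F2 (g x) - F1 (g x) = D x) (nhds x0)"
      unfolding eventually_nhds_metric
    proof (intro exI[of _ "\<delta> / 2"] conjI allI impI)
      fix x assume "dist x x0 < \<delta> / 2"
      then have "x \<in> ?I" unfolding dist_real_def abs_less_iff atLeastAtMost_iff by linarith
      then show "F2 (g x) - F1 (g x) = D x" by (simp add: D_def)
    qed (use \<delta>(1) in simp)
    then show ?thesis using iffD1[OF isCont_cong Dc[of x0]] \<delta>(1) by simp
  qed
  have hDm: "(\<lambda>x. h x * D x) \<in> borel_measurable borel" using h(1) Dm by measurable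
  have "bounded ((\<lambda>x. F2 (g x) - F1 (g x)) ` ?I)"
    by (intro compact_imp_bounded compact_continuous_image continuous_at_imp_continuous_on ballI Dc) auto
  then obtain BD where BD: "\<And>x. x \<in> ?I \<Longrightarrow> \<bar>F2 (g x) - F1 (g x)\<bar> \<le> BD"
    unfolding bounded_iff by (metis (no_types, lifting) image_eqI real_norm_def)
  have BD0: "BD \<ge> 0" using BD[of x0] \<delta>(1) by auto
  have DB: "\<bar>D x\<bar> \<le> BD" for x using BD[of x] BD0 by (auto simp: D_def indicator_def)
  have hDi: "set_integrable lborel {a..b} (\<lambda>x. h x * D x)" for a b
  proof (cases "a \<le> b")
    case True
    obtain B where B: "AE x in lborel. x \<in> {a..b} \<longrightarrow> \<bar>h x\<bar> \<le> B" using h(2) by blast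
    show ?thesis
    proof (rule AE_bounded_set_integral(1)[OF hDm True])
      show "AE x in lborel. x \<in> {a..b} \<longrightarrow> \<bar>h x * D x\<bar> \<le> \<bar>B\<bar> * BD"
        using B
      proof (eventually_elim, intro impI)
        fix x assume "x \<in> {a..b} \<longrightarrow> \<bar>h x\<bar> \<le> B" "x \<in> {a..b}"
        then show "\<bar>h x * D x\<bar> \<le> \<bar>B\<bar> * BD" unfolding abs_mult using DB[of x] by (intro mult_mono) auto
      qed
    qed
  qed (simp add: set_integrable_def)
  have hD0: "(LINT x:{a..b}|lborel. h x * D x) = 0" if ab: "a < b" "{a..b} \<subseteq> ball x0 (\<delta> / 2)" for a b
  proof -
    have ab': "x0 - \<delta> / 2 < a" "b < x0 + \<delta> / 2"
    proof -
      have "a \<in> ball x0 (\<delta> / 2)" "b \<in> ball x0 (\<delta> / 2)"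
        by (rule subsetD[OF ab(2)], use ab(1) in simp)+
      then have "\<bar>x0 - a\<bar> < \<delta> / 2" "\<bar>x0 - b\<bar> < \<delta> / 2" unfolding mem_ball dist_real_def by blast+
      then show "x0 - \<delta> / 2 < a" "b < x0 + \<delta> / 2" unfolding abs_less_iff by auto
    qed
    \<comment> \<open>The falling edge of the bump reaches beyond \<open>b\<close> by
      \<open>1 / (n + 1)\<close>; from \<open>N\<close> on it stays inside \<open>?I\<close>, where
      \<open>g\<close> is at least \<open>e1\<close>.\<close>
    obtain N where N: "inverse (real (Suc N)) < x0 + \<delta> / 2 - b"
      using reals_Archimedean[of "x0 + \<delta> / 2 - b"] ab'(2) by auto
    have "(LINT x|lborel. h x * D x * bump a b n x) = 0" if n: "n \<ge> N" for n
    proof -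
      have supp: "x \<in> ?I" if "bump a b n x \<noteq> 0" for x
      proof -
        have "1 / real (Suc n) \<le> 1 / real (Suc N)" using n by (intro divide_left_mono) auto
        then show ?thesis using bump_support[OF ab(1) that] ab' N by (auto simp: inverse_eq_divide)
      qed
      have "(LINT x|lborel. h x * bump a b n x * (F2 (g x) - F1 (g x))) = 0"
        by (rule weak_profile_jump[OF h(1,2) weak gc F1c F2c f1 f2 low test_fun_bump[OF ab(1)] supp])
      moreover have "h x * D x * bump a b n x = h x * bump a b n x * (F2 (g x) - F1 (g x))" for x
        using supp[of x] by (cases "bump a b n x = 0") (auto simp: D_def)
      ultimately show ?thesis by (simp only:)
    qed
    then have "eventually (\<lambda>n. (LINT x|lborel. h x * D x * bump a b n x) = 0) sequentially"
      unfolding eventually_sequentially by blast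
    then have "(\<lambda>n. LINT x|lborel. h x * D x * bump a b n x) \<longlonglongrightarrow> 0" by (rule tendsto_eventually)
    moreover have "(\<lambda>n. LINT x|lborel. h x * D x * bump a b n x) \<longlonglongrightarrow> (LINT x:{a..b}|lborel. h x * D x)"
      by (rule bump_integral_tendsto[OF hDm hDi ab(1)])
    ultimately show ?thesis using LIMSEQ_unique by blast
  qed
  have "((\<lambda>x. D x0 * g x) has_real_derivative 0) (at x0)"
  proof (rule integral_increment_deriv_zero[OF h(1,2) Dm D_isCont, of "\<delta> / 2"])
    fix a b :: real assume ab: "a < b" "{a..b} \<subseteq> ball x0 (\<delta> / 2)"
    have hi: "set_integrable lborel {a..b} h"
      by (meson AE_bounded_set_integral(1) h(1,2) less_imp_le ab(1))
    have "D x0 * g b - D x0 * g a = D x0 * (LINT x:{a..b}|lborel. h x)"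
      using h(3)[OF ab(1)] by (simp add: g right_diff_distrib[symmetric])
    also have "\<dots> = (LINT x:{a..b}|lborel. D x0 * h x) - (LINT x:{a..b}|lborel. h x * D x)"
      using hD0[OF ab] by simp
    also have "\<dots> = (LINT x:{a..b}|lborel. D x0 * h x - h x * D x)"
      using hi hDi by (subst set_integral_diff(2)) (auto intro: set_integrable_mult_right)
    also have "\<dots> = (LINT x:{a..b}|lborel. h x * (D x0 - D x))" by (simp add: algebra_simps)
    finally show "D x0 * g b - D x0 * g a = (LINT x:{a..b}|lborel. h x * (D x0 - D x))" .
  qed (use \<delta>(1) in simp)
  moreover have "((\<lambda>x. D x0 * g x) has_real_derivative D x0 * d) (at x0)" using gd by (rule DERIV_cmult)
  ultimately have "D x0 * d = 0" using DERIV_unique by blast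
  then show ?thesis using \<delta>(1) by (simp add: D_def)
qed

end

section \<open>The characterisation of stationary states\<close>

lemma energy_range_eq: "energy_range \<Phi> f = {z. \<exists>x. potential \<Phi> f x < z}"
  by (auto simp: energy_range_def INF_less_iff)

lemma countable_zeros_of_analytic:
  assumes F: "F real_analytic_on UNIV" and nz: "F y \<noteq> 0"
  shows "countable {x. F x = 0}"
proof -
  have "finite ({x. F x = 0} \<inter> {- real n..real n})" for n
  proof (rule ccontr)
    assume "infinite ({x. F x = 0} \<inter> {- real n..real n})"
    then obtain x where "x islimpt ({x. F x = 0} \<inter> {- real n..real n})"
      using Heine_Borel_imp_Bolzano_Weierstrass[of "{- real n..real n}"] by auto
    then have "x islimpt {x. F x = 0}" by (rule islimpt_subset) simp
    then have "F y = 0" by (intro real_analytic_identity[OF F open_UNIV connected_UNIV]) auto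
    then show False using nz by simp
  qed
  then have "countable (\<Union>n. {x. F x = 0} \<inter> {- real n..real n})"
    by (intro countable_UN) (auto intro: countable_finite)
  moreover have "{x. F x = 0} \<subseteq> (\<Union>n. {x. F x = 0} \<inter> {- real n..real n})"
  proof
    fix x assume x: "x \<in> {x. F x = 0}"
    obtain n :: nat where "\<bar>x\<bar> \<le> real n" using real_arch_simple by blast
    then have "x \<in> {- real n..real n}" by (auto simp: abs_le_iff)
    then show "x \<in> (\<Union>n. {x. F x = 0} \<inter> {- real n..real n})" using x by blast
  qed
  ultimately show ?thesis by (rule countable_subset[rotated])
qed

lemma constant_on_UNIV_of_deriv_zero:
  fixes g :: "real \<Rightarrow> real"
  assumes "\<And>x. (g has_real_derivative 0) (at x)" shows "g constant_on UNIV"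
proof -
  have "\<exists>c. \<forall>x\<in>UNIV. g x = c" by (rule has_field_derivative_zero_constant) (use assms in auto)
  then show ?thesis unfolding constant_on_def .
qed

context analytic_density
begin

lemma slice_reflect_integrable: "integrable lborel (\<lambda>v. f (x, - v))"
  using lborel_integrable_real_affine[OF slice_integrable[of x], of "- 1" 0] by simp

lemma rho_eq_halflines:
  "integrable lborel (\<lambda>v. indicator {0<..} v *\<^sub>R (f (x, v) + f (x, - v)))"
  "rho f x = (LINT v|lborel. indicator {0<..} v *\<^sub>R (f (x, v) + f (x, - v)))"
proof -
  have ip: "integrable lborel (\<lambda>v. indicator {0<..} v *\<^sub>R f (x, v))"
    by (rule integrable_mult_indicator[OF _ slice_integrable]) simp
  have im: "integrable lborel (\<lambda>v. indicator {..<0} v *\<^sub>R f (x, v))"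
    by (rule integrable_mult_indicator[OF _ slice_integrable]) simp
  have ir: "integrable lborel (\<lambda>v. indicator {0<..} v *\<^sub>R f (x, - v))"
    by (rule integrable_mult_indicator[OF _ slice_reflect_integrable]) simp
  have sum: "(\<lambda>v. indicator {0<..} v *\<^sub>R (f (x, v) + f (x, - v)))
      = (\<lambda>v. indicator {0<..} v *\<^sub>R f (x, v) + indicator {0<..} v *\<^sub>R f (x, - v))"
    by (simp only: scaleR_add_right)
  show "integrable lborel (\<lambda>v. indicator {0<..} v *\<^sub>R (f (x, v) + f (x, - v)))"
    unfolding sum using ip ir by (rule Bochner_Integration.integrable_add)
  have "rho f x = (LINT v|lborel. f (x, v))"
    unfolding rho_def by (rule integral_completion) measurable
  also have "\<dots> = (LINT v|lborel. indicator {0<..} v *\<^sub>R f (x, v) + indicator {..<0} v *\<^sub>R f (x, v))"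
  proof (rule integral_cong_AE)
    show "AE v in lborel. f (x, v) = indicator {0<..} v *\<^sub>R f (x, v) + indicator {..<0} v *\<^sub>R f (x, v)"
      using AE_lborel_singleton[of 0] by eventually_elim (auto simp: indicator_def)
  qed (use ip im in measurable)
  also have "\<dots> = (LINT v|lborel. indicator {0<..} v *\<^sub>R f (x, v)) + (LINT v|lborel. indicator {..<0} v *\<^sub>R f (x, v))"
    by (rule Bochner_Integration.integral_add[OF ip im])
  also have "(LINT v|lborel. indicator {..<0} v *\<^sub>R f (x, v)) = (LINT v|lborel. indicator {0<..} v *\<^sub>R f (x, - v))"
  proof -
    have "(LINT v|lborel. indicator {..<0} v *\<^sub>R f (x, v)) = (LINT v|lborel. indicator {..<0} (- v) *\<^sub>R f (x, - v))"
      using lborel_integral_real_affine[of "- 1" "\<lambda>v. indicator {..<0} v *\<^sub>R f (x, v)" 0] by simp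
    also have "\<dots> = (LINT v|lborel. indicator {0<..} v *\<^sub>R f (x, - v))"
      by (intro Bochner_Integration.integral_cong) (auto simp: indicator_def)
    finally show ?thesis .
  qed
  also have "(LINT v|lborel. indicator {0<..} v *\<^sub>R f (x, v)) + (LINT v|lborel. indicator {0<..} v *\<^sub>R f (x, - v))
      = (LINT v|lborel. indicator {0<..} v *\<^sub>R (f (x, v) + f (x, - v)))"
    unfolding sum by (rule Bochner_Integration.integral_add[OF ip ir, symmetric])
  finally show "rho f x = (LINT v|lborel. indicator {0<..} v *\<^sub>R (f (x, v) + f (x, - v)))" .
qed

text \<open>Negative velocities are folded onto positive ones; stationarity plays no part.
  Integrability is stated separately because the integral of a non-integrable function is 0 by
  convention.\<close>

lemma profiles_rho:
  assumes P: "energy_profiles \<Phi> f F1 F2"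
  shows "set_integrable lebesgue {0<..} (\<lambda>v. F1 (v\<^sup>2 / 2 + \<Phi> (rho f x)) + F2 (v\<^sup>2 / 2 + \<Phi> (rho f x)))"
    and "rho f x = (LINT v:{0<..}|lebesgue. F1 (v\<^sup>2 / 2 + \<Phi> (rho f x)) + F2 (v\<^sup>2 / 2 + \<Phi> (rho f x)))"
proof -
  let ?q = "\<lambda>v. indicator {0<..} v *\<^sub>R (F1 (v\<^sup>2 / 2 + \<Phi> (rho f x)) + F2 (v\<^sup>2 / 2 + \<Phi> (rho f x)))"
  have eq: "(\<lambda>v. indicator {0<..} v *\<^sub>R (f (x, v) + f (x, - v))) = ?q"
  proof
    fix v :: real
    show "indicator {0<..} v *\<^sub>R (f (x, v) + f (x, - v)) = ?q v"
      using P unfolding energy_profiles_def energy_def potential_def by (cases "v > 0") auto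
  qed
  note * = rho_eq_halflines[of x, unfolded eq]
  show "set_integrable lebesgue {0<..} (\<lambda>v. F1 (v\<^sup>2 / 2 + \<Phi> (rho f x)) + F2 (v\<^sup>2 / 2 + \<Phi> (rho f x)))"
    unfolding set_integrable_def using *(1) borel_measurable_integrable[OF *(1)] by (subst integrable_completion)
  show "rho f x = (LINT v:{0<..}|lebesgue. F1 (v\<^sup>2 / 2 + \<Phi> (rho f x)) + F2 (v\<^sup>2 / 2 + \<Phi> (rho f x)))"
    unfolding set_lebesgue_integral_def using *(2) borel_measurable_integrable[OF *(1)]
    by (subst integral_completion)
qed

lemma stationary_imp_profiles:
  assumes W: "weak_stationary_state \<Phi> f"
  obtains F1 F2 where "energy_profiles \<Phi> f F1 F2"
proof -
  let ?g = "potential \<Phi> f"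
  have half: "\<exists>F. F real_analytic_on {z. \<exists>x. ?g x < z} \<and> (\<forall>x v. v > 0 \<longrightarrow> f (x, s * v) = F (v\<^sup>2 / 2 + ?g x))"
    if s: "s = 1 \<or> s = - 1" for s
  proof -
    obtain h where "half_state (\<lambda>(x, v). f (x, s * v)) (\<lambda>(x, v). dx f (x, s * v)) (\<lambda>(x, v). s * dv f (x, s * v)) ?g h"
      by (rule stationary_half_state[OF W s])
    then interpret half_state "\<lambda>(x, v). f (x, s * v)" "\<lambda>(x, v). dx f (x, s * v)" "\<lambda>(x, v). s * dv f (x, s * v)" ?g h .
    obtain F where "F real_analytic_on {z. \<exists>x. ?g x < z}"
      "\<And>x v. v > 0 \<Longrightarrow> (\<lambda>(x, v). f (x, s * v)) (x, v) = F (v\<^sup>2 / 2 + ?g x)"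
      by (rule energy_profile_exists) (rule that)
    then show ?thesis by auto
  qed
  obtain F1 where F1: "F1 real_analytic_on {z. \<exists>x. ?g x < z}" "\<And>x v. v > 0 \<Longrightarrow> f (x, v) = F1 (v\<^sup>2 / 2 + ?g x)"
    using half[of 1] by auto
  obtain F2 where F2: "F2 real_analytic_on {z. \<exists>x. ?g x < z}" "\<And>x v. v > 0 \<Longrightarrow> f (x, - v) = F2 (v\<^sup>2 / 2 + ?g x)"
    using half[of "- 1"] by auto
  have "f (x, v) = F2 (v\<^sup>2 / 2 + ?g x)" if "v < 0" for x v
    using F2(2)[of "- v" x] that by simp
  then have "energy_profiles \<Phi> f F1 F2"
    unfolding energy_profiles_def energy_range_eq energy_def using F1 F2 by simp
  then show ?thesis by (rule that)
qed

lemma profiles_imp_analytic_potential: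
  assumes P: "energy_profiles \<Phi> f F1 F2"
    and nz: "z \<in> energy_range \<Phi> f" "F1 z \<noteq> 0 \<or> F2 z \<noteq> 0"
  shows "potential \<Phi> f real_analytic_on UNIV"
proof -
  let ?g = "potential \<Phi> f"
  have z: "\<exists>x. ?g x < z" using nz(1) by (simp add: energy_range_eq)
  have slice: "(\<lambda>x. f (x, v)) real_analytic_on UNIV" if "v \<noteq> 0" for v
  proof (rule real_analytic_on_singletonI)
    fix x show "(\<lambda>x. f (x, v)) real_analytic_on {x}"
      using real_analytic2_dx(4)[OF f_analytic, of "(x, v)"] that by (auto simp: neq_iff)
  qed
  have P': "F1 real_analytic_on {z. \<exists>x. ?g x < z}" "F2 real_analytic_on {z. \<exists>x. ?g x < z}"
    "\<And>x v. v > 0 \<Longrightarrow> f (x, v) = F1 (v\<^sup>2 / 2 + ?g x)" "\<And>x v. v < 0 \<Longrightarrow> f (x, v) = F2 (v\<^sup>2 / 2 + ?g x)"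
    using P unfolding energy_profiles_def energy_range_eq energy_def by auto
  show ?thesis
  proof (cases "F1 z = 0")
    case False
    interpret energy_density "\<lambda>x v. f (x, v)" F1 ?g
    proof
      show "set_integrable lborel {0<..} (\<lambda>v. f (x, v))" for x
        unfolding set_integrable_def by (rule integrable_mult_indicator[OF _ slice_integrable]) simp
      show "(\<lambda>x. f (x, v)) real_analytic_on UNIV" if "v > 0" for v by (rule slice) (use that in simp)
    qed (use P' z False in auto)
    show ?thesis by (rule potential_analytic)
  next
    case True
    interpret energy_density "\<lambda>x v. f (x, - v)" F2 ?g
    proof
      show "set_integrable lborel {0<..} (\<lambda>v. f (x, - v))" for x
        unfolding set_integrable_def by (rule integrable_mult_indicator[OF _ slice_reflect_integrable]) simp
      show "f (x, - v) = F2 (v\<^sup>2 / 2 + ?g x)" if "v > 0" for x v using P'(4)[of "- v" x] that by simp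
      show "(\<lambda>x. f (x, - v)) real_analytic_on UNIV" if "v > 0" for v by (rule slice) (use that in simp)
      show "\<exists>z. (\<exists>x. ?g x < z) \<and> F2 z \<noteq> 0" using z True nz(2) by auto
    qed (use P' in auto)
    show ?thesis by (rule potential_analytic)
  qed
qed

text \<open>Unless both profiles vanish at \<open>z\<close>, the potential is analytic. On a ball
  where its derivative is nonzero the jump vanishes at all values of \<open>g\<close>. These values
  form a nondegenerate interval, so they accumulate and the identity theorem applies on the
  connected energy range.\<close>

lemma stationary_imp_match:
  assumes W: "weak_stationary_state \<Phi> f" and P: "energy_profiles \<Phi> f F1 F2"
  shows "profiles_match \<Phi> f F1 F2"
  unfolding profiles_match_def
proof (intro impI ballI)
  let ?g = "potential \<Phi> f"
  fix z assume nc: "\<not> ?g constant_on UNIV" and z: "z \<in> energy_range \<Phi> f"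
  have P': "F1 real_analytic_on {z. \<exists>x. ?g x < z}" "F2 real_analytic_on {z. \<exists>x. ?g x < z}"
    "\<And>x v. v > 0 \<Longrightarrow> f (x, v) = F1 (v\<^sup>2 / 2 + ?g x)" "\<And>x v. v < 0 \<Longrightarrow> f (x, v) = F2 (v\<^sup>2 / 2 + ?g x)"
    using P unfolding energy_profiles_def energy_range_eq energy_def by auto
  show "F1 z = F2 z"
  proof (cases "F1 z = 0 \<and> F2 z = 0")
    case False
    then have ga: "?g real_analytic_on UNIV" using profiles_imp_analytic_potential[OF P z] by blast
    have gc: "continuous_on UNIV ?g" by (rule real_analytic_on_continuous_on[OF ga])
    have gd: "(?g has_real_derivative deriv ?g x) (at x)" for x by (rule real_analytic_on_has_deriv[OF ga]) simp
    have "\<exists>x1. deriv ?g x1 \<noteq> 0"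
    proof (rule ccontr)
      assume "\<nexists>x1. deriv ?g x1 \<noteq> 0"
      then have "(?g has_real_derivative 0) (at x)" for x using gd[of x] by simp
      then show False using constant_on_UNIV_of_deriv_zero nc by blast
    qed
    then obtain x1 where x1: "deriv ?g x1 \<noteq> 0" by blast
    have opn: "open {x. deriv ?g x \<noteq> 0}"
      by (intro open_Collect_neq real_analytic_on_continuous_on[OF real_analytic_on_deriv[OF ga]] continuous_on_const)
    obtain e where e: "e > 0" "ball x1 e \<subseteq> {x. deriv ?g x \<noteq> 0}"
      using openE[OF opn, of x1] x1 by auto
    have e2: "deriv ?g x \<noteq> 0" if "x \<in> ball x1 e" for x using e(2) that by blast
    \<comment> \<open>A point with nonzero derivative is not a minimum, so a strictly lower value of
      \<open>g\<close> exists, as the jump relation requires.\<close>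
    have low: "\<exists>y. ?g y < ?g x" if "x \<in> ball x1 e" for x
    proof (rule ccontr)
      assume "\<nexists>y. ?g y < ?g x"
      then have "\<forall>y. \<bar>x - y\<bar> < 1 \<longrightarrow> ?g x \<le> ?g y" by (meson not_le)
      then have "deriv ?g x = 0" by (intro DERIV_local_min[OF gd zero_less_one])
      then show False using e2[OF that] by simp
    qed
    have D0: "F1 (?g x) - F2 (?g x) = 0" if x: "x \<in> ball x1 e" for x
    proof -
      obtain y where "?g y < ?g x" using low[OF x] by blast
      from profile_jump_deriv_zero[OF W refl gc P' this gd[of x]] e2[OF x] show ?thesis by simp
    qed
    let ?S = "?g ` ball x1 e"
    have "connected ?S"
      by (intro connected_continuous_image continuous_on_subset[OF gc]) auto
    moreover have "\<not> (\<exists>s. ?S = {s})"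
    proof
      assume "\<exists>s. ?S = {s}"
      then obtain s where "?S = {s}" by blast
      then have s: "?g x = s" if "x \<in> ball x1 e" for x using that by blast
      have "((\<lambda>_. s) has_real_derivative 0) (at x1)" by simp
      then have "(?g has_real_derivative 0) (at x1)"
        by (rule has_field_derivative_transform_within_open[where S = "ball x1 e"]) (use s e(1) in auto)
      then show False using x1 DERIV_imp_deriv by blast
    qed
    moreover have "?g x1 \<in> ?S" using e(1) by simp
    ultimately have "?g x1 islimpt ?S" by (metis connected_imp_perfect)
    then have lim: "?g x1 islimpt {z. F1 z - F2 z = 0}" by (rule islimpt_subset) (use D0 in auto)
    let ?U = "{z. \<exists>x. ?g x < z}"
    have U: "open ?U" "connected ?U"
    proof -
      have "?U = (\<Union>x. {?g x<..})" by auto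
      then show "open ?U" by auto
      have "is_interval ?U" unfolding is_interval_1 by (blast intro: less_le_trans)
      then show "connected ?U" by (simp add: is_interval_connected_1)
    qed
    have "F1 z - F2 z = 0"
      by (rule real_analytic_identity[OF real_analytic_on_diff[OF P'(1,2)] U _ lim])
         (use low[of x1] e(1) z in \<open>auto simp: energy_range_eq\<close>)
    then show ?thesis by simp
  qed simp
qed

lemma profiles_imp_stationary:
  assumes P: "energy_profiles \<Phi> f F1 F2" and match: "profiles_match \<Phi> f F1 F2"
  shows "weak_stationary_state \<Phi> f"
proof -
  let ?g = "potential \<Phi> f"
  have P': "F1 real_analytic_on {z. \<exists>x. ?g x < z}" "F2 real_analytic_on {z. \<exists>x. ?g x < z}"
    "\<And>x v. v > 0 \<Longrightarrow> f (x, v) = F1 (v\<^sup>2 / 2 + ?g x)" "\<And>x v. v < 0 \<Longrightarrow> f (x, v) = F2 (v\<^sup>2 / 2 + ?g x)"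
    using P unfolding energy_profiles_def energy_range_eq energy_def by auto
  show ?thesis
  proof (cases "?g constant_on UNIV")
    case True
    then obtain m where m: "\<And>x. ?g x = m" unfolding constant_on_def by auto
    show ?thesis
    proof (rule constant_potential_stationary[OF m])
      fix x v :: real assume "v \<noteq> 0"
      then show "f (x, v) = f (0, v)" using P'(3,4)[of v] m by (cases "v > 0") auto
    qed
  next
    case nc: False
    \<comment> \<open>If both profiles vanished, \<open>f\<close> would be 0 off v = 0, so
      \<open>rho f = 0\<close> and the potential would be the constant
      \<open>\<Phi> 0\<close>.\<close>
    have "\<exists>z\<in>energy_range \<Phi> f. F1 z \<noteq> 0 \<or> F2 z \<noteq> 0"
    proof (rule ccontr)
      assume "\<not> ?thesis"
      then have z: "F1 z = 0" "F2 z = 0" if "?g x < z" for x z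
        using that by (auto simp: energy_range_eq)
      have "f (x, v) = 0" if "v \<noteq> 0" for x v
      proof -
        have "?g x < v\<^sup>2 / 2 + ?g x" using that by simp
        note z0 = z[OF this]
        from that consider "v > 0" | "v < 0" by linarith
        then show ?thesis by cases (simp_all add: P'(3,4) z0)
      qed
      then have "indicator {0<..} v *\<^sub>R (f (x, v) + f (x, - v)) = 0" for x v :: real
        by (simp add: indicator_def)
      then have "rho f x = 0" for x unfolding rho_eq_halflines(2) by (simp only: Bochner_Integration.integral_zero)
      then have "?g x = \<Phi> 0" for x by (simp add: potential_def)
      then show False using nc unfolding constant_on_def by blast
    qed
    then have ga: "?g real_analytic_on UNIV" using profiles_imp_analytic_potential[OF P] by blast
    have gd: "(?g has_real_derivative deriv ?g x) (at x)" for x by (rule real_analytic_on_has_deriv[OF ga]) simp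
    obtain x1 where x1: "deriv ?g x1 \<noteq> 0"
      using gd constant_on_UNIV_of_deriv_zero nc by metis
    \<comment> \<open>Critical values are images of zeros of \<open>deriv ?g\<close>, and these are
      countably many because that function is analytic and not identically zero.\<close>
    have crit: "countable {z. critical_value ?g z}"
    proof (rule countable_subset)
      show "{z. critical_value ?g z} \<subseteq> ?g ` {x. deriv ?g x = 0}"
        unfolding critical_value_def by (auto dest: DERIV_imp_deriv)
      show "countable (?g ` {x. deriv ?g x = 0})"
        by (intro countable_image countable_zeros_of_analytic[OF real_analytic_on_deriv[OF ga] x1])
    qed
    have F12: "F1 z = F2 z" if z: "?g y < z" for z y
    proof (rule ccontr)
      assume ne: "F1 z \<noteq> F2 z"
      have D: "(\<lambda>z. F1 z - F2 z) real_analytic_on {z. \<exists>x. ?g x < z}" by (rule real_analytic_on_diff[OF P'(1,2)])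
      have "isCont (\<lambda>z. F1 z - F2 z) z" by (rule real_analytic_on_isCont[OF D]) (use z in blast)
      moreover have "F1 z - F2 z \<noteq> 0" using ne by simp
      ultimately obtain d where d: "d > 0" "\<And>s. dist s z < d \<Longrightarrow> F1 s - F2 s \<noteq> 0"
        using continuous_at_avoid[of z "\<lambda>z. F1 z - F2 z" 0] by (metis dist_commute)
      \<comment> \<open>An inequality at \<open>z\<close> persists on an interval by continuity; by
        the matching condition that interval would consist of critical values, which are too
        few.\<close>
      have "{z<..<z + d} \<subseteq> {z. critical_value ?g z}"
      proof
        fix s assume s: "s \<in> {z<..<z + d}"
        then have "F1 s - F2 s \<noteq> 0" by (intro d(2)) (auto simp: dist_real_def)
        moreover have "s \<in> energy_range \<Phi> f" unfolding energy_range_eq using s z by (auto intro!: exI[of _ y])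
        ultimately show "s \<in> {z. critical_value ?g z}" using match nc unfolding profiles_match_def by auto
      qed
      then have "countable {z<..<z + d}" using crit countable_subset by blast
      then show False using uncountable_open_interval[of z "z + d"] d(1) by simp
    qed
    interpret even_density f F1 ?g
    proof
      fix x v :: real assume v: "v \<noteq> 0"
      have "F2 (v\<^sup>2 / 2 + ?g x) = F1 (v\<^sup>2 / 2 + ?g x)" by (rule F12[symmetric, of x]) (use v in simp)
      then show "f (x, v) = F1 (v\<^sup>2 / 2 + ?g x)" using P'(3,4)[of v x] v by (cases "v > 0") auto
    qed (use P'(1) ga nc in auto)
    show ?thesis by (rule even_density_stationary[OF refl])
  qed
qed

end

theorem proposition5p5:
  fixes \<Phi> :: "real \<Rightarrow> real" and c :: "nat \<Rightarrow> real" and R :: real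
    and f :: "real \<times> real \<Rightarrow> real"
  assumes R_pos: "R > 0"
    and Phi_analytic: "\<And>z. \<bar>z\<bar> < R \<Longrightarrow> (\<lambda>n. c n * z ^ n) sums \<Phi> z"
    and f_analytic: "f real_analytic2_on {(x, v). v < 0} \<union> {(x, v). v > 0}"
    and f_integrable: "\<And>x. integrable lebesgue (\<lambda>v. f (x, v))"
    and rho_analytic: "rho f real_analytic_on UNIV"
  shows "(weak_stationary_state \<Phi> f \<longleftrightarrow>
            (\<exists>F1 F2. energy_profiles \<Phi> f F1 F2 \<and> profiles_match \<Phi> f F1 F2)) \<and>
         (\<forall>F1 F2. energy_profiles \<Phi> f F1 F2 \<longrightarrow>
            (\<forall>x. set_integrable lebesgue {0<..}
                   (\<lambda>v. F1 (v\<^sup>2 / 2 + \<Phi> (rho f x)) + F2 (v\<^sup>2 / 2 + \<Phi> (rho f x))) \<and>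
                 rho f x = (LINT v:{0<..}|lebesgue.
                   F1 (v\<^sup>2 / 2 + \<Phi> (rho f x)) + F2 (v\<^sup>2 / 2 + \<Phi> (rho f x)))) \<and>
            (weak_stationary_state \<Phi> f \<longrightarrow> profiles_match \<Phi> f F1 F2))"
proof -
  interpret analytic_density f
    by unfold_locales (fact f_analytic, fact f_integrable)
  show ?thesis
  proof (intro conjI allI impI iffI)
    assume W: "weak_stationary_state \<Phi> f"
    obtain F1 F2 where P: "energy_profiles \<Phi> f F1 F2" by (rule stationary_imp_profiles[OF W])
    then show "\<exists>F1 F2. energy_profiles \<Phi> f F1 F2 \<and> profiles_match \<Phi> f F1 F2"
      using stationary_imp_match[OF W P] by blast
  next
    assume "\<exists>F1 F2. energy_profiles \<Phi> f F1 F2 \<and> profiles_match \<Phi> f F1 F2"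
    then show "weak_stationary_state \<Phi> f" using profiles_imp_stationary by blast
  next
    fix F1 F2 x assume P: "energy_profiles \<Phi> f F1 F2"
    show "set_integrable lebesgue {0<..} (\<lambda>v. F1 (v\<^sup>2 / 2 + \<Phi> (rho f x)) + F2 (v\<^sup>2 / 2 + \<Phi> (rho f x)))"
      by (rule profiles_rho(1)[OF P])
    show "rho f x = (LINT v:{0<..}|lebesgue. F1 (v\<^sup>2 / 2 + \<Phi> (rho f x)) + F2 (v\<^sup>2 / 2 + \<Phi> (rho f x)))"
      by (rule profiles_rho(2)[OF P])
  next
    fix F1 F2 assume "energy_profiles \<Phi> f F1 F2" "weak_stationary_state \<Phi> f"
    then show "profiles_match \<Phi> f F1 F2" using stationary_imp_match by blast
  qed
qed

end
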